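(* Suppose that the $\mathrm{LWE}_{n,q,G(\sigma,\tau)}$ problem is hard. If Alice follows Protocol $\mathbf{Q}$ (described in the context) and Bob is an efficient classical prover, i.e. in step 2 Bob computes $(y,u,p)\leftarrow\mathrm{FirstResponse}(pk,ct)$, sends $(y,u)$ and keeps the classical string $p$ in memory, and in step 4 he computes and sends $d'\leftarrow\mathrm{SecondResponse}(b',p)$, where $\mathrm{FirstResponse}$ and $\mathrm{SecondResponse}$ are non-uniform probabilistic polynomial-time (classical) algorithms, then $$\Pr[\text{success}]\;\le\;\frac34+\mathrm{negl}(\lambda)$$ for some negligible function $\mathrm{negl}$.
   Context: **Parameters.** $\lambda\ge 1$ is the security parameter; $n,m,q,Q,\sigma,\tau$ are functions of $\lambda$ such that: $\log q$ and $\log\sigma$ are polynomially bounded in $\lambda$ ($\log$ is base 2); $\sigma\ge 1$; $q$ is an odd prime; $Q=\lceil\log q\rceil$; $n=\lambda$; $m=n(2Q+1)$; $\tau=q/(4mQ)$. A function $f:\mathbb{N}\to\mathbb{R}_{\ge0}$ is negligible if it is $O(\lambda^{-C})$ for all $C>0$. **Notation.** $\mathbb{Z}_q=\{0,\dots,q-1\}$ with arithmetic mod $q$; $|x|=\min\{x,q-x\}$ for $x\in\mathbb{Z}_q$; $\|v\|_\infty=\max_i|v_i|$. For $k\in\mathbb{Z}_q$, $[k]\in\{0,1\}^Q$ is its binary representation, least significant bit first; for $x\in\mathbb{Z}_q^n$, $[x]\in\{0,1\}^{nQ}$ is the concatenation of $[x_1],\dots,[x_n]$. $\oplus$ is bitwise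 XOR and $u\cdot z$ for bit strings is the inner product mod 2. $x\leftarrow S$ means uniform sampling from the finite set $S$, and $x\leftarrow\chi$ sampling from the distribution $\chi$. $G(s)$ ($s>0$) is the discrete Gaussian on $\mathbb{Z}$, with $P(X=x)\propto e^{-x^2/(2s^2)}$; $G(s,t)$ is $G(s)$ conditioned on $|X|\le t$; $\chi^m$ denotes $m$ independent samples. **LWE hardness.** In the $\mathrm{LWE}_{n,q,\chi}$ problem, a bit $\beta\leftarrow\{0,1\}$ and a secret $s\leftarrow\mathbb{Z}_q^n$ are sampled once. The solver gets oracle access to samples of $\mathcal{D}_\beta$, where $\mathcal{D}_0$ is the distribution of $(a,a\cdot s+e)$ with $a\leftarrow\mathbb{Z}_q^n$, $e\leftarrow\chi$ fresh for each sample, and $\mathcal{D}_1$ is uniform on $\mathbb{Z}_q^n\times\mathbb{Z}_q$; it must determine $\beta$. "Hard" means that every non-uniform quantum polynomial-time algorithm (family of quantum circuits of size polynomial in $\lambda$) succeeds with probability at most $\frac12+\mathrm{negl}(\lambda)$. **Trapdoors.** $\mathrm{GenTrap}()$ is a fixed probabilistic polynomial-time algorithm and $\mathrm{Invert}$ a fixed deterministic polynomial-time algorithm (always returning an element of $\mathbb{Z}_q^n$) such that: (1) $\mathrm{GenTrap}()$ returns $(A,t)$ with $A\in\mathbb{Z}_q^{m\times n}$ within statistical distance $nQ2^{-n/2}$ of uniform; (2) for every output $(A,t)$ of $\mathrm{GenTrap}()$, every $s\in\mathbb{Z}_q^n$ and every $e\in\mathbb{Z}_q^m$ with $\|e\|_\infty\le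 2\tau$, $\mathrm{Invert}(A,As+e,t)=s$. **Protocol Q.** 1. Alice samples $s\leftarrow\mathbb{Z}_q^n$, $e\leftarrow G(\sigma,\tau)^m$ (reduced mod $q$), $(A,t)\leftarrow\mathrm{GenTrap}()$, and sets $v=As+e$, $pk=(A,v)$. She samples $b\leftarrow\{0,1\}$, $f\leftarrow\{0,1\}^m$ and sets $ct=(a,w)$ with $a=f^\top A\in\mathbb{Z}_q^n$, $w=f^\top v+b\lfloor q/4\rfloor\in\mathbb{Z}_q$. She sends $(pk,ct)$ to Bob. 2. Bob returns $(y,u)$ with $y\in\mathbb{Z}_q^m$, $u\in\{0,1\}^{nQ}$. 3. Alice samples $b'\leftarrow\{0,1\}$ and sends it to Bob. 4. Bob returns a bit $d'$. 5. Alice computes $x_0=\mathrm{Invert}(A,y,t)$, $x_1=\mathrm{Invert}(A,y+v,t)$ and $d=u\cdot([x_0]\oplus[x_1])$. 6. Success occurs iff $d\oplus d'=b\wedge b'$. *)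

theory Defs
  imports
    "HOL-Probability.Probability"
    "Jordan_Normal_Form.Matrix"
begin

(* HOL-Analysis and Jordan_Normal_Form both use the notation for vector components and for the
   scalar product; here it is always that of Jordan_Normal_Form. *)
unbundle no vec_syntax
no_notation inner (infix "\<bullet>" 70)
hide_type (open) Finite_Cartesian_Product.vec
hide_const (open) Finite_Cartesian_Product.vec Finite_Cartesian_Product.mat

section \<open>Asymptotics\<close>

definition negligible_fun :: "(nat \<Rightarrow> real) \<Rightarrow> bool" where
  "negligible_fun f \<longleftrightarrow>
     (\<forall>l. 0 \<le> f l) \<and> (\<forall>C::real. C > 0 \<longrightarrow> f \<in> O(\<lambda>l. real l powr - C))"

definition poly_bounded :: "(nat \<Rightarrow> real) \<Rightarrow> bool" where
  "poly_bounded f \<longleftrightarrow> (\<exists>k::nat. f \<in> O(\<lambda>l. real l ^ k))"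

section \<open>Parameters\<close>

definition Qlen :: "nat \<Rightarrow> nat" where
  "Qlen q = nat \<lceil>log 2 (real q)\<rceil>"

definition mdim :: "nat \<Rightarrow> nat \<Rightarrow> nat" where
  "mdim n q = n * (2 * Qlen q + 1)"

definition tau :: "nat \<Rightarrow> nat \<Rightarrow> real" where
  "tau n q = real q / (4 * real (mdim n q) * real (Qlen q))"

section \<open>Vectors and matrices over the integers mod q\<close>

(* Elements of Z_q are the integers 0, ..., q-1; results of integer arithmetic are reduced
   explicitly with modv. *)

definition Zq :: "nat \<Rightarrow> int set" where
  "Zq q = {0..<int q}"

definition Zq_vec :: "nat \<Rightarrow> nat \<Rightarrow> int vec set" where
  "Zq_vec q n = {v \<in> carrier_vec n. \<forall>i<n. v $ i \<in> Zq q}"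

definition Zq_mat :: "nat \<Rightarrow> nat \<Rightarrow> nat \<Rightarrow> int mat set" where
  "Zq_mat q m n = {A \<in> carrier_mat m n. \<forall>i<m. \<forall>j<n. A $$ (i, j) \<in> Zq q}"

definition modv :: "nat \<Rightarrow> int vec \<Rightarrow> int vec" where
  "modv q v = map_vec (\<lambda>x. x mod int q) v"

definition zq_abs :: "nat \<Rightarrow> int \<Rightarrow> int" where
  "zq_abs q x = min x (int q - x)"

definition linf_norm :: "nat \<Rightarrow> int vec \<Rightarrow> int" where
  "linf_norm q v = Max ((\<lambda>i. zq_abs q (v $ i)) ` {..<dim_vec v})"

definition binary_vecs :: "nat \<Rightarrow> int vec set" where
  "binary_vecs m = {f \<in> carrier_vec m. \<forall>i<m. f $ i \<in> {0, 1}}"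

section \<open>Bit strings\<close>

(* All binary representations have the least significant bit first. *)

definition enc_int :: "nat \<Rightarrow> int \<Rightarrow> bool list" where
  "enc_int q k = map (bit k) [0..<Qlen q]"

definition enc_vec :: "nat \<Rightarrow> int vec \<Rightarrow> bool list" where
  "enc_vec q v = concat (map (enc_int q) (list_of_vec v))"

definition enc_mat :: "nat \<Rightarrow> int mat \<Rightarrow> bool list" where
  "enc_mat q A = concat (map (enc_vec q) (rows A))"

(* Left inverse of enc_vec q on Zq_vec q n. A block that represents a number in q..2^Q-1, which is
   not the code of an element of Z_q, is read modulo q. *)
definition dec_vec :: "nat \<Rightarrow> nat \<Rightarrow> bool list \<Rightarrow> int vec" where
  "dec_vec q n bs =
     vec n (\<lambda>i. horner_sum of_bool 2 (take (Qlen q) (drop (i * Qlen q) bs)) mod int q)"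

definition xor_bits :: "bool list \<Rightarrow> bool list \<Rightarrow> bool list" where
  "xor_bits = map2 (\<noteq>)"

definition dot_bits :: "bool list \<Rightarrow> bool list \<Rightarrow> bool" where
  "dot_bits u z = odd (\<Sum>(x, y)\<leftarrow>zip u z. of_bool (x \<and> y) :: nat)"

section \<open>Distributions\<close>

definition coin :: "bool pmf" where
  "coin = pmf_of_set UNIV"

definition discrete_gaussian :: "real \<Rightarrow> int pmf" where
  "discrete_gaussian s = embed_pmf (\<lambda>x.
     exp (- (real_of_int x)\<^sup>2 / (2 * s\<^sup>2)) / (\<Sum>\<^sub>\<infinity>y::int. exp (- (real_of_int y)\<^sup>2 / (2 * s\<^sup>2))))"

definition trunc_gaussian :: "real \<Rightarrow> real \<Rightarrow> int pmf" where
  "trunc_gaussian s t = cond_pmf (discrete_gaussian s) {x. \<bar>real_of_int x\<bar> \<le> t}"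

definition iid_vec :: "nat \<Rightarrow> int pmf \<Rightarrow> int vec pmf" where
  "iid_vec m \<chi> = map_pmf vec_of_list (replicate_pmf m \<chi>)"

definition stat_dist :: "'a pmf \<Rightarrow> 'a pmf \<Rightarrow> real" where
  "stat_dist P R = (\<Sum>\<^sub>\<infinity>x. \<bar>pmf P x - pmf R x\<bar>) / 2"

section \<open>Uniform polynomial time: probabilistic Turing machines\<close>

(* A machine maps (state, scanned symbol, coin toss) to (new state, written symbol, head move).
   State 0 is halting and state 1 initial; symbol 0 is the blank and the symbols 1 and 2 stand for
   the bits 0 and 1. The number K bounds both the states and the symbols. *)
type_synonym tm = "nat \<Rightarrow> nat \<Rightarrow> bool \<Rightarrow> nat \<times> nat \<times> int"
type_synonym tm_config = "nat \<times> (int \<Rightarrow> nat) \<times> int"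

definition finite_tm :: "nat \<Rightarrow> tm \<Rightarrow> bool" where
  "finite_tm K \<delta> \<longleftrightarrow> K \<ge> 3 \<and>
     (\<forall>s<K. \<forall>a<K. \<forall>c. case \<delta> s a c of (s', a', d) \<Rightarrow> s' < K \<and> a' < K \<and> d \<in> {-1, 0, 1})"

definition tm_init :: "bool list \<Rightarrow> tm_config" where
  "tm_init x =
     (1, \<lambda>i. if 0 \<le> i \<and> i < int (length x) then (if x ! nat i then 2 else 1) else 0, 0)"

fun tm_step :: "tm \<Rightarrow> bool \<Rightarrow> tm_config \<Rightarrow> tm_config" where
  "tm_step \<delta> c (s, tape, h) =
     (if s = 0 then (s, tape, h)
      else case \<delta> s (tape h) c of (s', a', d) \<Rightarrow> (s', tape(h := a'), h + d))"

primrec tm_run :: "tm \<Rightarrow> nat \<Rightarrow> tm_config \<Rightarrow> tm_config pmf" where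
  "tm_run \<delta> 0 cfg = return_pmf cfg"
| "tm_run \<delta> (Suc t) cfg = do { c \<leftarrow> coin; tm_run \<delta> t (tm_step \<delta> c cfg) }"

definition tm_halted :: "tm_config \<Rightarrow> bool" where
  "tm_halted cfg \<longleftrightarrow> fst cfg = 0"

(* The output is the maximal block of bits that starts in cell 0. *)
fun tm_output :: "tm_config \<Rightarrow> bool list" where
  "tm_output (s, tape, h) =
     map (\<lambda>i. tape (int i) = 2) [0..<(LEAST i. tape (int i) \<notin> {1, 2})]"

definition tm_computes :: "tm \<Rightarrow> (bool list \<Rightarrow> bool list pmf) \<Rightarrow> bool" where
  "tm_computes \<delta> F \<longleftrightarrow> (\<exists>K c k. finite_tm K \<delta> \<and>
     (\<forall>x. let R = tm_run \<delta> (c * length x ^ k + c) (tm_init x) in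
        (\<forall>cfg \<in> set_pmf R. tm_halted cfg) \<and> map_pmf tm_output R = F x))"

definition prob_poly_time :: "(bool list \<Rightarrow> bool list pmf) \<Rightarrow> bool" where
  "prob_poly_time F \<longleftrightarrow> (\<exists>\<delta>. tm_computes \<delta> F)"

definition det_poly_time :: "(bool list \<Rightarrow> bool list) \<Rightarrow> bool" where
  "det_poly_time f \<longleftrightarrow>
     (\<exists>\<delta>. (\<forall>s a. \<delta> s a True = \<delta> s a False) \<and> tm_computes \<delta> (\<lambda>x. return_pmf (f x)))"

section \<open>Non-uniform classical algorithms: probabilistic Boolean circuits\<close>

(* Straight-line programs: every gate appends one bit to the list of wires computed so far, which
   initially consists of the input bits. A circuit also lists its output wires. *)
datatype gate = Coin | Nand nat nat
type_synonym circuit = "gate list \<times> nat list"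

fun wf_circuit :: "nat \<Rightarrow> nat \<Rightarrow> circuit \<Rightarrow> bool" where
  "wf_circuit n_in n_out (gs, outs) \<longleftrightarrow>
     (\<forall>k<length gs. case gs ! k of Coin \<Rightarrow> True | Nand i j \<Rightarrow> i < n_in + k \<and> j < n_in + k) \<and>
     length outs = n_out \<and> (\<forall>i \<in> set outs. i < n_in + length gs)"

fun circuit_size :: "circuit \<Rightarrow> nat" where
  "circuit_size (gs, outs) = length gs + length outs"

primrec run_gates :: "gate list \<Rightarrow> bool list \<Rightarrow> bool list pmf" where
  "run_gates [] w = return_pmf w"
| "run_gates (g # gs) w = (case g of
     Coin \<Rightarrow> do { c \<leftarrow> coin; run_gates gs (w @ [c]) }
   | Nand i j \<Rightarrow> run_gates gs (w @ [\<not> (w ! i \<and> w ! j)]))"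

fun run_circuit :: "circuit \<Rightarrow> bool list \<Rightarrow> bool list pmf" where
  "run_circuit (gs, outs) x = map_pmf (\<lambda>w. map ((!) w) outs) (run_gates gs x)"

definition nonuniform_ppt :: "(nat \<Rightarrow> nat) \<Rightarrow> (nat \<Rightarrow> nat) \<Rightarrow> (nat \<Rightarrow> circuit) \<Rightarrow> bool" where
  "nonuniform_ppt n_in n_out C \<longleftrightarrow>
     (\<forall>l\<ge>1. wf_circuit (n_in l) (n_out l) (C l)) \<and> poly_bounded (\<lambda>l. real (circuit_size (C l)))"

section \<open>Quantum circuits with access to a sample oracle\<close>

(* A computational basis state of N qubits is a function nat => bool that is False from N on; a
   state vector assigns an amplitude to each basis state. The gate Sample k draws a fresh sample
   from the oracle and XORs its bits into the qubits k, k+1, ... (so that it writes the sample when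
   these qubits are zero). Intermediate measurements can be deferred to the end of a circuit. *)
type_synonym qstate = "(nat \<Rightarrow> bool) \<Rightarrow> complex"

datatype qgate = Had nat | Tgate nat | Not nat | CNot nat nat | Toffoli nat nat nat | Sample nat

definition apply_had :: "nat \<Rightarrow> qstate \<Rightarrow> qstate" where
  "apply_had i \<psi> = (\<lambda>x.
     (\<psi> (x(i := False)) + (if x i then - 1 else 1) * \<psi> (x(i := True))) / complex_of_real (sqrt 2))"

definition apply_T :: "nat \<Rightarrow> qstate \<Rightarrow> qstate" where
  "apply_T i \<psi> = (\<lambda>x. (if x i then cis (pi / 4) else 1) * \<psi> x)"

(* The remaining gates permute the basis states by involutions. *)

definition apply_toffoli :: "nat set \<Rightarrow> nat \<Rightarrow> qstate \<Rightarrow> qstate" where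
  "apply_toffoli ctrl i \<psi> = (\<lambda>x. \<psi> (x(i := (x i \<noteq> (\<forall>c\<in>ctrl. x c)))))"

definition apply_xor :: "nat \<Rightarrow> bool list \<Rightarrow> qstate \<Rightarrow> qstate" where
  "apply_xor k z \<psi> =
     (\<lambda>x. \<psi> (\<lambda>i. if k \<le> i \<and> i < k + length z then x i \<noteq> z ! (i - k) else x i))"

primrec apply_gate :: "bool list pmf \<Rightarrow> qgate \<Rightarrow> qstate \<Rightarrow> qstate pmf" where
  "apply_gate D (Had i) \<psi> = return_pmf (apply_had i \<psi>)"
| "apply_gate D (Tgate i) \<psi> = return_pmf (apply_T i \<psi>)"
| "apply_gate D (Not i) \<psi> = return_pmf (apply_toffoli {} i \<psi>)"
| "apply_gate D (CNot c i) \<psi> = return_pmf (apply_toffoli {c} i \<psi>)"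
| "apply_gate D (Toffoli c c' i) \<psi> = return_pmf (apply_toffoli {c, c'} i \<psi>)"
| "apply_gate D (Sample k) \<psi> = map_pmf (\<lambda>z. apply_xor k z \<psi>) D"

primrec run_qgates :: "bool list pmf \<Rightarrow> qgate list \<Rightarrow> qstate \<Rightarrow> qstate pmf" where
  "run_qgates D [] \<psi> = return_pmf \<psi>"
| "run_qgates D (g # gs) \<psi> = do { \<psi>' \<leftarrow> apply_gate D g \<psi>; run_qgates D gs \<psi>' }"

(* A number of qubits and a list of gates. All qubits start as zero, qubit 0 is measured. *)
type_synonym qcircuit = "nat \<times> qgate list"

primrec wf_qgate :: "nat \<Rightarrow> nat \<Rightarrow> qgate \<Rightarrow> bool" where
  "wf_qgate len N (Had i) \<longleftrightarrow> i < N"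
| "wf_qgate len N (Tgate i) \<longleftrightarrow> i < N"
| "wf_qgate len N (Not i) \<longleftrightarrow> i < N"
| "wf_qgate len N (CNot c i) \<longleftrightarrow> c < N \<and> i < N \<and> c \<noteq> i"
| "wf_qgate len N (Toffoli c c' i) \<longleftrightarrow> c < N \<and> c' < N \<and> i < N \<and> distinct [c, c', i]"
| "wf_qgate len N (Sample k) \<longleftrightarrow> k + len \<le> N"

(* len is the length of the oracle's samples *)
fun wf_qcircuit :: "nat \<Rightarrow> qcircuit \<Rightarrow> bool" where
  "wf_qcircuit len (N, gs) \<longleftrightarrow> 0 < N \<and> (\<forall>g \<in> set gs. wf_qgate len N g)"

fun qcircuit_size :: "qcircuit \<Rightarrow> nat" where
  "qcircuit_size (N, gs) = N + length gs"

definition zero_state :: qstate where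
  "zero_state = (\<lambda>x. if x = (\<lambda>_. False) then 1 else 0)"

definition measure_qubit0 :: "nat \<Rightarrow> qstate \<Rightarrow> bool pmf" where
  "measure_qubit0 N \<psi> = bernoulli_pmf (\<Sum>x | x 0 \<and> (\<forall>i\<ge>N. \<not> x i). (cmod (\<psi> x))\<^sup>2)"

fun run_qcircuit :: "bool list pmf \<Rightarrow> qcircuit \<Rightarrow> bool pmf" where
  "run_qcircuit D (N, gs) = do { \<psi> \<leftarrow> run_qgates D gs zero_state; measure_qubit0 N \<psi> }"

section \<open>Learning with errors\<close>

definition lwe_dist :: "nat \<Rightarrow> nat \<Rightarrow> int pmf \<Rightarrow> int vec \<Rightarrow> (int vec \<times> int) pmf" where
  "lwe_dist n q \<chi> s = do {
     a \<leftarrow> pmf_of_set (Zq_vec q n);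
     e \<leftarrow> \<chi>;
     return_pmf (a, (a \<bullet> s + e) mod int q) }"

definition lwe_unif :: "nat \<Rightarrow> nat \<Rightarrow> (int vec \<times> int) pmf" where
  "lwe_unif n q = pmf_of_set (Zq_vec q n \<times> Zq q)"

definition enc_sample :: "nat \<Rightarrow> int vec \<times> int \<Rightarrow> bool list" where
  "enc_sample q = (\<lambda>(a, w). enc_vec q a @ enc_int q w)"

(* The result tells whether the solver determines \<beta>; here \<beta> = True selects the uniform samples. *)
definition lwe_experiment :: "nat \<Rightarrow> nat \<Rightarrow> int pmf \<Rightarrow> qcircuit \<Rightarrow> bool pmf" where
  "lwe_experiment n q \<chi> C = do {
     \<beta> \<leftarrow> coin;
     s \<leftarrow> pmf_of_set (Zq_vec q n);
     \<beta>' \<leftarrow> run_qcircuit (map_pmf (enc_sample q) (if \<beta> then lwe_unif n q else lwe_dist n q \<chi> s)) C;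
     return_pmf (\<beta>' = \<beta>) }"

definition lwe_hard :: "(nat \<Rightarrow> nat) \<Rightarrow> (nat \<Rightarrow> nat) \<Rightarrow> (nat \<Rightarrow> int pmf) \<Rightarrow> bool" where
  "lwe_hard n q \<chi> \<longleftrightarrow> (\<forall>C :: nat \<Rightarrow> qcircuit.
     (\<forall>l\<ge>1. wf_qcircuit ((n l + 1) * Qlen (q l)) (C l)) \<and>
     poly_bounded (\<lambda>l. real (qcircuit_size (C l))) \<longrightarrow>
     (\<exists>\<epsilon>. negligible_fun \<epsilon> \<and>
        (\<forall>l\<ge>1. pmf (lwe_experiment (n l) (q l) (\<chi> l) (C l)) True \<le> 1/2 + \<epsilon> l)))"

section \<open>Trapdoors\<close>

(* The algorithms are indexed by the security parameter l = n. They get the implicit parameters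
   n (in unary) and q (in binary) as input; the unary Q makes the encoding self-delimiting.
   Trapdoors are arbitrary bit strings. *)

definition enc_params :: "nat \<Rightarrow> nat \<Rightarrow> bool list" where
  "enc_params n q =
     replicate n True @ [False] @ replicate (Qlen q) True @ [False] @ enc_int q (int q)"

definition gentrap_poly_time :: "(nat \<Rightarrow> nat) \<Rightarrow> (nat \<Rightarrow> (int mat \<times> bool list) pmf) \<Rightarrow> bool" where
  "gentrap_poly_time q GenTrap \<longleftrightarrow> (\<exists>F. prob_poly_time F \<and>
     (\<forall>l\<ge>1. F (enc_params l (q l)) = map_pmf (\<lambda>(A, t). enc_mat (q l) A @ t) (GenTrap l)))"

definition invert_poly_time ::
  "(nat \<Rightarrow> nat) \<Rightarrow> (nat \<Rightarrow> int mat \<Rightarrow> int vec \<Rightarrow> bool list \<Rightarrow> int vec) \<Rightarrow> bool" where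
  "invert_poly_time q Invert \<longleftrightarrow> (\<exists>f. det_poly_time f \<and>
     (\<forall>l\<ge>1. \<forall>A \<in> Zq_mat (q l) (mdim l (q l)) l. \<forall>y \<in> Zq_vec (q l) (mdim l (q l)). \<forall>t.
        f (enc_params l (q l) @ enc_mat (q l) A @ enc_vec (q l) y @ t) =
          enc_vec (q l) (Invert l A y t)))"

section \<open>Protocol Q\<close>

fun protocol_Q :: "nat \<Rightarrow> nat \<Rightarrow> real \<Rightarrow>
    (int mat \<times> bool list) pmf \<Rightarrow> (int mat \<Rightarrow> int vec \<Rightarrow> bool list \<Rightarrow> int vec) \<Rightarrow>
    circuit \<Rightarrow> circuit \<Rightarrow> bool pmf" where
  "protocol_Q n q \<sigma> GenTrap Invert FirstResponse SecondResponse =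
    (let Q = Qlen q; m = mdim n q in do {
      s \<leftarrow> pmf_of_set (Zq_vec q n);
      e \<leftarrow> iid_vec m (trunc_gaussian \<sigma> (tau n q));
      (A, t) \<leftarrow> GenTrap;
      let v = modv q (A *\<^sub>v s + e);
      b \<leftarrow> coin;
      f \<leftarrow> pmf_of_set (binary_vecs m);
      let a = modv q (transpose_mat A *\<^sub>v f);
      let w = (f \<bullet> v + of_bool b * \<lfloor>real q / 4\<rfloor>) mod int q;
      r \<leftarrow> run_circuit FirstResponse (enc_mat q A @ enc_vec q v @ enc_vec q a @ enc_int q w);
      let y = dec_vec q m (take (m * Q) r);
      let u = take (n * Q) (drop (m * Q) r);
      let p = drop (m * Q + n * Q) r;
      b' \<leftarrow> coin;
      r' \<leftarrow> run_circuit SecondResponse (b' # p);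
      let d' = hd r';
      let x0 = Invert A y t;
      let x1 = Invert A (modv q (y + v)) t;
      let d = dot_bits u (xor_bits (enc_vec q x0) (enc_vec q x1));
      return_pmf ((d \<noteq> d') = (b \<and> b'))
    })"

end

theory Submission
  imports Defs "HOL-Real_Asymp.Real_Asymp"
begin

text \<open>A classical prover can be rewound: after the first message, run the second response on both
  challenges. If it answered both correctly, the exclusive or of the answers would be the encrypted
  bit \<open>b\<close>, so a success probability \<open>p\<close> yields a guess of \<open>b\<close> from \<open>pk\<close> and \<open>ct\<close> that is correct
  with probability at least \<open>2 p - 1\<close>. Replace \<open>A\<close> by a uniform matrix, then (by LWE) \<open>v\<close> by a
  uniform vector; now \<open>ct\<close> consists of a random subset sum of uniform vectors, plus a multiple of \<open>b\<close>,
  and is close to uniform by the leftover hash lemma, so that the guess succeeds with probability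
  \<open>1 / 2\<close> up to a negligible error. The LWE solver must be an oracle circuit of Hadamard, Toffoli etc.
  gates: it draws \<open>m\<close> samples, computes the ciphertext by ripple-carry adders, and runs the prover's
  circuits, every coin being a Hadamard gate on a fresh qubit, which creates no interference.\<close>

section \<open>Composition of probabilistic circuits\<close>

text \<open>The bit \<open>d\<close> depends on the key, the trapdoor and the first answer, but not
  on the challenge. So the same \<open>d\<close> enters both checks and cancels when they are
  combined, whatever \<open>Invert\<close> returns. The guess never touches the trapdoor, so
  exchanging \<open>A\<close> for a uniform matrix costs only the statistical distance. The constant
  3/4 solves \<open>2 p - 1 = 1 / 2\<close>. Everything is moved into the group of vectors of length
  \<open>n + 1\<close> over Z_q. Row \<open>i\<close> of the key is row \<open>i\<close> of
  \<open>A\<close> followed by entry \<open>i\<close> of \<open>v\<close>; for uniform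
  \<open>A\<close> this is one LWE sample. The ciphertext is the sum of the rows selected by
  \<open>f\<close>, shifted by \<open>b\<close> times the vector with last entry floor(q/4) and
  zeros elsewhere. Encryption is then a loop of masked additions, and the hash lemma concerns one
  abelian group of order q^(n+1). The choice m = n (2 Q + 1) makes 2^m at least 2^n q^(n+1).
  Hardness speaks of circuit families of polynomial size, so efficiency has to be proved as well:
  every construction carries an explicit size bound, and growth is examined once, for
  \<open>solver_size\<close>.\<close>

lemma run_gates_append:
  "run_gates (gs @ hs) w = run_gates gs w \<bind> run_gates hs"
proof (induction gs arbitrary: w)
  case (Cons g gs)
  then show ?case
    by (cases g) (simp_all add: bind_assoc_pmf)
qed (simp add: bind_return_pmf)

lemma set_run_gates:
  "w' \<in> set_pmf (run_gates gs w) \<Longrightarrow> \<exists>u. w' = w @ u \<and> length u = length gs"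
proof (induction gs arbitrary: w w')
  case (Cons g gs)
  then show ?case
    by (cases g) (fastforce simp: Suc_length_conv dest!: Cons.IH)+
qed simp

lemma length_run_gates:
  "w' \<in> set_pmf (run_gates gs w) \<Longrightarrow> length w' = length w + length gs"
  using set_run_gates by fastforce

text \<open>Wires are absolute positions, so gates that are reused inside another circuit need their
  references renamed.\<close>

fun relocate :: "(nat \<Rightarrow> nat) \<Rightarrow> gate \<Rightarrow> gate" where
  "relocate \<rho> Coin = Coin"
| "relocate \<rho> (Nand i j) = Nand (\<rho> i) (\<rho> j)"

fun wf_gate :: "nat \<Rightarrow> gate \<Rightarrow> bool" where
  "wf_gate n Coin \<longleftrightarrow> True"
| "wf_gate n (Nand i j) \<longleftrightarrow> i < n \<and> j < n"

text \<open>The index condition of \<open>wf_circuit\<close> as a recursion with the current number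
  of wires, which matches the recursion of \<open>run_gates\<close>.\<close>

primrec wf_gates :: "nat \<Rightarrow> gate list \<Rightarrow> bool" where
  "wf_gates n [] \<longleftrightarrow> True"
| "wf_gates n (g # gs) \<longleftrightarrow> wf_gate n g \<and> wf_gates (Suc n) gs"

lemma wf_gates_conv_nth:
  "wf_gates n gs \<longleftrightarrow>
     (\<forall>k<length gs. case gs ! k of Coin \<Rightarrow> True | Nand i j \<Rightarrow> i < n + k \<and> j < n + k)"
proof (induction gs arbitrary: n)
  case (Cons g gs)
  show ?case
    by (cases g) (simp_all add: Cons.IH All_less_Suc2 cong: gate.case_cong)
qed simp

lemma wf_circuit_iff:
  "wf_circuit n k (gs, outs) \<longleftrightarrow>
     wf_gates n gs \<and> length outs = k \<and> (\<forall>i \<in> set outs. i < n + length gs)"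
  by (simp add: wf_gates_conv_nth)

declare wf_circuit.simps [simp del]

lemma wf_gates_append:
  "wf_gates n (gs @ hs) \<longleftrightarrow> wf_gates n gs \<and> wf_gates (n + length gs) hs"
  by (induction gs arbitrary: n) auto

lemma wf_gates_relocate:
  assumes "wf_gates n gs" "\<And>i. i < n \<Longrightarrow> \<rho> i < n'" "\<And>j. \<rho> (n + j) = n' + j"
  shows "wf_gates n' (map (relocate \<rho>) gs)"
  using assms
proof (induction gs arbitrary: n n')
  case (Cons g gs)
  have lt: "\<rho> i < Suc n'" if "i < Suc n" for i
    using Cons.prems(2)[of i] Cons.prems(3)[of 0] that by (cases "i < n") (auto simp: less_Suc_eq)
  have "\<rho> (Suc n + j) = Suc n' + j" for j
    using Cons.prems(3)[of "Suc j"] by simp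
  then have "wf_gates (Suc n') (map (relocate \<rho>) gs)"
    using Cons.prems(1) lt by (intro Cons.IH[of "Suc n"]) auto
  then show ?case
    using Cons.prems(1,2) by (cases g) auto
qed simp

text \<open>The moved gates read the same values and toss the same coins, so they append the same
  bits to \<open>w\<close> as to \<open>x\<close>. The hypotheses survive the addition of one equal
  bit to both lists; that is why the last one is stated for all \<open>j\<close> and not only for
  the first new wire.\<close>

lemma run_gates_relocate:
  assumes "wf_gates (length x) gs"
    "\<And>i. i < length x \<Longrightarrow> \<rho> i < length w \<and> w ! \<rho> i = x ! i"
    "\<And>j. \<rho> (length x + j) = length w + j"
  shows "run_gates (map (relocate \<rho>) gs) w =
           map_pmf (\<lambda>y. w @ drop (length x) y) (run_gates gs x)"
  using assms
proof (induction gs arbitrary: x w)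
  case (Cons g gs)
  have IH: "run_gates (map (relocate \<rho>) gs) (w @ [c]) =
      map_pmf (\<lambda>y. w @ drop (length x) y) (run_gates gs (x @ [c]))" for c
  proof -
    have "\<rho> i < length (w @ [c]) \<and> (w @ [c]) ! \<rho> i = (x @ [c]) ! i" if "i < length (x @ [c])" for i
      using Cons.prems(2)[of i] Cons.prems(3)[of 0] that
      by (cases "i < length x") (auto simp: less_Suc_eq nth_append)
    moreover have "\<rho> (length (x @ [c]) + j) = length (w @ [c]) + j" for j
      using Cons.prems(3)[of "Suc j"] by simp
    ultimately have "run_gates (map (relocate \<rho>) gs) (w @ [c]) =
        map_pmf (\<lambda>y. (w @ [c]) @ drop (length (x @ [c])) y) (run_gates gs (x @ [c]))"
      using Cons.prems(1) by (intro Cons.IH) auto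
    also have "\<dots> = map_pmf (\<lambda>y. w @ drop (length x) y) (run_gates gs (x @ [c]))"
      by (intro map_pmf_cong refl) (auto dest!: set_run_gates)
    finally show ?thesis .
  qed
  show ?case
  proof (cases g)
    case (Nand i j)
    then show ?thesis
      using IH Cons.prems(1,2) by simp
  qed (simp add: IH map_bind_pmf)
qed simp

section \<open>Circuits of bounded size and their combinations\<close>

text \<open>The size bound is a number and not a growth rate: there is one circuit for each security
  parameter, and the bounds of the pieces just add up.\<close>

definition computes :: "nat \<Rightarrow> nat \<Rightarrow> nat \<Rightarrow> (bool list \<Rightarrow> bool list pmf) \<Rightarrow> bool" where
  "computes n k s F \<longleftrightarrow> (\<exists>C. wf_circuit n k C \<and> circuit_size C \<le> s \<and>
     (\<forall>x. length x = n \<longrightarrow> run_circuit C x = F x))"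

lemma computes_mono: "computes n k s F \<Longrightarrow> s \<le> s' \<Longrightarrow> computes n k s' F"
  unfolding computes_def by (meson le_trans)

lemma computes_cong:
  "computes n k s F \<Longrightarrow> (\<And>x. length x = n \<Longrightarrow> F x = G x) \<Longrightarrow> computes n k s G"
  unfolding computes_def by metis

lemma length_computes:
  assumes "computes n k s F" "length x = n" "y \<in> set_pmf (F x)"
  shows "length y = k"
proof -
  obtain gs outs where "wf_circuit n k (gs, outs)" "run_circuit (gs, outs) x = F x"
    using assms unfolding computes_def by (metis surj_pair)
  then show ?thesis
    using assms(3) by (auto simp: wf_circuit_iff simp flip: \<open>run_circuit (gs, outs) x = F x\<close>)
qed

lemma computes_circuit: "wf_circuit n k C \<Longrightarrow> computes n k (circuit_size C) (run_circuit C)"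
  unfolding computes_def by blast

text \<open>The second circuit may read, in any order, the inputs and the outputs of the first one.\<close>

lemma computes_bind:
  assumes F: "computes n k s1 F" and G: "computes k' k'' s2 G"
    and sel: "length sel = k'" "\<forall>i \<in> set sel. i < n + k"
  shows "computes n k'' (s1 + s2) (\<lambda>x. F x \<bind> (\<lambda>y. G (map ((!) (x @ y)) sel)))"
proof -
  obtain gs outs where C: "wf_circuit n k (gs, outs)" "circuit_size (gs, outs) \<le> s1"
    "\<And>x. length x = n \<Longrightarrow> run_circuit (gs, outs) x = F x"
    using F unfolding computes_def by (metis surj_pair)
  obtain hs outs' where D: "wf_circuit k' k'' (hs, outs')" "circuit_size (hs, outs') \<le> s2"
    "\<And>x. length x = k' \<Longrightarrow> run_circuit (hs, outs') x = G x"
    using G unfolding computes_def by (metis surj_pair)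
  \<comment> \<open>\<open>\<rho>0 i\<close> is the wire that carries bit \<open>i\<close> of
    \<open>x @ y\<close>, that is, an input or an output wire of the first circuit.
    \<open>\<rho>\<close> reads the inputs of the second circuit through it and puts the new wires
    behind all wires of the first.\<close>
  define \<rho>0 where "\<rho>0 i = (if i < n then i else outs ! (i - n))" for i
  define \<rho> where "\<rho> i = (if i < k' then \<rho>0 (sel ! i) else n + length gs + (i - k'))" for i
  have \<rho>0: "\<rho>0 i < n + length gs" if "i < n + k" for i
    using that C(1) nth_mem[of "i - n" outs] by (fastforce simp: \<rho>0_def wf_circuit_iff)
  have \<rho>1: "\<rho> i < n + length gs" if "i < k'" for i
    using that sel \<rho>0 by (simp add: \<rho>_def)
  have \<rho>2: "\<rho> (k' + j) = n + length gs + j" for j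
    by (simp add: \<rho>_def)
  have lt: "\<rho> i < n + length gs + length hs" if "i < k' + length hs" for i
    using that \<rho>1[of i] by (cases "i < k'") (auto simp: \<rho>_def)
  have "wf_circuit n k'' (gs @ map (relocate \<rho>) hs, map \<rho> outs')"
    using C(1) D(1) lt \<rho>1 \<rho>2 unfolding wf_circuit_iff
    by (auto simp: wf_gates_append add.assoc intro!: wf_gates_relocate[of k'])
  moreover have "circuit_size (gs @ map (relocate \<rho>) hs, map \<rho> outs') \<le> s1 + s2"
    using C(2) D(2) by simp
  moreover have "run_circuit (gs @ map (relocate \<rho>) hs, map \<rho> outs') x =
      F x \<bind> (\<lambda>y. G (map ((!) (x @ y)) sel))" if x: "length x = n" for x
  proof -
    have "map_pmf (\<lambda>w. map ((!) w) (map \<rho> outs')) (run_gates (map (relocate \<rho>) hs) w) =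
        G (map ((!) (x @ map ((!) w) outs)) sel)" if w: "w \<in> set_pmf (run_gates gs x)" for w
    proof -
      let ?z = "map ((!) (x @ map ((!) w) outs)) sel"
      obtain u where u: "w = x @ u" "length u = length gs"
        using set_run_gates[OF w] by blast
      have w\<rho>0: "w ! \<rho>0 i = (x @ map ((!) w) outs) ! i" if "i < n + k" for i
        using that x C(1) by (auto simp: \<rho>0_def u nth_append wf_circuit_iff)
      have "run_gates (map (relocate \<rho>) hs) w = map_pmf (\<lambda>y. w @ drop (length ?z) y) (run_gates hs ?z)"
      proof (rule run_gates_relocate)
        show "wf_gates (length ?z) hs"
          using D(1) sel by (simp add: wf_circuit_iff)
        show "\<rho> i < length w \<and> w ! \<rho> i = ?z ! i" if "i < length ?z" for i
          using that sel \<rho>1[of i] w\<rho>0[of "sel ! i"] x u by (simp add: \<rho>_def)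
        show "\<rho> (length ?z + j) = length w + j" for j
          using \<rho>2 sel x u by simp
      qed
      moreover have "map ((!) (w @ drop (length ?z) y)) (map \<rho> outs') = map ((!) y) outs'"
        if y: "y \<in> set_pmf (run_gates hs ?z)" for y
      proof -
        obtain v where v: "y = ?z @ v" "length v = length hs"
          using set_run_gates[OF y] by blast
        have "(w @ v) ! \<rho> i = (?z @ v) ! i" if "i < k' + length hs" for i
        proof (cases "i < k'")
          case True
          have "\<rho> i < length w"
            using \<rho>1[OF True] x u by simp
          then have "(w @ v) ! \<rho> i = w ! \<rho>0 (sel ! i)"
            using True by (simp add: nth_append_left \<rho>_def)
          also have "\<dots> = ?z ! i"
            using True sel w\<rho>0[of "sel ! i"] by simp
          finally show ?thesis
            using True sel by (simp add: nth_append_left)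
        next
          case False
          then show ?thesis
            using sel x u(1,2) by (auto simp add: \<rho>_def nth_append)
        qed
        then show ?thesis
          using D(1) v by (auto simp: wf_circuit_iff)
      qed
      ultimately have "map_pmf (\<lambda>w. map ((!) w) (map \<rho> outs')) (run_gates (map (relocate \<rho>) hs) w) =
          run_circuit (hs, outs') ?z"
        by (auto simp: map_pmf_comp simp del: map_map intro!: map_pmf_cong)
      then show ?thesis
        using D(3)[of ?z] sel by simp
    qed
    then have "run_circuit (gs @ map (relocate \<rho>) hs, map \<rho> outs') x =
        run_gates gs x \<bind> (\<lambda>w. G (map ((!) (x @ map ((!) w) outs)) sel))"
      by (auto simp: run_gates_append map_bind_pmf simp del: map_map intro!: bind_pmf_cong)
    also have "\<dots> = F x \<bind> (\<lambda>y. G (map ((!) (x @ y)) sel))"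
      by (simp add: bind_map_pmf flip: C(3)[OF x])
    finally show ?thesis .
  qed
  ultimately show ?thesis
    unfolding computes_def by blast
qed

lemma computes_select:
  assumes "\<forall>i \<in> set sel. i < n"
  shows "computes n (length sel) (length sel) (\<lambda>x. return_pmf (map ((!) x) sel))"
  unfolding computes_def using assms by (intro exI[of _ "([], sel)"]) (auto simp: wf_circuit_iff)

text \<open>Permuting, dropping or duplicating input wires is free: it is composition with the empty
  circuit.\<close>

lemma computes_reindex:
  assumes "computes k k' s F" "length sel = k" "\<forall>i \<in> set sel. i < n"
  shows "computes n k' s (\<lambda>x. F (map ((!) x) sel))"
proof -
  have "computes n 0 0 (\<lambda>x. return_pmf [])"
    using computes_select[of "[]" n] by simp
  from computes_bind[OF this assms(1), of sel] assms(2,3) show ?thesis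
    by (simp add: bind_return_pmf)
qed

text \<open>\<open>computes_bind\<close> returns only the output of the second circuit; here both
  outputs are kept. The second circuit reads the original inputs and tosses its own coins, so the
  two outputs are independent given \<open>x\<close>.\<close>

lemma computes_pair:
  assumes F: "computes n k1 s1 F" and G: "computes n k2 s2 G"
  shows "computes n (k1 + k2) (s1 + s2) (\<lambda>x. F x \<bind> (\<lambda>y. map_pmf (\<lambda>z. y @ z) (G x)))"
proof -
  obtain gs outs where C: "wf_circuit n k1 (gs, outs)" "circuit_size (gs, outs) \<le> s1"
    "\<And>x. length x = n \<Longrightarrow> run_circuit (gs, outs) x = F x"
    using F unfolding computes_def by (metis surj_pair)
  obtain hs outs' where D: "wf_circuit n k2 (hs, outs')" "circuit_size (hs, outs') \<le> s2"
    "\<And>x. length x = n \<Longrightarrow> run_circuit (hs, outs') x = G x"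
    using G unfolding computes_def by (metis surj_pair)
  define \<rho> where "\<rho> i = (if i < n then i else length gs + i)" for i
  let ?C = "(gs @ map (relocate \<rho>) hs, outs @ map \<rho> outs')"
  have "wf_circuit n (k1 + k2) ?C"
    using C(1) D(1) unfolding wf_circuit_iff
    by (fastforce simp: wf_gates_append \<rho>_def intro!: wf_gates_relocate[of n])
  moreover have "circuit_size ?C \<le> s1 + s2"
    using C(2) D(2) by simp
  moreover have "run_circuit ?C x = F x \<bind> (\<lambda>y. map_pmf (\<lambda>z. y @ z) (G x))" if x: "length x = n" for x
  proof -
    have "map_pmf (\<lambda>w. map ((!) w) (outs @ map \<rho> outs')) (run_gates (map (relocate \<rho>) hs) w) =
        map_pmf (\<lambda>z. map ((!) w) outs @ z) (G x)" if w: "w \<in> set_pmf (run_gates gs x)" for w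
    proof -
      obtain u where u: "w = x @ u" "length u = length gs"
        using set_run_gates[OF w] by blast
      have "run_gates (map (relocate \<rho>) hs) w = map_pmf (\<lambda>y. w @ drop (length x) y) (run_gates hs x)"
        using D(1) x u by (intro run_gates_relocate) (auto simp: wf_circuit_iff \<rho>_def nth_append)
      moreover have "map ((!) (w @ drop (length x) y)) (outs @ map \<rho> outs') =
          map ((!) w) outs @ map ((!) y) outs'"
        if y: "y \<in> set_pmf (run_gates hs x)" for y
      proof -
        obtain v where v: "y = x @ v" "length v = length hs"
          using set_run_gates[OF y] by blast
        show ?thesis
          using C(1) D(1) v x u by (auto simp: wf_circuit_iff \<rho>_def nth_append)
      qed
      ultimately have "map_pmf (\<lambda>w. map ((!) w) (outs @ map \<rho> outs')) (run_gates (map (relocate \<rho>) hs) w) =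
          map_pmf (\<lambda>z. map ((!) w) outs @ z) (run_circuit (hs, outs') x)"
        by (auto simp: map_pmf_comp simp del: map_map map_append intro!: map_pmf_cong)
      then show ?thesis
        using D(3)[OF x] by simp
    qed
    then have "run_circuit ?C x =
        run_gates gs x \<bind> (\<lambda>w. map_pmf (\<lambda>z. map ((!) w) outs @ z) (G x))"
      by (auto simp: run_gates_append map_bind_pmf simp del: map_map map_append intro!: bind_pmf_cong)
    also have "\<dots> = F x \<bind> (\<lambda>y. map_pmf (\<lambda>z. y @ z) (G x))"
      by (simp add: bind_map_pmf flip: C(3)[OF x])
    finally show ?thesis .
  qed
  ultimately show ?thesis
    unfolding computes_def by blast
qed

section \<open>Simulation by quantum circuits\<close>

text \<open>Wire \<open>i\<close> is kept in qubit \<open>i + 1\<close>; qubit 0 is reserved for the result.\<close>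

definition emb :: "bool list \<Rightarrow> nat \<Rightarrow> bool" where
  "emb w i \<longleftrightarrow> 0 < i \<and> i \<le> length w \<and> w ! (i - 1)"

lemma emb_Nil: "emb [] = (\<lambda>_. False)"
  by (auto simp: emb_def fun_eq_iff)

lemma emb_snoc: "emb (w @ [b]) = (emb w)(Suc (length w) := b)"
  by (auto simp: emb_def fun_eq_iff nth_append le_Suc_eq)

section \<open>States whose squared amplitudes form a probability distribution\<close>

text \<open>Phases are forgotten. As long as no two basis states of nonzero amplitude are merged,
  the squared moduli evolve on their own, and they do so like probabilities.\<close>

definition represents :: "qstate \<Rightarrow> (nat \<Rightarrow> bool) pmf \<Rightarrow> bool" where
  "represents \<psi> R \<longleftrightarrow> (\<forall>x. (cmod (\<psi> x))\<^sup>2 = pmf R x)"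

lemma represents_involution:
  assumes "represents \<psi> R" "\<And>x. \<pi> (\<pi> x) = x"
  shows "represents (\<lambda>x. \<psi> (\<pi> x)) (map_pmf \<pi> R)"
proof -
  have "inj \<pi>"
    using assms(2) by (metis injI)
  then have "pmf (map_pmf \<pi> R) x = pmf R (\<pi> x)" for x
    using pmf_map_inj'[of \<pi> R "\<pi> x"] assms(2) by simp
  then show ?thesis
    using assms(1) by (simp add: represents_def)
qed

lemma represents_toffoli:
  assumes "represents \<psi> R" "i \<notin> ctrl"
  shows "represents (apply_toffoli ctrl i \<psi>) (map_pmf (\<lambda>x. x(i := (x i \<noteq> (\<forall>c\<in>ctrl. x c)))) R)"
proof -
  \<comment> \<open>The target is not among the controls, so changing it leaves the condition alone
    and the map is an involution.\<close>
  have "(\<forall>c\<in>ctrl. (x(i := b)) c) \<longleftrightarrow> (\<forall>c\<in>ctrl. x c)" for x b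
    using assms(2) by auto
  then show ?thesis
    unfolding apply_toffoli_def using assms(1) by (intro represents_involution) (auto simp: fun_eq_iff)
qed

text \<open>Without interference, a Hadamard gate acts as a coin toss.\<close>

lemma represents_had:
  assumes "represents \<psi> R" "\<And>x. x \<in> set_pmf R \<Longrightarrow> \<not> x i"
  shows "represents (apply_had i \<psi>) (coin \<bind> (\<lambda>c. map_pmf (\<lambda>x. x(i := c)) R))"
  unfolding represents_def
proof
  fix x
  \<comment> \<open>Qubit \<open>i\<close> is still zero, so at most one of the two amplitudes that
    the gate adds is nonzero.\<close>
  have 0: "\<psi> (x(i := True)) = 0"
  proof -
    have "pmf R (x(i := True)) = 0"
      using assms(2)[of "x(i := True)"] by (auto simp: set_pmf_iff)
    then show ?thesis
      using assms(1) unfolding represents_def by (metis norm_eq_zero zero_eq_power2)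
  qed
  have R: "y(i := False) = y" if "y \<in> set_pmf R" for y
    using assms(2)[OF that] by (simp add: fun_upd_idem)
  have 1: "pmf (map_pmf (\<lambda>x. x(i := c)) R) x = (if x i = c then pmf R (x(i := False)) else 0)" for c
  proof (cases "x i = c")
    case True
    have "pmf (map_pmf (\<lambda>x. x(i := c)) R) ((x(i := False))(i := c)) = pmf R (x(i := False))"
    proof (cases "x(i := False) \<in> set_pmf R")
      case True
      have "inj_on (\<lambda>x. x(i := c)) (set_pmf R)"
      proof (rule inj_onI)
        fix y z assume "y \<in> set_pmf R" "z \<in> set_pmf R" "y(i := c) = z(i := c)"
        then have "y(i := False) = z(i := False)"
          by (metis fun_upd_upd)
        then show "y = z"
          using R[OF \<open>y \<in> set_pmf R\<close>] R[OF \<open>z \<in> set_pmf R\<close>] by simp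
      qed
      then show ?thesis
        using True by (rule pmf_map_inj)
    next
      case False
      have "x(i := c) \<notin> (\<lambda>x. x(i := c)) ` set_pmf R"
      proof
        assume "x(i := c) \<in> (\<lambda>x. x(i := c)) ` set_pmf R"
        then obtain y where "y \<in> set_pmf R" "x(i := c) = y(i := c)"
          by blast
        then have "x(i := False) = y(i := False)"
          by (metis fun_upd_upd)
        then have "x(i := False) = y"
          using R[OF \<open>y \<in> set_pmf R\<close>] by simp
        then show False
          using False \<open>y \<in> set_pmf R\<close> by simp
      qed
      then have "pmf (map_pmf (\<lambda>x. x(i := c)) R) (x(i := c)) = 0" "pmf R (x(i := False)) = 0"
        using False by (simp_all add: pmf_eq_0_set_pmf)
      then show ?thesis
        by simp
    qed
    moreover have "x(i := c) = x"
      using True by auto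
    ultimately show ?thesis
      using True by simp
  next
    case False
    then have "x \<notin> set_pmf (map_pmf (\<lambda>x. x(i := c)) R)"
      by auto
    then show ?thesis
      using False by (simp add: pmf_eq_0_set_pmf)
  qed
  have "(cmod (apply_had i \<psi> x))\<^sup>2 = (cmod (\<psi> (x(i := False))))\<^sup>2 / 2"
    by (simp add: apply_had_def 0 norm_divide power_divide)
  also have "\<dots> = pmf R (x(i := False)) / 2"
    using assms(1) by (simp add: represents_def)
  also have "\<dots> = pmf (coin \<bind> (\<lambda>c. map_pmf (\<lambda>x. x(i := c)) R)) x"
    unfolding coin_def by (subst pmf_bind_pmf_of_set) (auto simp: 1 UNIV_bool)
  finally show "(cmod (apply_had i \<psi> x))\<^sup>2 =
      pmf (coin \<bind> (\<lambda>c. map_pmf (\<lambda>x. x(i := c)) R)) x" .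
qed

lemma measure_qubit0_represents:
  assumes "represents \<psi> R" "\<And>x i. x \<in> set_pmf R \<Longrightarrow> i \<ge> N \<Longrightarrow> \<not> x i"
  shows "measure_qubit0 N \<psi> = map_pmf (\<lambda>x. x 0) R"
proof -
  let ?S = "{x. x 0 \<and> (\<forall>i\<ge>N. \<not> x i)}"
  \<comment> \<open>\<open>measure_qubit0\<close> sums over this set, and a sum over an infinite set
    would be 0 by convention; the condition on the qubits from \<open>N\<close> on makes it
    finite.\<close>
  have "?S \<subseteq> (\<lambda>A i. i \<in> A) ` Pow {..<N}"
  proof
    fix x assume "x \<in> ?S"
    then have "x = (\<lambda>i. i \<in> {i. x i})" "{i. x i} \<in> Pow {..<N}"
      by (auto simp: not_le)
    then show "x \<in> (\<lambda>A i. i \<in> A) ` Pow {..<N}"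
      by blast
  qed
  then have "finite ?S"
    by (rule finite_subset) simp
  then have "(\<Sum>x\<in>?S. (cmod (\<psi> x))\<^sup>2) = measure (measure_pmf R) ?S"
    using assms(1) by (simp add: represents_def measure_measure_pmf_finite)
  also have "\<dots> = measure (measure_pmf R) {x. x 0}"
    using assms(2) by (intro measure_pmf.finite_measure_eq_AE) (auto simp: AE_measure_pmf_iff)
  also have "\<dots> = pmf (map_pmf (\<lambda>x. x 0) R) True"
    by (simp add: pmf_map vimage_def)
  finally have p: "(\<Sum>x\<in>?S. (cmod (\<psi> x))\<^sup>2) = pmf (map_pmf (\<lambda>x. x 0) R) True" .
  have "bernoulli_pmf (pmf B True) = B" for B
  proof (rule pmf_eqI)
    fix b
    have "pmf B False = 1 - pmf B True"
      by (rule pmf_False_conv_True)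
    then show "pmf (bernoulli_pmf (pmf B True)) b = pmf B b"
      by (cases b) (simp_all add: pmf_le_1)
  qed
  then show ?thesis
    unfolding measure_qubit0_def p .
qed

text \<open>The target is a fresh qubit in state zero: the controlled gate writes the conjunction
  there and \<open>Not\<close> negates it. A Toffoli gate needs distinct qubits, so
  \<open>Nand i i\<close> is built with \<open>CNot\<close>.\<close>

fun quantum_gate :: "nat \<Rightarrow> gate \<Rightarrow> qgate list" where
  "quantum_gate L Coin = [Had (Suc L)]"
| "quantum_gate L (Nand i j) =
     [if i = j then CNot (Suc i) (Suc L) else Toffoli (Suc i) (Suc j) (Suc L), Not (Suc L)]"

primrec quantum_gates :: "nat \<Rightarrow> gate list \<Rightarrow> qgate list" where
  "quantum_gates L [] = []"
| "quantum_gates L (g # gs) = quantum_gate L g @ quantum_gates (Suc L) gs"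

lemma length_quantum_gates: "length (quantum_gates L gs) \<le> 2 * length gs"
proof (induction gs arbitrary: L)
  case (Cons g gs)
  show ?case
    using Cons.IH[of "Suc L"] by (cases g) auto
qed simp

lemma wf_quantum_gates:
  "wf_gates L gs \<Longrightarrow> Suc L + length gs \<le> N \<Longrightarrow> g \<in> set (quantum_gates L gs) \<Longrightarrow> wf_qgate len N g"
proof (induction gs arbitrary: L)
  case (Cons g' gs)
  then show ?case
    by (cases g') (auto simp: Cons.IH split: if_splits)
qed simp

lemma run_qgates_append:
  "run_qgates D (gs @ hs) \<psi> = run_qgates D gs \<psi> \<bind> run_qgates D hs"
  by (induction gs arbitrary: \<psi>) (simp_all add: bind_assoc_pmf bind_return_pmf)

text \<open>Coins are put into superposition and not drawn, so the run ends in one definite state;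
  the randomness of \<open>P\<close> and of the coins sits in its squared amplitudes until the
  measurement.\<close>

lemma run_quantum_gate:
  assumes "wf_gate L g" "\<And>w. w \<in> set_pmf P \<Longrightarrow> length w = L" "represents \<psi> (map_pmf emb P)"
  shows "\<exists>\<psi>'. run_qgates D (quantum_gate L g) \<psi> = return_pmf \<psi>' \<and>
           represents \<psi>' (map_pmf emb (P \<bind> run_gates [g]))"
proof (cases g)
  case Coin
  have "represents (apply_had (Suc L) \<psi>) (coin \<bind> (\<lambda>c. map_pmf (\<lambda>x. x(Suc L := c)) (map_pmf emb P)))"
    using assms by (intro represents_had) (auto simp: emb_def)
  also have "coin \<bind> (\<lambda>c. map_pmf (\<lambda>x. x(Suc L := c)) (map_pmf emb P)) =
      coin \<bind> (\<lambda>c. map_pmf (\<lambda>w. emb (w @ [c])) P)"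
    using assms(2) by (auto simp: map_pmf_comp emb_snoc intro!: bind_pmf_cong map_pmf_cong)
  also have "\<dots> = map_pmf emb (P \<bind> run_gates [Coin])"
    by (simp add: map_pmf_def bind_assoc_pmf bind_return_pmf bind_commute_pmf[of P])
  finally show ?thesis
    using Coin by (simp add: bind_return_pmf)
next
  case (Nand i j)
  \<comment> \<open>For \<open>i = j\<close> the set of controls collapses to one element, so this
    term also covers \<open>CNot\<close>.\<close>
  let ?\<psi>1 = "apply_toffoli {Suc i, Suc j} (Suc L) \<psi>"
  let ?\<psi>2 = "apply_toffoli {} (Suc L) ?\<psi>1"
  let ?T = "\<lambda>ctrl x. x(Suc L := (x (Suc L) \<noteq> (\<forall>c\<in>ctrl. x c)))"
  have "represents ?\<psi>2 (map_pmf (?T {}) (map_pmf (?T {Suc i, Suc j}) (map_pmf emb P)))"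
    using assms Nand by (intro represents_toffoli) auto
  also have "map_pmf (?T {}) (map_pmf (?T {Suc i, Suc j}) (map_pmf emb P)) =
      map_pmf (\<lambda>w. emb (w @ [\<not> (w ! i \<and> w ! j)])) P"
    unfolding map_pmf_comp using assms(1,2) Nand
    by (intro map_pmf_cong) (auto simp: emb_snoc fun_eq_iff, auto simp: emb_def)
  also have "\<dots> = map_pmf emb (P \<bind> run_gates [g])"
    by (simp add: Nand map_pmf_def bind_assoc_pmf bind_return_pmf)
  finally have "represents ?\<psi>2 (map_pmf emb (P \<bind> run_gates [g]))" .
  moreover have "run_qgates D (quantum_gate L g) \<psi> = return_pmf ?\<psi>2"
    by (simp add: Nand bind_return_pmf)
  ultimately show ?thesis
    by blast
qed

lemma run_quantum_gates:
  assumes "wf_gates L gs" "\<And>w. w \<in> set_pmf P \<Longrightarrow> length w = L" "represents \<psi> (map_pmf emb P)"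
  shows "\<exists>\<psi>'. run_qgates D (quantum_gates L gs) \<psi> = return_pmf \<psi>' \<and>
           represents \<psi>' (map_pmf emb (P \<bind> run_gates gs))"
  using assms
proof (induction gs arbitrary: L P \<psi>)
  case Nil
  then show ?case
    by (simp add: bind_return_pmf')
next
  case (Cons g gs)
  obtain \<psi>1 where 1: "run_qgates D (quantum_gate L g) \<psi> = return_pmf \<psi>1"
    "represents \<psi>1 (map_pmf emb (P \<bind> run_gates [g]))"
    using run_quantum_gate[of L g P \<psi>] Cons.prems by auto
  have "length w = Suc L" if "w \<in> set_pmf (P \<bind> run_gates [g])" for w
    using that Cons.prems(2) length_run_gates[of w "[g]"] by fastforce
  then obtain \<psi>2 where 2: "run_qgates D (quantum_gates (Suc L) gs) \<psi>1 = return_pmf \<psi>2"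
    "represents \<psi>2 (map_pmf emb ((P \<bind> run_gates [g]) \<bind> run_gates gs))"
    using Cons.IH[of "Suc L" "P \<bind> run_gates [g]" \<psi>1] Cons.prems(1) 1(2) by auto
  have "(P \<bind> run_gates [g]) \<bind> run_gates gs = P \<bind> run_gates (g # gs)"
    unfolding bind_assoc_pmf by (intro bind_pmf_cong refl) (metis run_gates_append append_Cons append_Nil)
  then show ?case
    using 1(1) 2 by (auto simp: run_qgates_append bind_return_pmf simp del: run_gates.simps)
qed

section \<open>Oracle samples and the complete quantum circuit\<close>

definition basis_state :: "(nat \<Rightarrow> bool) \<Rightarrow> qstate" where
  "basis_state y = (\<lambda>x. if x = y then 1 else 0)"

lemma represents_basis_state: "represents (basis_state y) (return_pmf y)"
  by (auto simp: represents_def basis_state_def)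

lemma apply_xor_basis_state:
  "apply_xor (Suc (length w)) z (basis_state (emb w)) = basis_state (emb (w @ z))"
proof -
  define \<pi> where "\<pi> x i = (if Suc (length w) \<le> i \<and> i < Suc (length w) + length z
    then x i \<noteq> z ! (i - Suc (length w)) else x i)" for x i
  have "\<pi> (\<pi> x) = x" for x
    by (auto simp: \<pi>_def fun_eq_iff)
  moreover have "\<pi> (emb w) = emb (w @ z)"
    by (auto simp: \<pi>_def emb_def fun_eq_iff nth_append)
  ultimately have "\<pi> x = emb w \<longleftrightarrow> x = emb (w @ z)" for x
    by metis
  then show ?thesis
    by (simp add: apply_xor_def basis_state_def \<pi>_def[abs_def] fun_eq_iff)
qed

text \<open>While samples are drawn the register is in a basis state, so the draws are classical
  randomness. The offset \<open>k\<close> serves the induction: \<open>w\<close> stands for the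
  \<open>k\<close> samples drawn before.\<close>

lemma run_sample_gates:
  assumes "\<And>z. z \<in> set_pmf D \<Longrightarrow> length z = len" "length w = k * len"
  shows "run_qgates D (map (\<lambda>j. Sample (Suc (j * len))) [k..<k + m]) (basis_state (emb w)) =
           map_pmf (\<lambda>zs. basis_state (emb (w @ concat zs))) (replicate_pmf m D)"
  using assms(2)
proof (induction m arbitrary: k w)
  case (Suc m)
  have *: "[k..<k + Suc m] = k # [Suc k..<Suc k + m]"
    by (simp add: upt_rec)
  have "run_qgates D (map (\<lambda>j. Sample (Suc (j * len))) [Suc k..<Suc k + m])
      (apply_xor (Suc (k * len)) z (basis_state (emb w))) =
      map_pmf (\<lambda>zs. basis_state (emb ((w @ z) @ concat zs))) (replicate_pmf m D)" if "z \<in> set_pmf D" for z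
    using Suc.prems assms(1)[OF that] apply_xor_basis_state[of w z] Suc.IH[of "w @ z" "Suc k"] by simp
  then show ?case
    unfolding * using Suc.prems
    by (simp add: bind_map_pmf cong: bind_pmf_cong) (simp add: map_pmf_def bind_assoc_pmf bind_return_pmf)
qed simp

lemma sampling_circuit_quantum:
  assumes "wf_circuit (m * len) 1 C"
  shows "\<exists>C'. wf_qcircuit len C' \<and> qcircuit_size C' \<le> m * len + m + 3 * circuit_size C + 2 \<and>
    (\<forall>D. (\<forall>z \<in> set_pmf D. length z = len) \<longrightarrow>
      run_qcircuit D C' = replicate_pmf m D \<bind> (\<lambda>zs. map_pmf hd (run_circuit C (concat zs))))"
proof -
  obtain gs out where C: "C = (gs, [out])" "wf_gates (m * len) gs" "out < m * len + length gs"
    using assms by (cases C) (auto simp: wf_circuit_iff length_Suc_conv)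
  define S where "S = map (\<lambda>j. Sample (Suc (j * len))) [0..<m]"
  \<comment> \<open>One qubit for the result, one for each sample bit and one for each gate. With at
    most two quantum gates per gate, this explains the factor 3 in the size.\<close>
  define N where "N = Suc (m * len + length gs)"
  let ?C = "(N, S @ quantum_gates (m * len) gs @ [CNot (Suc out) 0])"
  have "wf_qgate len N (Sample (Suc (j * len)))" if "j < m" for j
  proof -
    have "Suc j * len \<le> m * len"
      using that by (intro mult_le_mono1) auto
    then show ?thesis
      by (simp add: N_def)
  qed
  then have "wf_qcircuit len ?C"
    using C wf_quantum_gates[OF C(2), of N] by (auto simp: S_def N_def)
  moreover have "qcircuit_size ?C \<le> m * len + m + 3 * circuit_size C + 2"
    using length_quantum_gates[of "m * len" gs] by (simp add: C S_def N_def)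
  moreover have "run_qcircuit D ?C = replicate_pmf m D \<bind> (\<lambda>zs. map_pmf hd (run_circuit C (concat zs)))"
    if D: "\<forall>z \<in> set_pmf D. length z = len" for D
  proof -
    have S: "run_qgates D S zero_state =
        map_pmf (\<lambda>zs. basis_state (emb (concat zs))) (replicate_pmf m D)"
      using run_sample_gates[of D len "[]" 0 m] D
      by (simp add: S_def basis_state_def zero_state_def emb_Nil)
    have "run_qgates D (quantum_gates (m * len) gs @ [CNot (Suc out) 0]) (basis_state (emb z)) \<bind>
        measure_qubit0 N = map_pmf hd (run_circuit C z)" if z: "length z = m * len" for z
    proof -
      have "represents (basis_state (emb z)) (map_pmf emb (return_pmf z))"
        by (simp add: represents_basis_state)
      from run_quantum_gates[OF C(2) _ this] z obtain \<psi> where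
        \<psi>: "run_qgates D (quantum_gates (m * len) gs) (basis_state (emb z)) = return_pmf \<psi>"
        "represents \<psi> (map_pmf emb (run_gates gs z))"
        by (auto simp: bind_return_pmf)
      let ?R = "map_pmf (\<lambda>x. x(0 := (x 0 \<noteq> (\<forall>c\<in>{Suc out}. x c)))) (map_pmf emb (run_gates gs z))"
      have "represents (apply_toffoli {Suc out} 0 \<psi>) ?R"
        by (intro represents_toffoli \<psi>) auto
      then have "measure_qubit0 N (apply_toffoli {Suc out} 0 \<psi>) = map_pmf (\<lambda>x. x 0) ?R"
        using z by (intro measure_qubit0_represents) (auto simp: N_def emb_def dest!: length_run_gates)
      also have "\<dots> = map_pmf (\<lambda>w. w ! out) (run_gates gs z)"
        using z C(3) by (auto simp: map_pmf_comp emb_def dest!: length_run_gates intro!: map_pmf_cong)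
      finally show ?thesis
        using \<psi>(1) by (simp add: C(1) run_qgates_append bind_return_pmf map_pmf_comp)
    qed
    moreover have "length (concat zs) = m * len" if "zs \<in> set_pmf (replicate_pmf m D)" for zs
    proof -
      have "map length zs = map (\<lambda>_. len) zs"
        using that D by (auto simp: set_replicate_pmf in_lists_conv_set)
      then show ?thesis
        using that by (simp add: length_concat set_replicate_pmf map_replicate_const sum_list_replicate)
    qed
    ultimately show ?thesis
      by (auto simp: run_qgates_append S bind_assoc_pmf bind_map_pmf intro!: bind_pmf_cong)
  qed
  ultimately show ?thesis
    by blast
qed

section \<open>Deterministic circuits: wiring, connectives, constants and coins\<close>

abbreviation computes_fun :: "nat \<Rightarrow> nat \<Rightarrow> nat \<Rightarrow> (bool list \<Rightarrow> bool list) \<Rightarrow> bool" where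
  "computes_fun n k s f \<equiv> computes n k s (\<lambda>x. return_pmf (f x))"

lemma length_computes_fun: "computes_fun n k s f \<Longrightarrow> length x = n \<Longrightarrow> length (f x) = k"
  using length_computes[of n k s "\<lambda>x. return_pmf (f x)" x "f x"] by simp

lemma computes_fun_bind:
  assumes "computes_fun n k s1 f" "computes k' k'' s2 G" "length sel = k'" "\<forall>i \<in> set sel. i < n + k"
  shows "computes n k'' (s1 + s2) (\<lambda>x. G (map ((!) (x @ f x)) sel))"
  using computes_bind[OF assms] by (simp add: bind_return_pmf)

lemma map_nth_append_upt:
  "length xs = n \<Longrightarrow> map ((!) (xs @ ys)) [n..<n + length ys] = ys"
  by (intro nth_equalityI) (auto simp: nth_append)

lemma map_nth_upt_take: "b \<le> length xs \<Longrightarrow> map ((!) xs) [a..<b] = take (b - a) (drop a xs)"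
  by (intro nth_equalityI) auto

lemma computes_fun_comp:
  assumes "computes_fun n k s1 f" "computes k k' s2 G"
  shows "computes n k' (s1 + s2) (\<lambda>x. G (f x))"
proof -
  have "computes n k' (s1 + s2) (\<lambda>x. G (map ((!) (x @ f x)) [n..<n + k]))"
    by (rule computes_fun_bind[OF assms]) auto
  then show ?thesis
    by (rule computes_cong) (use length_computes_fun[OF assms(1)] map_nth_append_upt in metis)
qed

lemma computes_fun_append:
  assumes "computes_fun n k1 s1 f" "computes_fun n k2 s2 g"
  shows "computes_fun n (k1 + k2) (s1 + s2) (\<lambda>x. f x @ g x)"
  using computes_pair[OF assms] by (simp add: bind_return_pmf)

lemma computes_fun_blocks:
  assumes "\<And>j. j < K \<Longrightarrow> computes_fun n b s (G j)"
  shows "computes_fun n (K * b) (K * s) (\<lambda>x. concat (map (\<lambda>j. G j x) [0..<K]))"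
  using assms
proof (induction K)
  case 0
  show ?case
    using computes_select[of "[]" n] by simp
next
  case (Suc K)
  then have "computes_fun n (K * b + b) (K * s + s) (\<lambda>x. concat (map (\<lambda>j. G j x) [0..<K]) @ G K x)"
    by (intro computes_fun_append) auto
  then show ?case
    by (simp add: add.commute)
qed

lemma computes_bits:
  assumes "\<And>j. j < K \<Longrightarrow> computes_fun n 1 s (\<lambda>x. [g j x])"
  shows "computes_fun n K (K * s) (\<lambda>x. map (\<lambda>j. g j x) [0..<K])"
  using computes_fun_blocks[of K n 1 s "\<lambda>j x. [g j x]"] assms by simp

lemma computes_var: "i < n \<Longrightarrow> computes_fun n 1 1 (\<lambda>x. [x ! i])"
  using computes_select[of "[i]" n] by simp

lemma computes_nand:
  assumes "computes_fun n 1 s (\<lambda>x. [f x])" "computes_fun n 1 t (\<lambda>x. [g x])"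
  shows "computes_fun n 1 (s + t + 2) (\<lambda>x. [\<not> (f x \<and> g x)])"
proof -
  have "computes_fun 2 1 2 (\<lambda>x. [\<not> (x ! 0 \<and> x ! 1)])"
    unfolding computes_def
    by (intro exI[of _ "([Nand 0 1], [2])"]) (auto simp: wf_circuit_iff nth_append)
  moreover have "computes_fun n 2 (s + t) (\<lambda>x. [f x, g x])"
    using computes_fun_append[OF assms] by (simp add: numeral_2_eq_2)
  ultimately show ?thesis
    using computes_fun_comp[of n 2 "s + t" "\<lambda>x. [f x, g x]" 1 2] by fastforce
qed

text \<open>\<open>computes_nand\<close> builds both arguments, here the same one twice. Such
  doubling is harmless in formulas of fixed depth; in longer computations intermediate results
  become wires, by \<open>computes_fun_bind\<close> or \<open>computes_let\<close>.\<close>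

lemma computes_not:
  assumes "computes_fun n 1 s (\<lambda>x. [f x])"
  shows "computes_fun n 1 (2 * s + 2) (\<lambda>x. [\<not> f x])"
  using computes_nand[OF assms assms] by (simp add: mult_2)

lemma computes_and:
  assumes "computes_fun n 1 s (\<lambda>x. [f x])" "computes_fun n 1 t (\<lambda>x. [g x])"
  shows "computes_fun n 1 (2 * (s + t + 2) + 2) (\<lambda>x. [f x \<and> g x])"
  using computes_not[OF computes_nand[OF assms]] by simp

lemma computes_or:
  assumes "computes_fun n 1 s (\<lambda>x. [f x])" "computes_fun n 1 t (\<lambda>x. [g x])"
  shows "computes_fun n 1 (2 * s + 2 + (2 * t + 2) + 2) (\<lambda>x. [f x \<or> g x])"
  using computes_nand[OF assms[THEN computes_not]] by simp

lemma computes_if: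
  assumes "computes_fun n 1 r (\<lambda>x. [c x])" "computes_fun n 1 s (\<lambda>x. [f x])"
    "computes_fun n 1 t (\<lambda>x. [g x])"
  shows "computes_fun n 1 ((r + s + 2) + (2 * r + 2 + t + 2) + 2) (\<lambda>x. [if c x then f x else g x])"
  using computes_nand[OF computes_nand[OF assms(1,2)] computes_nand[OF computes_not[OF assms(1)] assms(3)]]
  by (rule computes_cong) auto

lemma computes_xor:
  assumes "computes_fun n 1 s (\<lambda>x. [f x])" "computes_fun n 1 t (\<lambda>x. [g x])"
  shows "computes_fun n 1 ((s + (2 * t + 2) + 2) + (2 * s + 2 + t + 2) + 2) (\<lambda>x. [f x \<noteq> g x])"
  using computes_if[OF assms(1) computes_not[OF assms(2)] assms(2)] by (rule computes_cong) auto

text \<open>There is no gate for constants: \<open>True\<close> is the disjunction of a coin toss and its negation.\<close>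

lemma computes_const: "computes_fun n 1 10 (\<lambda>x. [b])"
proof -
  have "run_circuit ([Coin, Nand n n, Nand n (Suc n)], [n + 2]) x = return_pmf [True]"
    if "length x = n" for x
    using that by (simp add: nth_append map_bind_pmf)
  then have T: "computes_fun n 1 4 (\<lambda>x. [True])"
    unfolding computes_def
    by (intro exI[of _ "([Coin, Nand n n, Nand n (Suc n)], [n + 2])"]) (auto simp: wf_circuit_iff)
  show ?thesis
  proof (cases b)
    case True
    then show ?thesis
      using T by (simp add: computes_mono)
  next
    case False
    then show ?thesis
      using computes_not[OF T] by simp
  qed
qed

lemma computes_coin: "computes n 1 2 (\<lambda>x. map_pmf (\<lambda>c. [c]) coin)"
  unfolding computes_def
  by (intro exI[of _ "([Coin], [n])"])
    (auto simp: wf_circuit_iff nth_append map_pmf_def bind_assoc_pmf bind_return_pmf)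

lemma computes_coins: "computes n m (2 * m) (\<lambda>x. replicate_pmf m coin)"
proof (induction m)
  case 0
  show ?case
    using computes_select[of "[]" n] by simp
next
  case (Suc m)
  have "computes n (1 + m) (2 + 2 * m)
      (\<lambda>x. map_pmf (\<lambda>c. [c]) coin \<bind> (\<lambda>y. map_pmf (\<lambda>z. y @ z) (replicate_pmf m coin)))"
    by (intro computes_pair computes_coin Suc.IH)
  then show ?case
    by (simp add: map_pmf_def bind_assoc_pmf bind_return_pmf)
qed

section \<open>Arithmetic circuits\<close>

fun ripple_add :: "bool \<Rightarrow> bool list \<Rightarrow> bool list \<Rightarrow> bool list" where
  "ripple_add c (x # xs) (y # ys) = ((x \<noteq> y) \<noteq> c) # ripple_add ((x \<and> y) \<or> (c \<and> (x \<noteq> y))) xs ys"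
| "ripple_add c _ _ = []"

lemma map_bit_Suc: "map (bit (x::int)) [0..<Suc k] = odd x # map (bit (x div 2)) [0..<k]"
  by (simp add: upt_rec[of 0] bit_0 del: upt_Suc flip: map_Suc_upt) (simp add: bit_Suc)

text \<open>In two's complement: the summands may be negative.\<close>

lemma ripple_add_bits:
  "ripple_add c (map (bit x) [0..<k]) (map (bit y) [0..<k]) = map (bit (x + y + of_bool c :: int)) [0..<k]"
proof (induction k arbitrary: c x y)
  case (Suc k)
  let ?c = "(odd x \<and> odd y) \<or> (c \<and> (odd x \<noteq> odd y))"
  have "(x + y + of_bool c) div 2 = x div 2 + y div 2 + of_bool ?c"
    by (cases c; cases "odd x"; cases "odd y"; simp; presburger)
  moreover have "odd (x + y + of_bool c) \<longleftrightarrow> ((odd x \<noteq> odd y) \<noteq> c)"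
    by auto
  ultimately show ?case
    unfolding map_bit_Suc by (simp add: Suc.IH del: upt_Suc)
qed simp

text \<open>The lowest carry becomes a wire that is handed to the adder for the remaining bits; as
  nested formulas the carries would at least double in size from bit to bit. The 200 per bit are 61
  for the sum and at most 139 for the carry.\<close>

lemma computes_ripple_add_aux:
  "computes_fun (1 + k + k) k (200 * k) (\<lambda>z. ripple_add (z ! 0) (take k (drop 1 z)) (drop (1 + k) z))"
proof (induction k)
  case 0
  show ?case
    using computes_select[of "[]" 1] by simp
next
  case (Suc k)
  let ?n = "1 + Suc k + Suc k"
  \<comment> \<open>Wire \<open>?n\<close>, just behind the inputs, is the new carry; the two ranges
    skip the lowest bit of each summand.\<close>
  let ?sel = "?n # [2..<2 + k] @ [3 + k..<3 + k + k]"
  let ?carry = "\<lambda>z. (z ! 1 \<and> z ! (k + 2)) \<or> (z ! 0 \<and> (z ! 1 \<noteq> z ! (k + 2)))"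
  let ?add = "\<lambda>z. ripple_add (z ! 0) (take k (drop 1 z)) (drop (1 + k) z)"
  have 1: "computes_fun ?n 1 61 (\<lambda>z. [(z ! 1 \<noteq> z ! (k + 2)) \<noteq> z ! 0])"
    by (intro computes_mono[OF computes_xor[OF computes_xor[OF computes_var computes_var] computes_var]]) auto
  have 2: "computes_fun ?n 1 139 (\<lambda>z. [?carry z])"
    by (intro computes_mono[OF computes_or[OF computes_and[OF computes_var computes_var]
          computes_and[OF computes_var computes_xor[OF computes_var computes_var]]]]) auto
  have "computes_fun ?n k (139 + 200 * k) (\<lambda>z. ?add (map ((!) (z @ [?carry z])) ?sel))"
    by (rule computes_fun_bind[OF 2 Suc.IH]) auto
  from computes_fun_append[OF 1 this]
  have "computes_fun ?n (1 + k) (61 + (139 + 200 * k))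
      (\<lambda>z. [(z ! 1 \<noteq> z ! (k + 2)) \<noteq> z ! 0] @ ?add (map ((!) (z @ [?carry z])) ?sel))" .
  then have "computes_fun ?n (1 + k) (61 + (139 + 200 * k))
      (\<lambda>z. ripple_add (z ! 0) (take (Suc k) (drop 1 z)) (drop (1 + Suc k) z))"
  proof (rule computes_cong)
    fix z :: "bool list" assume z: "length z = ?n"
    have eq: "map ((!) (z @ [?carry z])) ?sel = ?carry z # take k (drop 2 z) @ drop (3 + k) z"
      using z by (subst list.map(2), subst map_append, subst (1 2) map_nth_upt_take) (auto simp: nth_append)
    have "take (Suc k) (drop 1 z) = z ! 1 # take k (drop 2 z)"
      using z by (cases z; cases "tl z") (auto simp: numeral_2_eq_2)
    moreover have "drop (1 + Suc k) z = z ! (k + 2) # drop (3 + k) z"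
      using z by (simp add: numeral_eq_Suc Cons_nth_drop_Suc)
    ultimately show "return_pmf ([(z ! 1 \<noteq> z ! (k + 2)) \<noteq> z ! 0] @ ?add (map ((!) (z @ [?carry z])) ?sel)) =
        return_pmf (ripple_add (z ! 0) (take (Suc k) (drop 1 z)) (drop (1 + Suc k) z))"
      unfolding eq using z by simp
  qed
  then show ?case
    by simp
qed

lemma computes_ripple_add:
  assumes "computes_fun n 1 r (\<lambda>x. [c x])" "computes_fun n k s f" "computes_fun n k t g"
  shows "computes_fun n k (r + s + t + 200 * k) (\<lambda>x. ripple_add (c x) (f x) (g x))"
proof -
  have "computes_fun n (1 + k + k) (r + s + t) (\<lambda>x. ([c x] @ f x) @ g x)"
    by (intro computes_fun_append assms)
  from computes_fun_comp[OF this computes_ripple_add_aux] show ?thesis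
    by (rule computes_cong) (use length_computes_fun[OF assms(2)] in auto)
qed

section \<open>Addition modulo q\<close>

text \<open>Subtract \<open>q\<close> and keep the difference unless it is negative. The sum of two
  numbers below 2^Q takes \<open>Q + 1\<close> bits; one more bit, at position \<open>Q + 1\<close>,
  is the sign in two's complement.\<close>

definition mod_add_bits :: "nat \<Rightarrow> nat \<Rightarrow> bool list \<Rightarrow> bool list \<Rightarrow> bool list" where
  "mod_add_bits q Q xs ys =
     (let s = ripple_add False (xs @ [False, False]) (ys @ [False, False]);
          d = ripple_add False s (map (bit (- int q)) [0..<Q + 2])
      in map (\<lambda>j. if d ! (Q + 1) then s ! j else d ! j) [0..<Q])"

lemma map_bit_zero_extend:
  assumes "0 \<le> x" "x < 2 ^ Q"
  shows "map (bit (x::int)) [0..<Q + 2] = map (bit x) [0..<Q] @ [False, False]"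
proof -
  have "\<not> bit x j" if "j \<ge> Q" for j
  proof -
    have "x < 2 ^ j"
      using assms(2) that by (meson less_le_trans one_le_numeral power_increasing)
    then show ?thesis
      using assms(1) by (simp add: bit_iff_odd)
  qed
  then show ?thesis
    by simp
qed

lemma mod_add_bits:
  assumes "x \<in> Zq q" "y \<in> Zq q" "int q \<le> 2 ^ Q"
  shows "mod_add_bits q Q (map (bit x) [0..<Q]) (map (bit y) [0..<Q]) =
           map (bit ((x + y) mod int q)) [0..<Q]"
proof -
  obtain p where p: "p = int q" and pQ: "p \<le> 2 ^ Q"
    using assms(3) by blast
  have xy: "0 \<le> x" "x < p" "0 \<le> y" "y < p"
    using assms(1,2) by (auto simp: Zq_def p)
  let ?d = "x + y - p"
  have sign: "bit ?d (Q + 1) \<longleftrightarrow> ?d < 0"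
  proof (cases "?d < 0")
    case True
    then have "?d div 2 ^ (Q + 1) = -1"
      using xy pQ by (intro int_div_pos_eq[where r = "?d + 2 ^ (Q + 1)"]) auto
    then show ?thesis
      using True by (simp add: bit_iff_odd)
  next
    case False
    then have "?d div 2 ^ (Q + 1) = 0"
      using xy pQ by (intro div_pos_pos_trivial) auto
    then show ?thesis
      using False by (simp add: bit_iff_odd)
  qed
  have mod: "(x + y) mod p = (if ?d < 0 then x + y else ?d)"
  proof (cases "?d < 0")
    case False
    then have "(x + y) mod p = ?d mod p"
      using xy by (intro mod_pos_geq) auto
    also have "\<dots> = ?d"
      using False xy by (intro mod_pos_pos_trivial) auto
    finally show ?thesis
      by (simp only: False if_False)
  qed (use xy in simp)
  have S: "ripple_add False (map (bit x) [0..<Q] @ [False, False])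
      (map (bit y) [0..<Q] @ [False, False]) = map (bit (x + y)) [0..<Q + 2]"
  proof -
    have lt: "x < 2 ^ Q" "y < 2 ^ Q"
      using xy pQ by linarith+
    show ?thesis
      unfolding map_bit_zero_extend[OF xy(1) lt(1), symmetric] map_bit_zero_extend[OF xy(3) lt(2), symmetric]
      unfolding ripple_add_bits by (simp only: of_bool_eq add_0_right)
  qed
  have D: "ripple_add False (map (bit (x + y)) [0..<Q + 2]) (map (bit (- p)) [0..<Q + 2]) =
      map (bit ?d) [0..<Q + 2]"
    unfolding ripple_add_bits by simp
  have nth: "map (bit z) [0..<Q + 2] ! j = bit z j" if "j < Q + 2" for z :: int and j
    using that by (simp only: nth_map length_upt diff_zero nth_upt add_0)
  have "mod_add_bits q Q (map (bit x) [0..<Q]) (map (bit y) [0..<Q]) =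
      map (\<lambda>j. if bit ?d (Q + 1) then bit (x + y) j else bit ?d j) [0..<Q]"
    unfolding mod_add_bits_def Let_def p[symmetric] S D by (intro map_cong refl) (simp add: nth del: upt_Suc)
  then show ?thesis
    unfolding sign p[symmetric] mod by (cases "?d < 0") (simp_all only: if_True if_False)
qed

lemma computes_mod_add:
  assumes "computes_fun n Q s f" "computes_fun n Q t g"
  shows "computes_fun n Q (s + t + 500 * (Q + 2)) (\<lambda>x. mod_add_bits q Q (f x) (g x))"
proof -
  let ?S = "\<lambda>x. ripple_add False (f x @ [False, False]) (g x @ [False, False])"
  let ?D = "\<lambda>z. ripple_add False z (map (bit (- int q)) [0..<Q + 2])"
  \<comment> \<open>The selector reads the sum followed by the difference, so the sign of the latter
    is wire \<open>Q + 2 + (Q + 1)\<close>.\<close>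
  let ?M = "\<lambda>z. map (\<lambda>j. if z ! (Q + 2 + (Q + 1)) then z ! j else z ! (Q + 2 + j)) [0..<Q]"
  have FF: "computes_fun n 2 20 (\<lambda>x. [False, False])"
    using computes_bits[of 2 n 10 "\<lambda>j x. False"] computes_const by (simp add: numeral_2_eq_2)
  have S: "computes_fun n (Q + 2) (10 + (s + 20) + (t + 20) + 200 * (Q + 2)) ?S"
    by (intro computes_ripple_add computes_const computes_fun_append assms FF)
  have id: "computes_fun (Q + 2) (Q + 2) (Q + 2) (\<lambda>z. z)"
  proof (rule computes_cong)
    show "computes_fun (Q + 2) (Q + 2) (Q + 2) (\<lambda>z. map ((!) z) [0..<Q + 2])"
      using computes_select[of "[0..<Q + 2]" "Q + 2"] by (simp del: upt_Suc)
    show "return_pmf (map ((!) z) [0..<Q + 2]) = return_pmf z" if "length z = Q + 2" for z :: "bool list"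
      using map_nth[of z] that by simp
  qed
  have D: "computes_fun (Q + 2) (Q + 2) (10 + (Q + 2) + (Q + 2) * 10 + 200 * (Q + 2)) ?D"
    by (intro computes_ripple_add computes_const id computes_bits)
  have M: "computes_fun (Q + 2 + (Q + 2)) Q (Q * 13) ?M"
    by (intro computes_bits computes_mono[OF computes_if[OF computes_var computes_var computes_var]]) auto
  have eq: "?M (?S x @ ?D (?S x)) = mod_add_bits q Q (f x) (g x)" if "length x = n" for x
  proof -
    have "length (?S x) = Q + 2"
      using length_computes_fun[OF S] that by blast
    then show ?thesis
      unfolding mod_add_bits_def Let_def by (intro map_cong refl) (simp add: nth_append)
  qed
  have "computes_fun n Q ((10 + (s + 20) + (t + 20) + 200 * (Q + 2)) +
      ((Q + 2 + (10 + (Q + 2) + (Q + 2) * 10 + 200 * (Q + 2))) + Q * 13)) (\<lambda>x. ?M (?S x @ ?D (?S x)))"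
    using computes_fun_comp[OF S computes_fun_comp[OF computes_fun_append[OF id D] M]] .
  then have "computes_fun n Q (s + t + 500 * (Q + 2)) (\<lambda>x. ?M (?S x @ ?D (?S x)))"
    by (rule computes_mono) simp
  then show ?thesis
    by (rule computes_cong) (simp only: eq)
qed

lemma computes_let:
  assumes "computes n k s1 F" "computes (n + k) k' s2 G"
  shows "computes n k' (s1 + s2) (\<lambda>x. F x \<bind> (\<lambda>y. G (x @ y)))"
proof -
  have "computes n k' (s1 + s2) (\<lambda>x. F x \<bind> (\<lambda>y. G (map ((!) (x @ y)) [0..<n + k])))"
    using assms by (rule computes_bind) auto
  then show ?thesis
  proof (rule computes_cong)
    fix x :: "bool list" assume x: "length x = n"
    show "F x \<bind> (\<lambda>y. G (map ((!) (x @ y)) [0..<n + k])) = F x \<bind> (\<lambda>y. G (x @ y))"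
      using length_computes[OF assms(1) x] x
      by (intro bind_pmf_cong refl) (metis length_append map_nth)
  qed
qed

lemma computes_fun_let:
  assumes "computes_fun n k s1 f" "computes (n + k) k' s2 G"
  shows "computes n k' (s1 + s2) (\<lambda>x. G (x @ f x))"
  using computes_let[OF assms] by (simp add: bind_return_pmf)

section \<open>Vectors over Z_q as blocks of a bit string\<close>

lemma computes_slice: "a + k \<le> n \<Longrightarrow> computes_fun n k k (\<lambda>x. map ((!) x) [a..<a + k])"
  using computes_select[of "[a..<a + k]" n] by simp

lemma map_nth_append_shift:
  "length p = k \<Longrightarrow> map ((!) (p @ x)) [k + a..<k + b] = map ((!) x) [a..<b]"
  by (intro nth_equalityI) (auto simp: nth_append)

lemma map_nth_append_left: "b \<le> length x \<Longrightarrow> map ((!) (x @ r)) [a..<b] = map ((!) x) [a..<b]"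
  by (intro nth_equalityI) (auto simp: nth_append)

lemma length_concat_blocks: "\<forall>xs \<in> set xss. length xs = b \<Longrightarrow> length (concat xss) = length xss * b"
  by (induction xss) auto

lemma map_nth_concat:
  assumes "\<forall>xs \<in> set xss. length xs = b" "j < length xss" "c \<le> b"
  shows "map ((!) (concat xss)) [j * b + a..<j * b + c] = map ((!) (xss ! j)) [a..<c]"
  using assms
proof (induction xss arbitrary: j)
  case (Cons xs xss)
  show ?case
  proof (cases j)
    case 0
    then show ?thesis
      using Cons.prems by (auto simp: map_nth_append_left)
  next
    case (Suc i)
    have "map ((!) (xs @ concat xss)) [b + (i * b + a)..<b + (i * b + c)] =
        map ((!) (concat xss)) [i * b + a..<i * b + c]"
      using Cons.prems(1) by (intro map_nth_append_shift) simp
    then show ?thesis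
      using Cons.IH[of i] Cons.prems Suc by (simp add: add.assoc)
  qed
qed simp

definition enc_ints :: "nat \<Rightarrow> int list \<Rightarrow> bool list" where
  "enc_ints q xs = concat (map (enc_int q) xs)"

lemma length_enc_int [simp]: "length (enc_int q x) = Qlen q"
  by (simp add: enc_int_def)

lemma length_enc_ints [simp]: "length (enc_ints q xs) = length xs * Qlen q"
  using length_concat_blocks[of "map (enc_int q) xs" "Qlen q"] by (simp add: enc_ints_def)

lemma enc_ints_append: "enc_ints q (xs @ ys) = enc_ints q xs @ enc_ints q ys"
  by (simp add: enc_ints_def)

lemma map_nth_enc_ints:
  "j < length xs \<Longrightarrow> map ((!) (enc_ints q xs)) [j * Qlen q..<j * Qlen q + Qlen q] = enc_int q (xs ! j)"
  using map_nth_concat[of "map (enc_int q) xs" "Qlen q" j "Qlen q" 0] map_nth[of "enc_int q (xs ! j)"]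
  by (simp add: enc_ints_def)

lemma enc_ints_zero: "enc_ints q (replicate K 0) = replicate (K * Qlen q) False"
proof -
  have "enc_int q 0 = replicate (Qlen q) False"
    by (intro nth_equalityI) (simp_all add: enc_int_def)
  then show ?thesis
    by (induction K) (simp_all add: enc_ints_def replicate_add)
qed

text \<open>Lists carry the arithmetic from here on: circuits, folds and the abelian group all work
  on them, with \<open>enc_ints\<close> as the encoding.\<close>

definition zq_lists :: "nat \<Rightarrow> nat \<Rightarrow> int list set" where
  "zq_lists q K = {xs. length xs = K \<and> set xs \<subseteq> Zq q}"

definition add_mod :: "nat \<Rightarrow> int list \<Rightarrow> int list \<Rightarrow> int list" where
  "add_mod q = map2 (\<lambda>x y. (x + y) mod int q)"

lemma add_mod_zq_lists: "0 < q \<Longrightarrow> xs \<in> zq_lists q K \<Longrightarrow> ys \<in> zq_lists q K \<Longrightarrow> add_mod q xs ys \<in> zq_lists q K"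
  by (auto simp: zq_lists_def add_mod_def Zq_def)

lemma zero_zq_lists: "0 < q \<Longrightarrow> replicate K 0 \<in> zq_lists q K"
  by (auto simp: zq_lists_def Zq_def)

definition select_row :: "nat \<Rightarrow> bool \<times> int list \<Rightarrow> int list" where
  "select_row K = (\<lambda>(c, y). if c then y else replicate K 0)"

text \<open>Zero is encoded by zero bits, so masking a vector is the conjunction of every bit with
  the mask bit. The function is described only on encodings of reduced vectors: one conditional
  subtraction of \<open>q\<close> is sure to reduce a sum if both summands are below
  \<open>q\<close>.\<close>

lemma computes_masked_add:
  assumes q: "0 < q" "int q \<le> 2 ^ Qlen q"
  defines "Q \<equiv> Qlen q"
  shows "\<exists>F. computes_fun (K * Q + 1 + K * Q) (K * Q) (K * Q * 10 + K * (Q + Q + 500 * (Q + 2))) F \<and>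
    (\<forall>xs \<in> zq_lists q K. \<forall>ys \<in> zq_lists q K. \<forall>c.
       F (enc_ints q xs @ [c] @ enc_ints q ys) = enc_ints q (add_mod q xs (select_row K (c, ys))))"
proof -
  define n where "n = K * Q + 1 + K * Q"
  define M where "M z = map (\<lambda>j. z ! (K * Q) \<and> z ! (K * Q + 1 + j)) [0..<K * Q]" for z :: "bool list"
  define S where "S w = concat (map (\<lambda>j. mod_add_bits q Q (map ((!) w) [j * Q..<j * Q + Q])
    (map ((!) w) [(n + j * Q)..<(n + j * Q) + Q])) [0..<K])" for w :: "bool list"
  have "computes_fun n (K * Q) (K * Q * 10) M"
    unfolding M_def n_def
    by (intro computes_bits computes_mono[OF computes_and[OF computes_var computes_var]]) auto
  moreover have "computes_fun (n + K * Q) (K * Q) (K * (Q + Q + 500 * (Q + 2))) S"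
    unfolding S_def
  proof (intro computes_fun_blocks computes_mod_add computes_slice)
    fix j assume "j < K"
    then have "Suc j * Q \<le> K * Q"
      by (intro mult_le_mono1) simp
    then show "j * Q + Q \<le> n + K * Q" "n + j * Q + Q \<le> n + K * Q"
      by (simp_all add: n_def)
  qed
  ultimately have "computes_fun n (K * Q) (K * Q * 10 + K * (Q + Q + 500 * (Q + 2))) (\<lambda>z. S (z @ M z))"
    by (rule computes_fun_let)
  moreover have "S (z @ M z) = enc_ints q (add_mod q xs (select_row K (c, ys)))"
    if xs: "xs \<in> zq_lists q K" and ys: "ys \<in> zq_lists q K"
      and z: "z = enc_ints q xs @ [c] @ enc_ints q ys" for xs ys c z
  proof -
    let ?y = "select_row K (c, ys)"
    have y: "?y \<in> zq_lists q K"
      using ys zero_zq_lists[OF q(1)] by (auto simp: select_row_def)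
    have l: "length xs = K" "length ys = K" "length ?y = K"
      using xs ys y by (auto simp: zq_lists_def)
    have "M z = map (\<lambda>j. c \<and> enc_ints q ys ! j) [0..<K * Q]"
      unfolding M_def using l by (intro map_cong refl) (auto simp: z nth_append Q_def)
    also have "\<dots> = enc_ints q ?y"
      using l by (cases c) (auto simp: select_row_def enc_ints_zero Q_def map_replicate_const
          intro: nth_equalityI)
    finally have M: "M z = enc_ints q ?y" .
    have "mod_add_bits q Q (map ((!) (z @ M z)) [j * Q..<j * Q + Q])
        (map ((!) (z @ M z)) [(n + j * Q)..<(n + j * Q) + Q]) = enc_int q ((xs ! j + ?y ! j) mod int q)"
      if j: "j < K" for j
    proof -
      have "Suc j * Q \<le> K * Q"
        using j by (intro mult_le_mono1) simp
      then have "map ((!) (z @ M z)) [j * Q..<j * Q + Q] = enc_int q (xs ! j)"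
        using l j by (simp add: z map_nth_append_left map_nth_enc_ints Q_def)
      moreover have "map ((!) (z @ M z)) [n + j * Q..<n + (j * Q + Q)] = enc_int q (?y ! j)"
      proof -
        have "length z = n"
          using l by (simp add: z n_def Q_def)
        then have "map ((!) (z @ M z)) [n + j * Q..<n + (j * Q + Q)] = map ((!) (M z)) [j * Q..<j * Q + Q]"
          by (rule map_nth_append_shift)
        also have "\<dots> = enc_int q (?y ! j)"
          unfolding M Q_def using l j by (intro map_nth_enc_ints) simp
        finally show ?thesis .
      qed
      moreover have "xs ! j \<in> Zq q" "?y ! j \<in> Zq q"
        using xs y j nth_mem[of j xs] nth_mem[of j ?y] unfolding zq_lists_def by auto
      ultimately show ?thesis
        using mod_add_bits[OF _ _ q(2)] by (simp add: enc_int_def Q_def add.assoc)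
    qed
    then have "S (z @ M z) = concat (map (\<lambda>j. enc_int q ((xs ! j + ?y ! j) mod int q)) [0..<K])"
      unfolding S_def by (intro arg_cong[of _ _ concat] map_cong) auto
    also have "\<dots> = enc_ints q (add_mod q xs ?y)"
      using l unfolding enc_ints_def add_mod_def
      by (intro arg_cong[of _ _ concat] nth_equalityI) auto
    finally show ?thesis .
  qed
  ultimately show ?thesis
    unfolding n_def by (intro exI[of _ "\<lambda>z. S (z @ M z)"]) simp
qed

section \<open>Subset sums of rows\<close>

text \<open>The fold is the form that a circuit follows, one masked addition per row. With
  \<open>rs\<close> the rows of the key, \<open>fs\<close> the bits of \<open>f\<close> and
  \<open>a\<close> the shift for \<open>b\<close>, this is the ciphertext.\<close>

definition row_sum :: "nat \<Rightarrow> nat \<Rightarrow> int list \<Rightarrow> bool list \<Rightarrow> int list list \<Rightarrow> int list" where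
  "row_sum q K a fs rs = foldl (add_mod q) a (map (select_row K) (zip fs rs))"

lemma row_sum_zq_lists:
  assumes "0 < q" "a \<in> zq_lists q K" "set rs \<subseteq> zq_lists q K"
  shows "row_sum q K a fs rs \<in> zq_lists q K"
  using assms(2,3) unfolding row_sum_def
proof (induction rs arbitrary: fs a)
  case (Cons r rs)
  then show ?case
    by (cases fs) (auto simp: select_row_def assms(1) add_mod_zq_lists zero_zq_lists)
qed simp

lemma computes_row_sum:
  assumes q: "0 < q" "int q \<le> 2 ^ Qlen q" and c: "c \<in> zq_lists q K"
  defines "Q \<equiv> Qlen q"
  defines "s \<equiv> K * Q * 10 + K * (Q + Q + 500 * (Q + 2))"
  shows "\<exists>F. computes_fun (m * (K * Q) + 1 + m) (K * Q) (K * Q * 10 + m * s) F \<and>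
    (\<forall>rs b fs. length rs = m \<longrightarrow> set rs \<subseteq> zq_lists q K \<longrightarrow> length fs = m \<longrightarrow>
       F (concat (map (enc_ints q) rs) @ [b] @ fs) = enc_ints q (row_sum q K (select_row K (b, c)) fs rs))"
proof -
  define N where "N = m * (K * Q) + 1 + m"
  obtain A where A: "computes_fun (K * Q + 1 + K * Q) (K * Q) s A"
    and A': "\<And>xs ys b. xs \<in> zq_lists q K \<Longrightarrow> ys \<in> zq_lists q K \<Longrightarrow>
      A (enc_ints q xs @ [b] @ enc_ints q ys) = enc_ints q (add_mod q xs (select_row K (b, ys)))"
    using computes_masked_add[OF q, of K] unfolding s_def Q_def by blast
  \<comment> \<open>Induction on the number of rows added so far. The input format stays that of all
    \<open>m\<close> rows, so stage \<open>i\<close> finds its row and its mask bit at fixed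
    wires.\<close>
  have "\<exists>F. computes_fun N (K * Q) (K * Q * 10 + i * s) F \<and>
    (\<forall>rs b fs. length rs = m \<longrightarrow> set rs \<subseteq> zq_lists q K \<longrightarrow> length fs = m \<longrightarrow>
       F (concat (map (enc_ints q) rs) @ [b] @ fs) =
         enc_ints q (row_sum q K (select_row K (b, c)) (take i fs) (take i rs)))" if "i \<le> m" for i
    using that
  proof (induction i)
    case 0
    \<comment> \<open>\<open>c\<close> is known when the circuit is built: where its encoding has a
      one, the start value has the wire of \<open>b\<close>, elsewhere the constant
      \<open>False\<close>.\<close>
    define F where "F x = map (\<lambda>j. if enc_ints q c ! j then x ! (m * (K * Q)) else False) [0..<K * Q]"
      for x :: "bool list"
    have "computes_fun N (K * Q) (K * Q * 10) F"
      unfolding F_def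
    proof (rule computes_bits)
      fix j
      show "computes_fun N 1 10 (\<lambda>x. [if enc_ints q c ! j then x ! (m * (K * Q)) else False])"
        using computes_mono[OF computes_var] computes_const by (cases "enc_ints q c ! j") (auto simp: N_def)
    qed
    moreover have "F (concat (map (enc_ints q) rs) @ [b] @ fs) = enc_ints q (select_row K (b, c))"
      if rs: "length rs = m" "set rs \<subseteq> zq_lists q K" for rs b fs
    proof -
      have "length (concat (map (enc_ints q) rs)) = m * (K * Q)"
        using length_concat_blocks[of "map (enc_ints q) rs" "K * Q"] rs by (auto simp: zq_lists_def Q_def)
      then have "F (concat (map (enc_ints q) rs) @ [b] @ fs) = map (\<lambda>j. enc_ints q c ! j \<and> b) [0..<K * Q]"
        by (auto simp: F_def nth_append)
      also have "\<dots> = enc_ints q (select_row K (b, c))"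
        using c by (cases b) (auto simp: select_row_def enc_ints_zero Q_def map_replicate_const zq_lists_def
            intro: nth_equalityI)
      finally show ?thesis .
    qed
    ultimately show ?case
      by (auto simp: row_sum_def)
  next
    case (Suc i)
    from Suc.IH[OF Suc_leD[OF Suc.prems]]
    obtain F where F: "computes_fun N (K * Q) (K * Q * 10 + i * s) F"
      and F': "\<And>rs b fs. length rs = m \<Longrightarrow> set rs \<subseteq> zq_lists q K \<Longrightarrow> length fs = m \<Longrightarrow>
       F (concat (map (enc_ints q) rs) @ [b] @ fs) =
         enc_ints q (row_sum q K (select_row K (b, c)) (take i fs) (take i rs))"
      by blast
    \<comment> \<open>Accumulator, mask bit and row, in the order in which \<open>A\<close> takes
      them.\<close>
    let ?sel = "[N..<N + K * Q] @ [m * (K * Q) + 1 + i] @ [i * (K * Q)..<i * (K * Q) + K * Q]"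
    have "Suc i * (K * Q) \<le> m * (K * Q)"
      using Suc.prems by (intro mult_le_mono1) simp
    then have "computes_fun N (K * Q) (K * Q * 10 + i * s + s) (\<lambda>x. A (map ((!) (x @ F x)) ?sel))"
      using Suc.prems by (intro computes_fun_bind[OF F A]) (auto simp: N_def)
    moreover have "A (map ((!) (x @ F x)) ?sel) =
        enc_ints q (row_sum q K (select_row K (b, c)) (take (Suc i) fs) (take (Suc i) rs))"
      if rs: "length rs = m" "set rs \<subseteq> zq_lists q K" and fs: "length fs = m"
        and x: "x = concat (map (enc_ints q) rs) @ [b] @ fs" for rs b fs x
    proof -
      let ?a = "row_sum q K (select_row K (b, c)) (take i fs) (take i rs)"
      have i: "i < m"
        using Suc.prems by simp
      have len: "\<forall>xs\<in>set (map (enc_ints q) rs). length xs = K * Q"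
        using rs by (auto simp: zq_lists_def Q_def)
      have lenc: "length (concat (map (enc_ints q) rs)) = m * (K * Q)"
        using length_concat_blocks[OF len] rs by simp
      have "?a \<in> zq_lists q K"
        using rs c zero_zq_lists[OF q(1)] in_set_takeD
        by (intro row_sum_zq_lists q) (fastforce simp: select_row_def)+
      moreover have "map ((!) (x @ F x)) [N..<N + K * Q] = enc_ints q ?a"
      proof -
        have Fx: "F x = enc_ints q ?a"
          using F'[OF rs fs, of b] by (simp only: x)
        have "length x = N"
          using lenc fs by (simp add: x N_def)
        moreover from \<open>?a \<in> zq_lists q K\<close> have "length (F x) = K * Q"
          by (simp add: Fx zq_lists_def Q_def)
        ultimately show ?thesis
          using map_nth_append_upt[of x N "F x"] Fx by (simp only:)
      qed
      moreover have "map ((!) (x @ F x)) [m * (K * Q) + 1 + i] = [fs ! i]"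
        using lenc fs i by (simp add: x nth_append)
      moreover have "map ((!) (x @ F x)) [i * (K * Q)..<i * (K * Q) + K * Q] = enc_ints q (rs ! i)"
      proof -
        have "i * (K * Q) + K * Q \<le> m * (K * Q)"
          using \<open>Suc i * (K * Q) \<le> m * (K * Q)\<close> by simp
        then have "map ((!) (x @ F x)) [i * (K * Q)..<i * (K * Q) + K * Q] =
            map ((!) (concat (map (enc_ints q) rs))) [i * (K * Q) + 0..<i * (K * Q) + K * Q]"
          using lenc by (simp add: x map_nth_append_left)
        also have "\<dots> = map ((!) (map (enc_ints q) rs ! i)) [0..<K * Q]"
          using rs i by (intro map_nth_concat len) auto
        also have "\<dots> = enc_ints q (rs ! i)"
          using rs i len map_nth[of "enc_ints q (rs ! i)"] by simp
        finally show ?thesis .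
      qed
      moreover have "rs ! i \<in> zq_lists q K"
        using rs i nth_mem by blast
      ultimately have "A (map ((!) (x @ F x)) ?sel) = enc_ints q (add_mod q ?a (select_row K (fs ! i, rs ! i)))"
        using A' by (simp only: map_append)
      then show ?thesis
        using rs fs i by (simp add: row_sum_def take_Suc_conv_app_nth)
    qed
    ultimately show ?case
      by (intro exI[of _ "\<lambda>x. A (map ((!) (x @ F x)) ?sel)"]) (simp add: add.assoc add.commute[of s])
  qed
  from this[OF order_refl] show ?thesis
    unfolding N_def by (elim exE conjE) (intro exI conjI allI impI, assumption, simp)
qed

section \<open>The rewound prover as a distinguisher\<close>

lemma computes_comp:
  assumes "computes n k s1 F" "computes k k' s2 G"
  shows "computes n k' (s1 + s2) (\<lambda>x. F x \<bind> G)"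
proof -
  have "computes n k' (s1 + s2) (\<lambda>x. F x \<bind> (\<lambda>y. G (map ((!) (x @ y)) [n..<n + k])))"
    using assms by (rule computes_bind) auto
  then show ?thesis
  proof (rule computes_cong)
    fix x :: "bool list" assume x: "length x = n"
    show "F x \<bind> (\<lambda>y. G (map ((!) (x @ y)) [n..<n + k])) = F x \<bind> G"
      using length_computes[OF assms(1) x] map_nth_append_upt[OF x]
      by (intro bind_pmf_cong refl) metis
  qed
qed

text \<open>The first \<open>k\<close> bits of the response, the message \<open>(y, u)\<close>, are
  dropped: only the memory is passed on. Being a classical string, it can be used twice.\<close>

definition guess_bit :: "circuit \<Rightarrow> circuit \<Rightarrow> nat \<Rightarrow> bool list \<Rightarrow> bool pmf" where
  "guess_bit C1 C2 k x = do {
     r \<leftarrow> run_circuit C1 x;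
     d0 \<leftarrow> run_circuit C2 (False # drop k r);
     d1 \<leftarrow> run_circuit C2 (True # drop k r);
     return_pmf (hd d0 \<noteq> hd d1) }"

lemma computes_guess_bit:
  assumes C1: "wf_circuit n (k + mem) C1" and C2: "wf_circuit (1 + mem) 1 C2"
  shows "computes n 1 (circuit_size C1 + 2 * circuit_size C2 + 36)
           (\<lambda>x. map_pmf (\<lambda>b. [b]) (guess_bit C1 C2 k x))"
proof -
  let ?S = "\<lambda>b r. run_circuit C2 (b # drop k r)"
  have S: "computes (k + mem) 1 (10 + circuit_size C2) (?S b)" for b
  proof -
    have "computes (k + mem) 1 (10 + circuit_size C2)
        (\<lambda>r. run_circuit C2 (map ((!) (r @ [b])) ((k + mem) # [k..<k + mem])))"
      by (rule computes_fun_bind[OF computes_const computes_circuit[OF C2]]) auto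
    then show ?thesis
    proof (rule computes_cong)
      fix r :: "bool list" assume "length r = k + mem"
      then have "map ((!) (r @ [b])) ((k + mem) # [k..<k + mem]) = b # drop k r"
        by (simp add: nth_append map_nth_append_left map_nth_upt_take)
      then show "run_circuit C2 (map ((!) (r @ [b])) ((k + mem) # [k..<k + mem])) = ?S b r"
        by simp
    qed
  qed
  have X: "computes_fun (1 + 1) 1 16 (\<lambda>z. [z ! 0 \<noteq> z ! 1])"
    by (intro computes_mono[OF computes_xor[OF computes_var computes_var]]) auto
  \<comment> \<open>Each challenge bit is a constant of cost 10, and the final exclusive or costs
    16.\<close>
  have "computes n 1 (circuit_size C1 + ((10 + circuit_size C2 + (10 + circuit_size C2)) + 16))
      (\<lambda>x. run_circuit C1 x \<bind> (\<lambda>r. (?S False r \<bind> (\<lambda>y. map_pmf (\<lambda>z. y @ z) (?S True r)))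
         \<bind> (\<lambda>z. return_pmf [z ! 0 \<noteq> z ! 1])))"
    by (intro computes_comp[OF computes_circuit[OF C1]] computes_comp[OF computes_pair X] S)
  then have "computes n 1 (circuit_size C1 + 2 * circuit_size C2 + 36)
      (\<lambda>x. run_circuit C1 x \<bind> (\<lambda>r. (?S False r \<bind> (\<lambda>y. map_pmf (\<lambda>z. y @ z) (?S True r)))
         \<bind> (\<lambda>z. return_pmf [z ! 0 \<noteq> z ! 1])))"
    by (rule computes_mono) simp
  then show ?thesis
  proof (rule computes_cong)
    fix x :: "bool list" assume x: "length x = n"
    have A: "(?S False r \<bind> (\<lambda>y. map_pmf (\<lambda>z. y @ z) (?S True r))) \<bind> (\<lambda>z. return_pmf [z ! 0 \<noteq> z ! 1]) =
        ?S False r \<bind> (\<lambda>d0. ?S True r \<bind> (\<lambda>d1. return_pmf [hd d0 \<noteq> hd d1]))"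
      if r: "r \<in> set_pmf (run_circuit C1 x)" for r
    proof -
      have lr: "length r = k + mem"
        using length_computes[OF computes_circuit[OF C1] x r] .
      have "return_pmf [(y @ z) ! 0 \<noteq> (y @ z) ! 1] = return_pmf [hd y \<noteq> hd z]"
        if "y \<in> set_pmf (?S False r)" "z \<in> set_pmf (?S True r)" for y z
        using length_computes[OF S lr that(1)] length_computes[OF S lr that(2)]
        by (auto simp: length_Suc_conv)
      then show ?thesis
        by (auto simp: bind_assoc_pmf bind_map_pmf intro!: bind_pmf_cong)
    qed
    show "run_circuit C1 x \<bind> (\<lambda>r. (?S False r \<bind> (\<lambda>y. map_pmf (\<lambda>z. y @ z) (?S True r)))
         \<bind> (\<lambda>z. return_pmf [z ! 0 \<noteq> z ! 1])) = map_pmf (\<lambda>b. [b]) (guess_bit C1 C2 k x)"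
      unfolding guess_bit_def map_bind_pmf map_return_pmf by (intro bind_pmf_cong[OF refl] A)
  qed
qed

text \<open>The prover reads all of \<open>A\<close> before \<open>v\<close>, whereas an LWE sample
  brings a row together with its entry of \<open>v\<close>; this is the prover's order.\<close>

definition enc_rows :: "nat \<Rightarrow> nat \<Rightarrow> int list list \<Rightarrow> bool list" where
  "enc_rows q n rs = concat (map (\<lambda>r. enc_ints q (take n r)) rs) @ concat (map (\<lambda>r. enc_int q (r ! n)) rs)"

text \<open>The guessing game as a function of the rows only. The hybrids differ just in the
  distribution of the rows: LWE samples with a common secret, or uniform.\<close>

definition guess_correct ::
  "circuit \<Rightarrow> circuit \<Rightarrow> nat \<Rightarrow> nat \<Rightarrow> nat \<Rightarrow> int list \<Rightarrow> int list list \<Rightarrow> bool pmf" where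
  "guess_correct C1 C2 k q n c rs = do {
     b \<leftarrow> coin;
     fs \<leftarrow> replicate_pmf (length rs) coin;
     g \<leftarrow> guess_bit C1 C2 k (enc_rows q n rs @
            enc_ints q (row_sum q (Suc n) (select_row (Suc n) (b, c)) fs rs));
     return_pmf (g = b) }"

lemma map_nth_concat_upt:
  assumes "\<forall>xs \<in> set xss. length xs = b" "a \<le> c" "c \<le> b"
  shows "map ((!) (concat xss @ r)) (concat (map (\<lambda>i. [i * b + a..<i * b + c]) [0..<length xss])) =
           concat (map (\<lambda>xs. take (c - a) (drop a xs)) xss)"
proof -
  have "map ((!) (concat xss @ r)) [i * b + a..<i * b + c] = take (c - a) (drop a (xss ! i))"
    if "i < length xss" for i
  proof -
    have "Suc i * b \<le> length xss * b"
      using that by (intro mult_le_mono1) simp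
    then have "map ((!) (concat xss @ r)) [i * b + a..<i * b + c] = map ((!) (concat xss)) [i * b + a..<i * b + c]"
      using assms length_concat_blocks[OF assms(1)] by (intro map_nth_append_left) simp
    also have "\<dots> = map ((!) (xss ! i)) [a..<c]"
      using assms that by (intro map_nth_concat)
    also have "\<dots> = take (c - a) (drop a (xss ! i))"
      using assms that by (intro map_nth_upt_take) simp
    finally show ?thesis .
  qed
  then have "map (map ((!) (concat xss @ r))) (map (\<lambda>i. [i * b + a..<i * b + c]) [0..<length xss]) =
      map (\<lambda>xs. take (c - a) (drop a xs)) xss"
    by (intro nth_equalityI) simp_all
  then show ?thesis
    by (simp only: map_concat)
qed

text \<open>The negation is due to the convention that \<open>True\<close> stands for uniform samples: a correct guess
  of \<open>b\<close> is evidence for LWE samples.\<close>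

lemma distinguisher_circuit:
  assumes q: "0 < q" "int q \<le> 2 ^ Qlen q" and c: "c \<in> zq_lists q (Suc n)"
    and C1: "wf_circuit (m * n * Qlen q + m * Qlen q + n * Qlen q + Qlen q) (k + mem) C1"
    and C2: "wf_circuit (1 + mem) 1 C2"
  defines "Q \<equiv> Qlen q"
  defines "K \<equiv> Suc n"
  shows "\<exists>C. wf_circuit (m * (K * Q)) 1 C \<and>
    circuit_size C \<le> 2 * (1 + m) + (K * Q * 10 + m * (K * Q * 10 + K * (Q + Q + 500 * (Q + 2)))) +
      (circuit_size C1 + 2 * circuit_size C2 + 36) + 34 \<and>
    (\<forall>rs. length rs = m \<longrightarrow> set rs \<subseteq> zq_lists q K \<longrightarrow>
       map_pmf hd (run_circuit C (concat (map (enc_ints q) rs))) =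
       map_pmf HOL.Not (guess_correct C1 C2 k q n c rs))"
proof -
  define N where "N = m * (K * Q) + 1 + m"
  let ?sF = "K * Q * 10 + m * (K * Q * 10 + K * (Q + Q + 500 * (Q + 2)))"
  obtain F where F: "computes_fun N (K * Q) ?sF F"
    and F': "\<And>rs b fs. length rs = m \<Longrightarrow> set rs \<subseteq> zq_lists q K \<Longrightarrow> length fs = m \<Longrightarrow>
       F (concat (map (enc_ints q) rs) @ [b] @ fs) = enc_ints q (row_sum q K (select_row K (b, c)) fs rs)"
    using computes_row_sum[OF q c, of m] unfolding N_def Q_def K_def by blast
  \<comment> \<open>The prover's order from the wires at hand: the first \<open>n\<close> entries of
    all rows, then their last entries, then the ciphertext, which starts at wire
    \<open>N\<close>.\<close>
  define sel where "sel = concat (map (\<lambda>i. [i * (K * Q) + 0..<i * (K * Q) + n * Q]) [0..<m]) @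
    concat (map (\<lambda>i. [i * (K * Q) + n * Q..<i * (K * Q) + K * Q]) [0..<m]) @ [N..<N + K * Q]"
  let ?s = "circuit_size C1 + 2 * circuit_size C2 + 36"
  let ?G = "\<lambda>z. map_pmf (\<lambda>b. [b]) (guess_bit C1 C2 k z)"
  \<comment> \<open>The guess is compared with the first coin, the bit \<open>b\<close>, which
    follows the samples at wire \<open>m * (K * Q)\<close>.\<close>
  let ?X = "\<lambda>z. return_pmf [\<not> (z ! (N + K * Q) = z ! (m * (K * Q)))]"
  have "i * (K * Q) + K * Q \<le> m * (K * Q)" if "i < m" for i
    using mult_le_mono1[of "Suc i" m "K * Q"] that by simp
  then have sel: "\<forall>i \<in> set sel. i < N + K * Q"
    by (fastforce simp: sel_def N_def K_def)
  have lsel: "length sel = m * n * Q + m * Q + n * Q + Q"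
    by (simp add: sel_def length_concat comp_def sum_list_triv K_def algebra_simps)
  have G: "computes (N + K * Q) 1 ?s (\<lambda>z. ?G (map ((!) z) sel))"
    using C1 C2 lsel sel unfolding Q_def
    by (intro computes_reindex[OF computes_guess_bit]) auto
  have X: "computes_fun (N + K * Q + 1) 1 34 (\<lambda>z. [\<not> (z ! (N + K * Q) = z ! (m * (K * Q)))])"
    by (intro computes_mono[OF computes_xor[OF computes_var computes_var]]) (auto simp: N_def)
  have "computes (m * (K * Q) + (1 + m)) 1 (?sF + (?s + 34))
      (\<lambda>y. ?G (map ((!) (y @ F y)) sel) \<bind> (\<lambda>g. ?X ((y @ F y) @ g)))"
    using computes_fun_let[OF F computes_let[OF G X]] by (simp add: N_def)
  from computes_let[OF computes_coins this]
  have "computes (m * (K * Q)) 1 (2 * (1 + m) + (?sF + (?s + 34)))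
      (\<lambda>x. replicate_pmf (1 + m) coin \<bind>
        (\<lambda>cs. let y = x @ cs in ?G (map ((!) (y @ F y)) sel) \<bind> (\<lambda>g. ?X ((y @ F y) @ g))))"
    unfolding Let_def .
  then obtain C where C: "wf_circuit (m * (K * Q)) 1 C" "circuit_size C \<le> 2 * (1 + m) + (?sF + (?s + 34))"
    and C': "\<And>x. length x = m * (K * Q) \<Longrightarrow> run_circuit C x = replicate_pmf (1 + m) coin \<bind>
        (\<lambda>cs. let y = x @ cs in ?G (map ((!) (y @ F y)) sel) \<bind> (\<lambda>g. ?X ((y @ F y) @ g)))"
    unfolding computes_def by blast
  have "map_pmf hd (run_circuit C (concat (map (enc_ints q) rs))) =
       map_pmf HOL.Not (guess_correct C1 C2 k q n c rs)"
    if rs: "length rs = m" "set rs \<subseteq> zq_lists q K" for rs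
  proof -
    let ?x = "concat (map (enc_ints q) rs)"
    have len: "\<forall>xs\<in>set (map (enc_ints q) rs). length xs = K * Q"
      using rs by (auto simp: zq_lists_def Q_def)
    have lx: "length ?x = m * (K * Q)"
      using length_concat_blocks[OF len] rs by simp
    have eq: "map_pmf hd (let y = ?x @ b # fs in ?G (map ((!) (y @ F y)) sel) \<bind> (\<lambda>g. ?X ((y @ F y) @ g))) =
        guess_bit C1 C2 k (enc_rows q n rs @ enc_ints q (row_sum q K (select_row K (b, c)) fs rs)) \<bind>
          (\<lambda>g. return_pmf (\<not> (g = b)))"
      if fs: "length fs = m" for b fs
    proof -
      define y where "y = ?x @ [b] @ fs"
      define ct where "ct = row_sum q K (select_row K (b, c)) fs rs"
      have Fy: "F y = enc_ints q ct"
        unfolding y_def ct_def using rs fs by (intro F')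
      have ly: "length y = N"
        using lx fs by (simp add: y_def N_def)
      have lF: "length (F y) = K * Q"
        using length_computes_fun[OF F ly] .
      have "map ((!) (y @ F y)) (concat (map (\<lambda>i. [i * (K * Q) + 0..<i * (K * Q) + n * Q]) [0..<m])) =
          concat (map (\<lambda>r. enc_ints q (take n r)) rs)"
      proof -
        have "take (n * Q) (enc_ints q r) = enc_ints q (take n r)" if "r \<in> set rs" for r
        proof -
          have "length r = K"
            using that rs by (auto simp: zq_lists_def)
          then have "length (enc_ints q (take n r)) = n * Q"
            by (simp add: Q_def K_def)
          then show ?thesis
            using enc_ints_append[of q "take n r" "drop n r"] by simp
        qed
        then show ?thesis
          using map_nth_concat_upt[OF len, of 0 "n * Q" "([b] @ fs) @ F y"] rs
          by (simp add: y_def K_def comp_def cong: map_cong)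
      qed
      moreover have "map ((!) (y @ F y)) (concat (map (\<lambda>i. [i * (K * Q) + n * Q..<i * (K * Q) + K * Q]) [0..<m])) =
          concat (map (\<lambda>r. enc_int q (r ! n)) rs)"
      proof -
        have "take (K * Q - n * Q) (drop (n * Q) (enc_ints q r)) = enc_int q (r ! n)" if "r \<in> set rs" for r
        proof -
          have lr: "length r = K"
            using that rs by (auto simp: zq_lists_def)
          then have "length (enc_ints q (take n r)) = n * Q"
            by (simp add: Q_def K_def)
          moreover have "r = take n r @ [r ! n]"
            using lr by (simp add: K_def flip: take_Suc_conv_app_nth)
          then have "enc_ints q r = enc_ints q (take n r) @ enc_int q (r ! n)"
            using enc_ints_append[of q "take n r" "[r ! n]"] by (simp add: enc_ints_def[of q "[r ! n]"])
          ultimately show ?thesis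
            by (simp add: K_def Q_def lr min_def)
        qed
        then show ?thesis
          using map_nth_concat_upt[OF len, of "n * Q" "K * Q" "([b] @ fs) @ F y"] rs
          by (simp add: y_def K_def comp_def cong: map_cong)
      qed
      moreover have "map ((!) (y @ F y)) [N..<N + K * Q] = F y"
        using map_nth_append_upt[OF ly, of "F y"] by (simp only: lF)
      ultimately have "map ((!) (y @ F y)) sel = enc_rows q n rs @ enc_ints q ct"
        by (simp only: sel_def map_append enc_rows_def Fy append_assoc)
      moreover have "((y @ F y) @ [g]) ! (N + K * Q) = g" for g
        using ly lF by (simp add: nth_append)
      moreover have "((y @ F y) @ [g]) ! (m * (K * Q)) = b" for g
        using lx by (simp add: y_def nth_append)
      ultimately have "?G (map ((!) (y @ F y)) sel) \<bind> (\<lambda>g. ?X ((y @ F y) @ g)) =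
          guess_bit C1 C2 k (enc_rows q n rs @ enc_ints q ct) \<bind> (\<lambda>g. return_pmf [\<not> (g = b)])"
        by (simp only: bind_map_pmf)
      then show ?thesis
        unfolding Let_def ct_def y_def by (simp add: map_bind_pmf)
    qed
    have "map_pmf hd (run_circuit C ?x) = coin \<bind> (\<lambda>b. replicate_pmf m coin \<bind> (\<lambda>fs.
        map_pmf hd (let y = ?x @ b # fs in ?G (map ((!) (y @ F y)) sel) \<bind> (\<lambda>g. ?X ((y @ F y) @ g)))))"
      unfolding C'[OF lx] by (simp add: bind_assoc_pmf bind_return_pmf map_bind_pmf Let_def)
    also have "\<dots> = map_pmf HOL.Not (guess_correct C1 C2 k q n c rs)"
      unfolding guess_correct_def map_bind_pmf map_return_pmf K_def[symmetric] rs(1)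
      by (intro bind_pmf_cong refl eq) (simp add: set_replicate_pmf)
    finally show ?thesis .
  qed
  then show ?thesis
    using C by (intro exI[of _ C]) (auto simp: add.assoc)
qed

section \<open>The leftover hash lemma\<close>

lemma pmf_bind_const_on:
  assumes "\<And>x. x \<in> set_pmf p \<Longrightarrow> pmf (f x) i = c"
  shows "pmf (p \<bind> f) i = c"
proof -
  have "pmf (p \<bind> f) i = measure_pmf.expectation p (\<lambda>x. c)"
    unfolding pmf_bind using assms by (intro integral_cong_AE) (auto simp: AE_measure_pmf_iff)
  then show ?thesis
    by simp
qed

lemma integrable_pmf_comp: "integrable (measure_pmf p) (\<lambda>x. pmf (f x) i)"
  by (rule measure_pmf.integrable_const_bound[where B = 1]) (auto simp: pmf_le_1)

lemma expectation_mono: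
  fixes f g :: "'a \<Rightarrow> real"
  assumes "integrable (measure_pmf p) f" "integrable (measure_pmf p) g"
    "\<And>x. x \<in> set_pmf p \<Longrightarrow> f x \<le> g x"
  shows "measure_pmf.expectation p f \<le> measure_pmf.expectation p g"
  using assms by (intro integral_mono_AE) (auto simp: AE_measure_pmf_iff)

lemma replicate_pmf_of_set:
  assumes "finite A" "A \<noteq> {}"
  shows "replicate_pmf m (pmf_of_set A) = pmf_of_set {xs. length xs = m \<and> set xs \<subseteq> A}"
proof (induction m)
  case 0
  have "{xs. length xs = 0 \<and> set xs \<subseteq> A} = {[]}"
    by auto
  then show ?case
    by (simp only: pmf_of_set_singleton replicate_pmf.simps)
next
  case (Suc m)
  let ?L = "\<lambda>m. {xs. length xs = m \<and> set xs \<subseteq> A}"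
  have fin: "finite (?L m)" for m
    using finite_lists_length_eq[OF assms(1), of m] by (simp add: conj_commute)
  obtain a where "a \<in> A"
    using assms(2) by blast
  then have "replicate m a \<in> ?L m" for m
    by auto
  then have ne: "?L m \<noteq> {}" for m
    by blast
  have pair: "pair_pmf (pmf_of_set A) (pmf_of_set (?L m)) = pmf_of_set (A \<times> ?L m)"
  proof (rule pmf_eqI)
    fix z :: "'a \<times> 'a list"
    have "A \<times> ?L m \<noteq> {}" "finite (A \<times> ?L m)"
      using assms fin[of m] ne[of m] by auto
    then show "pmf (pair_pmf (pmf_of_set A) (pmf_of_set (?L m))) z = pmf (pmf_of_set (A \<times> ?L m)) z"
      using assms pmf_of_set[OF ne fin, of m]
      by (cases z) (simp add: pmf_pair card_cartesian_product indicator_def)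
  qed
  then have "replicate_pmf (Suc m) (pmf_of_set A) = map_pmf (\<lambda>(x, xs). x # xs) (pmf_of_set (A \<times> ?L m))"
    unfolding replicate_pmf.simps Suc.IH
    by (simp add: pair_pmf_def map_bind_pmf flip: pair)
  also have "\<dots> = pmf_of_set (?L (Suc m))"
  proof (rule map_pmf_of_set_bij_betw)
    show "bij_betw (\<lambda>(x, xs). x # xs) (A \<times> ?L m) (?L (Suc m))"
      by (auto simp: bij_betw_def inj_on_def length_Suc_conv image_iff)
  qed (use assms fin[of m] ne[of m] in auto)
  finally show ?case .
qed

lemma pmf_replicate_coin: "length fs = m \<Longrightarrow> pmf (replicate_pmf m coin) fs = 1 / 2 ^ m"
proof -
  assume "length fs = m"
  moreover have "card {xs :: bool list. length xs = m} = 2 ^ m"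
    using card_lists_length_eq[of "UNIV :: bool set" m] by simp
  moreover have "finite {xs :: bool list. length xs = m}"
    using finite_lists_length_eq[of "UNIV :: bool set" m] by simp
  ultimately show ?thesis
    using pmf_of_set[of "{xs :: bool list. length xs = m}" fs]
    unfolding coin_def by (subst replicate_pmf_of_set) (auto simp: exI[of _ fs])
qed

section \<open>Subset sums of uniform elements of a finite abelian group\<close>

context comm_group
begin

fun subset_prod :: "bool list \<Rightarrow> 'a list \<Rightarrow> 'a" where
  "subset_prod (f # fs) (r # rs) = (if f then r else \<one>) \<otimes> subset_prod fs rs"
| "subset_prod _ _ = \<one>"

lemma subset_prod_closed: "set rs \<subseteq> carrier G \<Longrightarrow> subset_prod fs rs \<in> carrier G"
  by (induction fs rs rule: subset_prod.induct) auto

lemma foldl_subset_prod: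
  "set rs \<subseteq> carrier G \<Longrightarrow> a \<in> carrier G \<Longrightarrow>
     foldl (\<otimes>) a (map (\<lambda>(f, r). if f then r else \<one>) (zip fs rs)) = a \<otimes> subset_prod fs rs"
  by (induction fs rs arbitrary: a rule: subset_prod.induct) (auto simp: m_assoc subset_prod_closed)

text \<open>At a position where the selections differ, one side has the uniform factor and the other
  has not; for any values of the remaining factors exactly one group element solves the equation.
  Positions where they agree cancel.\<close>

lemma subset_prod_collision:
  assumes fin: "finite (carrier G)" and "length fs = m" "length fs' = m" "fs \<noteq> fs'"
  shows "pmf (map_pmf (\<lambda>rs. subset_prod fs rs = subset_prod fs' rs)
           (replicate_pmf m (pmf_of_set (carrier G)))) True = 1 / card (carrier G)"
  using assms(2-)
proof (induction m arbitrary: fs fs')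
  case (Suc m)
  let ?U = "pmf_of_set (carrier G)"
  have U: "set_pmf ?U = carrier G"
    using fin one_closed by (intro set_pmf_of_set) auto
  have R: "set rs \<subseteq> carrier G" if "rs \<in> set_pmf (replicate_pmf m ?U)" for rs
    using that U by (auto simp: set_replicate_pmf)
  obtain f gs f' gs' where fs: "fs = f # gs" "fs' = f' # gs'" "length gs = m" "length gs' = m"
    using Suc.prems(1,2) by (auto simp: length_Suc_conv)
  let ?t = "\<lambda>f r. if f then r else \<one>"
  have eq: "map_pmf (\<lambda>rs. subset_prod fs rs = subset_prod fs' rs) (replicate_pmf (Suc m) ?U) =
      replicate_pmf m ?U \<bind> (\<lambda>rs. map_pmf (\<lambda>r. ?t f r \<otimes> subset_prod gs rs = ?t f' r \<otimes> subset_prod gs' rs) ?U)"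
    by (simp only: fs(1,2) subset_prod.simps replicate_pmf.simps map_bind_pmf map_return_pmf
        bind_commute_pmf[of ?U]) (simp only: map_pmf_def)
  show ?case
  proof (cases "f = f'")
    case True
    then have ne: "gs \<noteq> gs'"
      using Suc.prems(3) fs by simp
    have "map_pmf (\<lambda>r. ?t f r \<otimes> subset_prod gs rs = ?t f' r \<otimes> subset_prod gs' rs) ?U =
        return_pmf (subset_prod gs rs = subset_prod gs' rs)" if "rs \<in> set_pmf (replicate_pmf m ?U)" for rs
    proof -
      have "map_pmf (\<lambda>r. ?t f r \<otimes> subset_prod gs rs = ?t f' r \<otimes> subset_prod gs' rs) ?U =
          map_pmf (\<lambda>r. subset_prod gs rs = subset_prod gs' rs) ?U"
        using subset_prod_closed[OF R[OF that]] U by (intro map_pmf_cong) (auto simp: True)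
      then show ?thesis
        by (simp add: map_pmf_const)
    qed
    then have "replicate_pmf m ?U \<bind> (\<lambda>rs. map_pmf (\<lambda>r. ?t f r \<otimes> subset_prod gs rs = ?t f' r \<otimes> subset_prod gs' rs) ?U) =
        map_pmf (\<lambda>rs. subset_prod gs rs = subset_prod gs' rs) (replicate_pmf m ?U)"
      by (auto simp: map_pmf_def intro!: bind_pmf_cong)
    then show ?thesis
      unfolding eq using Suc.IH[OF fs(3,4) ne] by simp
  next
    case False
    show ?thesis
      unfolding eq
    proof (rule pmf_bind_const_on)
      fix rs assume "rs \<in> set_pmf (replicate_pmf m ?U)"
      then have cl: "subset_prod gs rs \<in> carrier G" "subset_prod gs' rs \<in> carrier G"
        using R subset_prod_closed by auto
      \<comment> \<open>\<open>a\<close> multiplies the factor \<open>r\<close>, on whichever side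
        that is, so the equation reads \<open>r \<otimes> a = b\<close>.\<close>
      define a where "a = subset_prod (if f then gs else gs') rs"
      define b where "b = subset_prod (if f then gs' else gs) rs"
      have ab: "a \<in> carrier G" "b \<in> carrier G"
        using cl by (auto simp: a_def b_def)
      have "{r \<in> carrier G. ?t f r \<otimes> subset_prod gs rs = ?t f' r \<otimes> subset_prod gs' rs} = {b \<otimes> inv a}"
        using False cl ab by (cases f) (auto simp: a_def b_def inv_solve_right inv_solve_right' m_assoc)
      moreover have "pmf (map_pmf P ?U) True = card {r \<in> carrier G. P r} / card (carrier G)" for P
      proof -
        have "carrier G \<inter> {r. P r} = {r \<in> carrier G. P r}"
          by auto
        then show ?thesis
          using fin one_closed by (subst pmf_map, subst measure_pmf_of_set) (auto simp: vimage_def)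
      qed
      ultimately show "pmf (map_pmf (\<lambda>r. ?t f r \<otimes> subset_prod gs rs = ?t f' r \<otimes> subset_prod gs' rs) ?U) True =
          1 / card (carrier G)"
        by simp
    qed
  qed
qed simp

text \<open>The sum of the absolute deviations is bounded through the squares by AM-GM with weight
  \<open>c = sqrt (1 / (2 ^ m * N))\<close>, and the expected sum of squares is a collision probability.\<close>

lemma leftover_hash:
  assumes fin: "finite (carrier G)"
  defines "U \<equiv> pmf_of_set (carrier G)"
  shows "\<bar>pmf (replicate_pmf m U \<bind> (\<lambda>rs. replicate_pmf m coin \<bind> (\<lambda>fs. g rs (subset_prod fs rs)))) True
    - pmf (replicate_pmf m U \<bind> (\<lambda>rs. U \<bind> g rs)) True\<bar> \<le> sqrt (card (carrier G) / 2 ^ m)"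
proof -
  define N where "N = real (card (carrier G))"
  define R where "R = replicate_pmf m U"
  define B where "B = replicate_pmf m coin"
  define P where "P rs = map_pmf (\<lambda>fs. subset_prod fs rs) B" for rs
  define c where "c = sqrt (1 / (2 ^ m * N))"
  define S where "S rs = (\<Sum>u\<in>carrier G. (pmf (P rs) u - 1 / N)\<^sup>2)" for rs
  let ?E = "measure_pmf.expectation R"
  have N: "N > 0"
    using fin one_closed by (auto simp: N_def card_gt_0_iff)
  have c: "c > 0"
    using N by (simp add: c_def)
  have setU: "set_pmf U = carrier G"
    unfolding U_def using fin one_closed by (intro set_pmf_of_set) auto
  have pmfU: "pmf U u = 1 / N" if "u \<in> carrier G" for u
    using that pmf_of_set[OF carrier_not_empty fin] by (simp add: U_def N_def)
  have setR: "set rs \<subseteq> carrier G" if "rs \<in> set_pmf R" for rs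
    using that setU by (auto simp: R_def set_replicate_pmf)
  have "set_pmf R \<subseteq> {xs. set xs \<subseteq> carrier G \<and> length xs = m}"
    using setU by (auto simp: R_def set_replicate_pmf)
  then have finR: "finite (set_pmf R)"
    using finite_lists_length_eq[OF fin] by (rule finite_subset)
  have "set_pmf B \<subseteq> {fs. set fs \<subseteq> UNIV \<and> length fs = m}"
    by (auto simp: B_def set_replicate_pmf)
  then have finB: "finite (set_pmf B)"
    using finite_lists_length_eq[of "UNIV :: bool set"] by (rule finite_subset) simp
  have int: "integrable R f" for f :: "'a list \<Rightarrow> real"
    by (intro integrable_measure_pmf_finite finR)
  have setP: "set_pmf (P rs) \<subseteq> carrier G" if "rs \<in> set_pmf R" for rs
    using subset_prod_closed[OF setR[OF that]] by (auto simp: P_def)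
  have bind_P: "pmf (B \<bind> (\<lambda>fs. g rs (subset_prod fs rs))) True = (\<Sum>u\<in>carrier G. pmf (g rs u) True * pmf (P rs) u)"
    if "rs \<in> set_pmf R" for rs
  proof -
    have "B \<bind> (\<lambda>fs. g rs (subset_prod fs rs)) = P rs \<bind> g rs"
      by (simp add: P_def bind_map_pmf)
    then show ?thesis
      using setP[OF that] fin by (simp add: pmf_bind) (subst integral_measure_pmf_real[of "carrier G"]; auto)
  qed
  have bind_U: "pmf (U \<bind> g rs) True = (\<Sum>u\<in>carrier G. pmf (g rs u) True * (1 / N))" for rs
    unfolding pmf_bind using fin setU pmfU by (subst integral_measure_pmf_real[of "carrier G"]) auto
  have sumP: "(\<Sum>u\<in>carrier G. pmf (P rs) u) = 1" if "rs \<in> set_pmf R" for rs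
    using fin setP[OF that] by (rule sum_pmf_eq_1)
  have S: "S rs = (\<Sum>u\<in>carrier G. (pmf (P rs) u)\<^sup>2) - 1 / N" if "rs \<in> set_pmf R" for rs
  proof -
    have "S rs = (\<Sum>u\<in>carrier G. (pmf (P rs) u)\<^sup>2 - 2 / N * pmf (P rs) u + (1 / N)\<^sup>2)"
      unfolding S_def by (intro sum.cong) (auto simp: power2_eq_square algebra_simps)
    also have "\<dots> = (\<Sum>u\<in>carrier G. (pmf (P rs) u)\<^sup>2) - 2 / N * (\<Sum>u\<in>carrier G. pmf (P rs) u) + N * (1 / N)\<^sup>2"
      by (simp add: sum.distrib sum_subtractf sum_distrib_left N_def)
    also have "\<dots> = (\<Sum>u\<in>carrier G. (pmf (P rs) u)\<^sup>2) - 1 / N"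
      using N sumP[OF that] by (simp add: power2_eq_square field_simps)
    finally show ?thesis .
  qed
  \<comment> \<open>The sum of squares is the probability that two independent selections give the
    same product.\<close>
  have coll: "(\<Sum>u\<in>carrier G. (pmf (P rs) u)\<^sup>2) =
      pmf (B \<bind> (\<lambda>fs. map_pmf (\<lambda>fs'. subset_prod fs rs = subset_prod fs' rs) B)) True"
    if "rs \<in> set_pmf R" for rs
  proof -
    have "B \<bind> (\<lambda>fs. map_pmf (\<lambda>fs'. subset_prod fs rs = subset_prod fs' rs) B) =
        P rs \<bind> (\<lambda>u. map_pmf (\<lambda>u'. u = u') (P rs))"
      by (simp add: P_def bind_map_pmf map_pmf_comp)
    also have "pmf \<dots> True = measure_pmf.expectation (P rs) (\<lambda>u. pmf (P rs) u)"
    proof -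
      have "pmf (map_pmf (\<lambda>u'. u = u') (P rs)) True = pmf (P rs) u" for u
        by (simp add: pmf_map vimage_def measure_pmf_single)
      then show ?thesis
        by (simp add: pmf_bind)
    qed
    also have "\<dots> = (\<Sum>u\<in>carrier G. pmf (P rs) u * pmf (P rs) u)"
      using setP[OF that] fin by (intro integral_measure_pmf_real) auto
    finally show ?thesis
      by (simp add: power2_eq_square)
  qed
  have "?E S = ?E (\<lambda>rs. pmf (B \<bind> (\<lambda>fs. map_pmf (\<lambda>fs'. subset_prod fs rs = subset_prod fs' rs) B)) True - 1 / N)"
    by (intro integral_cong_AE) (auto simp: AE_measure_pmf_iff S coll)
  also have "\<dots> = pmf (R \<bind> (\<lambda>rs. B \<bind> (\<lambda>fs. map_pmf (\<lambda>fs'. subset_prod fs rs = subset_prod fs' rs) B))) True - 1 / N"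
    by (simp add: int pmf_bind[of R])
  \<comment> \<open>With the rows drawn last, the two selections are fixed while the rows are
    random, as \<open>subset_prod_collision\<close> requires.\<close>
  also have "R \<bind> (\<lambda>rs. B \<bind> (\<lambda>fs. map_pmf (\<lambda>fs'. subset_prod fs rs = subset_prod fs' rs) B)) =
      B \<bind> (\<lambda>fs. B \<bind> (\<lambda>fs'. map_pmf (\<lambda>rs. subset_prod fs rs = subset_prod fs' rs) R))"
    unfolding map_pmf_def by (subst bind_commute_pmf, subst (2) bind_commute_pmf) (rule refl)
  \<comment> \<open>The second selection equals the first with probability \<open>1 / 2 ^ m\<close>,
    and unequal selections collide with probability \<open>1 / N\<close>.\<close>
  also have "pmf \<dots> True \<le> 1 / 2 ^ m + 1 / N"
  proof -
    have "pmf (B \<bind> (\<lambda>fs'. map_pmf (\<lambda>rs. subset_prod fs rs = subset_prod fs' rs) R)) True \<le> 1 / 2 ^ m + 1 / N"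
      if fs: "fs \<in> set_pmf B" for fs
    proof -
      have "pmf (B \<bind> (\<lambda>fs'. map_pmf (\<lambda>rs. subset_prod fs rs = subset_prod fs' rs) R)) True =
          measure_pmf.expectation B (\<lambda>fs'. pmf (map_pmf (\<lambda>rs. subset_prod fs rs = subset_prod fs' rs) R) True)"
        by (rule pmf_bind)
      also have "\<dots> \<le> measure_pmf.expectation B (\<lambda>fs'. indicator {fs} fs' + 1 / N)"
      proof (rule expectation_mono[OF integrable_pmf_comp])
        show "integrable (measure_pmf B) (\<lambda>fs'. indicator {fs} fs' + 1 / N)"
          by (intro integrable_measure_pmf_finite finB)
        fix fs' assume fs': "fs' \<in> set_pmf B"
        show "pmf (map_pmf (\<lambda>rs. subset_prod fs rs = subset_prod fs' rs) R) True \<le> indicator {fs} fs' + 1 / N"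
        proof (cases "fs = fs'")
          case True
          then show ?thesis
            using N by (simp add: add_increasing2 pmf_le_1)
        next
          case False
          then show ?thesis
            using subset_prod_collision[OF fin _ _ False, of m] fs fs'
            by (simp add: B_def set_replicate_pmf R_def U_def N_def)
        qed
      qed
      also have "\<dots> = pmf B fs + 1 / N"
        using integrable_measure_pmf_finite[OF finB, of "indicator {fs} :: _ \<Rightarrow> real"]
        by (simp add: measure_pmf_single)
      also have "pmf B fs = 1 / 2 ^ m"
        using fs unfolding B_def by (intro pmf_replicate_coin) (simp add: set_replicate_pmf)
      finally show ?thesis .
    qed
    then have "measure_pmf.expectation B (\<lambda>fs. pmf (B \<bind> (\<lambda>fs'. map_pmf (\<lambda>rs. subset_prod fs rs = subset_prod fs' rs) R)) True)
        \<le> measure_pmf.expectation B (\<lambda>fs. 1 / 2 ^ m + 1 / N)"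
      by (intro expectation_mono integrable_pmf_comp) auto
    then show ?thesis
      by (simp add: pmf_bind[of B])
  qed
  finally have ES: "?E S \<le> 1 / 2 ^ m"
    by simp
  have "pmf (R \<bind> (\<lambda>rs. B \<bind> (\<lambda>fs. g rs (subset_prod fs rs)))) True - pmf (R \<bind> (\<lambda>rs. U \<bind> g rs)) True =
      ?E (\<lambda>rs. pmf (B \<bind> (\<lambda>fs. g rs (subset_prod fs rs))) True - pmf (U \<bind> g rs) True)"
    unfolding pmf_bind[of R] by (simp add: int)
  also have "\<bar>\<dots>\<bar> \<le> ?E (\<lambda>rs. \<bar>pmf (B \<bind> (\<lambda>fs. g rs (subset_prod fs rs))) True - pmf (U \<bind> g rs) True\<bar>)"
    by (rule integral_abs_bound)
  also have "\<dots> \<le> ?E (\<lambda>rs. (S rs / c + N * c) / 2)"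
  proof (rule expectation_mono[OF int int])
    show "\<bar>pmf (B \<bind> (\<lambda>fs. g rs (subset_prod fs rs))) True - pmf (U \<bind> g rs) True\<bar> \<le> (S rs / c + N * c) / 2"
      if "rs \<in> set_pmf R" for rs
    proof -
      have "pmf (B \<bind> (\<lambda>fs. g rs (subset_prod fs rs))) True - pmf (U \<bind> g rs) True =
          (\<Sum>u\<in>carrier G. pmf (g rs u) True * (pmf (P rs) u - 1 / N))"
        unfolding bind_P[OF that] bind_U by (simp add: sum_subtractf right_diff_distrib)
      also have "\<bar>\<dots>\<bar> \<le> (\<Sum>u\<in>carrier G. ((pmf (P rs) u - 1 / N)\<^sup>2 / c + c) / 2)"
      proof (rule order_trans[OF sum_abs sum_mono])
        fix u
        let ?d = "pmf (P rs) u - 1 / N"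
        have "\<bar>pmf (g rs u) True * ?d\<bar> \<le> 1 * \<bar>?d\<bar>"
          unfolding abs_mult by (intro mult_right_mono) (auto simp: pmf_le_1)
        also have "\<dots> \<le> (?d\<^sup>2 / c + c) / 2"
        proof -
          have "0 \<le> (\<bar>?d\<bar> - c)\<^sup>2"
            by simp
          then show ?thesis
            using c by (simp add: power2_eq_square field_simps)
        qed
        finally show "\<bar>pmf (g rs u) True * ?d\<bar> \<le> (?d\<^sup>2 / c + c) / 2" .
      qed
      also have "\<dots> = (S rs / c + N * c) / 2"
        by (simp add: S_def N_def sum.distrib sum_divide_distrib[symmetric])
      finally show ?thesis .
    qed
  qed
  also have "\<dots> = (?E S / c + N * c) / 2"
    by (simp add: int)
  also have "\<dots> \<le> (1 / 2 ^ m / c + N * c) / 2"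
    using ES c by (intro divide_right_mono add_right_mono) auto
  \<comment> \<open>At this \<open>c\<close> the two terms of the weighted inequality
    balance.\<close>
  also have "\<dots> = N * c"
  proof -
    have "c * c = 1 / (2 ^ m * N)"
      using N by (simp add: c_def)
    then have "1 / 2 ^ m = N * (c * c)"
      using N by (simp add: field_simps)
    then show ?thesis
      using c by (simp add: field_simps)
  qed
  also have "N * c = sqrt (N / 2 ^ m)"
  proof -
    have "N * c = sqrt (N * N) * sqrt (1 / (2 ^ m * N))"
      using N by (simp add: c_def)
    also have "\<dots> = sqrt (N * N * (1 / (2 ^ m * N)))"
      by (simp only: real_sqrt_mult)
    also have "N * N * (1 / (2 ^ m * N)) = N / 2 ^ m"
      using N by simp
    finally show ?thesis .
  qed
  finally show ?thesis
    unfolding R_def B_def N_def .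
qed

end

section \<open>Vectors over Z_q as a finite abelian group\<close>

definition zq_group :: "nat \<Rightarrow> nat \<Rightarrow> int list monoid" where
  "zq_group q K = \<lparr>carrier = zq_lists q K, monoid.mult = add_mod q, one = replicate K 0\<rparr>"

lemma zq_group_simps [simp]:
  "carrier (zq_group q K) = zq_lists q K" "mult (zq_group q K) = add_mod q"
  "\<one>\<^bsub>zq_group q K\<^esub> = replicate K 0"
  by (simp_all add: zq_group_def)

lemma zq_lists_nth: "xs \<in> zq_lists q K \<Longrightarrow> i < K \<Longrightarrow> 0 \<le> xs ! i \<and> xs ! i < int q"
proof -
  assume "xs \<in> zq_lists q K" "i < K"
  then have "xs ! i \<in> Zq q"
    using nth_mem[of i xs] unfolding zq_lists_def by blast
  then show ?thesis
    by (simp add: Zq_def)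
qed

lemma comm_group_zq_group:
  assumes q: "0 < q"
  shows "comm_group (zq_group q K)"
proof (rule comm_groupI, simp_all add: add_mod_zq_lists[OF q] zero_zq_lists[OF q])
  fix x y z assume x: "x \<in> zq_lists q K" and y: "y \<in> zq_lists q K"
  then have l: "length x = K" "length y = K"
    by (auto simp: zq_lists_def)
  show "add_mod q x y = add_mod q y x"
    using l by (intro nth_equalityI) (auto simp: add_mod_def add.commute)
  show "add_mod q (replicate K 0) x = x"
    using l zq_lists_nth[OF x] by (intro nth_equalityI) (auto simp: add_mod_def)
  show "\<exists>y\<in>zq_lists q K. add_mod q y x = replicate K 0"
  proof
    let ?y = "map (\<lambda>a. (- a) mod int q) x"
    show "?y \<in> zq_lists q K"
      using l q by (auto simp: zq_lists_def Zq_def)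
    show "add_mod q ?y x = replicate K 0"
      using l by (intro nth_equalityI) (auto simp: add_mod_def mod_simps)
  qed
  assume z: "z \<in> zq_lists q K"
  show "add_mod q (add_mod q x y) z = add_mod q x (add_mod q y z)"
    using l z by (intro nth_equalityI) (auto simp: add_mod_def zq_lists_def mod_simps add.assoc)
qed

lemma finite_Zq [simp]: "finite (Zq q)"
  by (simp add: Zq_def)

lemma finite_zq_lists: "finite (zq_lists q K)"
  using finite_lists_length_eq[of "Zq q" K] by (simp add: zq_lists_def conj_commute)

lemma card_zq_lists: "card (zq_lists q K) = q ^ K"
  using card_lists_length_eq[of "Zq q" K] by (simp add: zq_lists_def Zq_def conj_commute)

lemma row_sum_subset_prod:
  assumes "0 < q" "a \<in> zq_lists q K" "set rs \<subseteq> zq_lists q K"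
  shows "row_sum q K a fs rs = add_mod q a (comm_group.subset_prod (zq_group q K) fs rs)"
  using comm_group.foldl_subset_prod[OF comm_group_zq_group[OF assms(1)], of rs K a fs] assms
  by (simp add: row_sum_def select_row_def cong: if_cong)

lemma map_add_mod_uniform:
  assumes q: "0 < q" and a: "a \<in> zq_lists q K"
  shows "map_pmf (add_mod q a) (pmf_of_set (zq_lists q K)) = pmf_of_set (zq_lists q K)"
proof (rule map_pmf_of_set_bij_betw)
  interpret comm_group "zq_group q K"
    by (rule comm_group_zq_group[OF q])
  have "inj_on (add_mod q a) (zq_lists q K)"
  proof (rule inj_onI)
    fix x y assume xy: "x \<in> zq_lists q K" "y \<in> zq_lists q K" "add_mod q a x = add_mod q a y"
    then have "add_mod q x a = add_mod q y a"
      using a m_comm[of a x] m_comm[of a y] by simp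
    then show "x = y"
      using a xy right_cancel[of a x y] by simp
  qed
  moreover have "add_mod q a ` zq_lists q K \<subseteq> zq_lists q K"
    using a q by (auto intro: add_mod_zq_lists)
  ultimately show "bij_betw (add_mod q a) (zq_lists q K) (zq_lists q K)"
    by (simp add: bij_betw_def endo_inj_surj finite_zq_lists)
qed (use a finite_zq_lists in auto)

lemma pmf_coin_bind: "pmf (coin \<bind> f) i = (pmf (f True) i + pmf (f False) i) / 2"
  unfolding coin_def by (subst pmf_bind_pmf_of_set) (auto simp: UNIV_bool)

text \<open>With uniform rows and a uniform last vector in place of the ciphertext, the bit \<open>b\<close> is hidden
  perfectly.\<close>

lemma guess_correct_uniform:
  assumes q: "0 < q" and c: "c \<in> zq_lists q (Suc n)"
  shows "pmf (replicate_pmf m (pmf_of_set (zq_lists q (Suc n))) \<bind> guess_correct C1 C2 k q n c) True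
    \<le> 1 / 2 + sqrt (real (q ^ Suc n) / 2 ^ m)"
proof -
  let ?K = "Suc n"
  interpret comm_group "zq_group q ?K"
    by (rule comm_group_zq_group[OF q])
  let ?U = "pmf_of_set (zq_lists q ?K)"
  let ?R = "replicate_pmf m ?U"
  define cb where "cb b = select_row ?K (b, c)" for b
  define gb where "gb rs u = guess_bit C1 C2 k (enc_rows q n rs @ enc_ints q u)" for rs u
  define g where "g b rs u = map_pmf (\<lambda>x. x = b) (gb rs (add_mod q (cb b) u))" for b rs u
  \<comment> \<open>The guess on a uniform ciphertext. Adding the shift for \<open>b\<close> keeps
    the ciphertext uniform, so one \<open>H\<close> serves both values of \<open>b\<close>.\<close>
  define H where "H = ?R \<bind> (\<lambda>rs. ?U \<bind> gb rs)"
  have U: "set_pmf ?U = zq_lists q ?K"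
    using finite_zq_lists zero_zq_lists[OF q] by (intro set_pmf_of_set) auto
  have cb: "cb b \<in> zq_lists q ?K" for b
    using c zero_zq_lists[OF q, of ?K] by (auto simp: cb_def select_row_def simp del: replicate_Suc)
  have "?R \<bind> guess_correct C1 C2 k q n c =
      ?R \<bind> (\<lambda>rs. coin \<bind> (\<lambda>b. replicate_pmf m coin \<bind> (\<lambda>fs. g b rs (subset_prod fs rs))))"
  proof (intro bind_pmf_cong refl)
    fix rs assume "rs \<in> set_pmf ?R"
    then have rs: "length rs = m" "set rs \<subseteq> zq_lists q ?K"
      using U by (auto simp: set_replicate_pmf)
    show "guess_correct C1 C2 k q n c rs =
        coin \<bind> (\<lambda>b. replicate_pmf m coin \<bind> (\<lambda>fs. g b rs (subset_prod fs rs)))"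
      unfolding guess_correct_def g_def gb_def cb_def
      by (simp add: rs row_sum_subset_prod[OF q cb[unfolded cb_def]] map_pmf_def)
  qed
  also have "\<dots> = coin \<bind> (\<lambda>b. ?R \<bind> (\<lambda>rs. replicate_pmf m coin \<bind> (\<lambda>fs. g b rs (subset_prod fs rs))))"
    by (rule bind_commute_pmf)
  finally have "pmf (?R \<bind> guess_correct C1 C2 k q n c) True =
      (pmf (?R \<bind> (\<lambda>rs. replicate_pmf m coin \<bind> (\<lambda>fs. g True rs (subset_prod fs rs)))) True +
       pmf (?R \<bind> (\<lambda>rs. replicate_pmf m coin \<bind> (\<lambda>fs. g False rs (subset_prod fs rs)))) True) / 2"
    by (simp only: pmf_coin_bind)
  moreover have "pmf (?R \<bind> (\<lambda>rs. replicate_pmf m coin \<bind> (\<lambda>fs. g b rs (subset_prod fs rs)))) True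
      \<le> pmf H b + sqrt (real (q ^ ?K) / 2 ^ m)" for b
  proof -
    have "?R \<bind> (\<lambda>rs. ?U \<bind> g b rs) = map_pmf (\<lambda>x. x = b) H"
    proof -
      have "?U \<bind> g b rs = map_pmf (\<lambda>x. x = b) (map_pmf (add_mod q (cb b)) ?U \<bind> gb rs)" for rs
        by (simp add: g_def[abs_def] bind_map_pmf map_bind_pmf)
      then show ?thesis
        by (simp add: map_add_mod_uniform[OF q cb] H_def map_bind_pmf)
    qed
    moreover have "pmf (map_pmf (\<lambda>x. x = b) H) True = pmf H b"
      by (simp add: pmf_map vimage_def measure_pmf_single)
    ultimately show ?thesis
      using leftover_hash[of m "g b"] finite_zq_lists by (simp add: card_zq_lists)
  qed
  \<comment> \<open>The main terms are the probabilities of the two outcomes of \<open>H\<close> and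
    add up to 1.\<close>
  from this[of True] this[of False] have
    "pmf (?R \<bind> (\<lambda>rs. replicate_pmf m coin \<bind> (\<lambda>fs. g True rs (subset_prod fs rs)))) True +
     pmf (?R \<bind> (\<lambda>rs. replicate_pmf m coin \<bind> (\<lambda>fs. g False rs (subset_prod fs rs)))) True
      \<le> 1 + 2 * sqrt (real (q ^ ?K) / 2 ^ m)"
    by (simp add: pmf_False_conv_True[of H])
  ultimately show ?thesis
    by simp
qed

section \<open>The reduction to LWE\<close>

definition sample_row :: "int vec \<times> int \<Rightarrow> int list" where
  "sample_row = (\<lambda>(a, w). list_of_vec a @ [w])"

lemma enc_vec_enc_ints: "enc_vec q v = enc_ints q (list_of_vec v)"
  by (simp add: enc_vec_def enc_ints_def)

lemma enc_sample_row: "enc_sample q z = enc_ints q (sample_row z)"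
  by (cases z) (simp add: enc_sample_def sample_row_def enc_ints_append enc_vec_enc_ints enc_ints_def)

lemma set_list_of_vec_subset: "set (list_of_vec v) \<subseteq> A \<longleftrightarrow> (\<forall>i<dim_vec v. v $ i \<in> A)"
  by (auto simp: list_of_vec_map)

lemma list_of_vec_zq_lists:
  assumes "v \<in> Zq_vec q n"
  shows "list_of_vec v \<in> zq_lists q n"
proof -
  have "dim_vec v = n" "\<forall>i<n. v $ i \<in> Zq q"
    using assms by (auto simp: Zq_vec_def)
  then show ?thesis
    unfolding zq_lists_def by (simp add: set_list_of_vec_subset)
qed

lemma vec_of_list_Zq_vec:
  assumes xs: "xs \<in> zq_lists q n"
  shows "vec_of_list xs \<in> Zq_vec q n"
proof -
  have "length xs = n"
    using xs by (simp add: zq_lists_def)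
  then have "vec_of_list xs \<in> carrier_vec n"
    by (intro carrier_vecI) simp
  moreover have "vec_of_list xs $ i \<in> Zq q" if "i < n" for i
    unfolding vec_of_list_index Zq_def using zq_lists_nth[OF xs that] by simp
  ultimately show ?thesis
    by (simp only: Zq_vec_def mem_Collect_eq) blast
qed

lemma sample_row_bij:
  "bij_betw sample_row (Zq_vec q n \<times> Zq q) (zq_lists q (Suc n))"
proof (rule bij_betw_byWitness[where f' = "\<lambda>xs. (vec_of_list (take n xs), xs ! n)"])
  show "\<forall>z\<in>Zq_vec q n \<times> Zq q. (vec_of_list (take n (sample_row z)), sample_row z ! n) = z"
  proof
    fix z assume "z \<in> Zq_vec q n \<times> Zq q"
    then have "length (list_of_vec (fst z)) = n"
      by (auto simp: Zq_vec_def)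
    then show "(vec_of_list (take n (sample_row z)), sample_row z ! n) = z"
      by (cases z) (simp add: sample_row_def nth_append vec_list)
  qed
  show "\<forall>xs\<in>zq_lists q (Suc n). sample_row (vec_of_list (take n xs), xs ! n) = xs"
  proof
    fix xs assume "xs \<in> zq_lists q (Suc n)"
    then have "length xs = Suc n"
      by (simp add: zq_lists_def)
    then show "sample_row (vec_of_list (take n xs), xs ! n) = xs"
      by (simp add: sample_row_def list_vec flip: take_Suc_conv_app_nth)
  qed
  show "sample_row ` (Zq_vec q n \<times> Zq q) \<subseteq> zq_lists q (Suc n)"
  proof (rule image_subsetI)
    fix z assume "z \<in> Zq_vec q n \<times> Zq q"
    then show "sample_row z \<in> zq_lists q (Suc n)"
      using list_of_vec_zq_lists[of "fst z" q n] by (cases z) (simp add: sample_row_def zq_lists_def)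
  qed
  show "(\<lambda>xs. (vec_of_list (take n xs), xs ! n)) ` zq_lists q (Suc n) \<subseteq> Zq_vec q n \<times> Zq q"
  proof (rule image_subsetI)
    fix xs assume xs: "xs \<in> zq_lists q (Suc n)"
    then have "take n xs \<in> zq_lists q n"
      using set_take_subset[of n xs] by (auto simp: zq_lists_def)
    moreover have "xs ! n \<in> Zq q"
      using zq_lists_nth[OF xs, of n] by (simp add: Zq_def)
    ultimately show "(vec_of_list (take n xs), xs ! n) \<in> Zq_vec q n \<times> Zq q"
      using vec_of_list_Zq_vec by blast
  qed
qed

lemma Zq_nonempty: "0 < q \<Longrightarrow> Zq q \<noteq> {}"
  by (simp add: Zq_def)

lemma zero_Zq_vec: "0 < q \<Longrightarrow> 0\<^sub>v n \<in> Zq_vec q n"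
  by (simp add: Zq_vec_def Zq_def)

lemma list_of_vec_bij: "bij_betw list_of_vec (Zq_vec q n) (zq_lists q n)"
proof (rule bij_betw_byWitness[where f' = vec_of_list])
  show "list_of_vec ` Zq_vec q n \<subseteq> zq_lists q n"
    using list_of_vec_zq_lists by blast
  show "vec_of_list ` zq_lists q n \<subseteq> Zq_vec q n"
    using vec_of_list_Zq_vec by blast
qed (auto simp: vec_list list_vec)

lemma finite_Zq_vec: "finite (Zq_vec q n)"
  using bij_betw_finite[OF list_of_vec_bij] finite_zq_lists by blast

lemma map_sample_row_unif:
  assumes "0 < q"
  shows "map_pmf sample_row (lwe_unif n q) = pmf_of_set (zq_lists q (Suc n))"
proof -
  have "Zq_vec q n \<noteq> {}"
    using zero_Zq_vec[OF assms] by blast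
  then show ?thesis
    unfolding lwe_unif_def using Zq_nonempty[OF assms] finite_Zq_vec[of q n]
    by (intro map_pmf_of_set_bij_betw sample_row_bij) auto
qed

lemma replicate_map_pmf: "replicate_pmf m (map_pmf f p) = map_pmf (map f) (replicate_pmf m p)"
  by (induction m) (simp_all add: map_bind_pmf bind_map_pmf)

lemma set_lwe_dist:
  assumes "0 < q" "z \<in> set_pmf (lwe_dist n q \<chi> s)"
  shows "sample_row z \<in> zq_lists q (Suc n)"
proof -
  have "set_pmf (pmf_of_set (Zq_vec q n)) = Zq_vec q n"
    using zero_Zq_vec[OF assms(1)] finite_Zq_vec by (intro set_pmf_of_set) auto
  then obtain a w where z: "z = (a, w mod int q)" "a \<in> Zq_vec q n"
    using assms(2) by (auto simp: lwe_dist_def)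
  then have "z \<in> Zq_vec q n \<times> Zq q"
    using assms(1) by (simp add: Zq_def)
  then show ?thesis
    using bij_betwE[OF sample_row_bij] by blast
qed

lemma pmf_map_Not: "pmf (map_pmf HOL.Not p) True = 1 - pmf p True"
proof -
  have "pmf (map_pmf HOL.Not p) (\<not> False) = pmf p False"
    by (rule pmf_map_inj') (simp add: inj_def)
  then show ?thesis
    by (simp add: pmf_False_conv_True)
qed

text \<open>The solver says uniform exactly if the guess is wrong. Writing pL and pU for the
  probability of a correct guess on LWE rows and on uniform rows, it succeeds with probability (pL +
  (1 - pU)) / 2.\<close>

lemma lwe_experiment_distinguisher:
  assumes q: "0 < q"
    and C: "\<And>D. \<forall>z \<in> set_pmf D. length z = Suc n * Qlen q \<Longrightarrow> run_qcircuit D C =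
      replicate_pmf m D \<bind> (\<lambda>zs. map_pmf hd (run_circuit C' (concat zs)))"
    and C': "\<And>rs. length rs = m \<Longrightarrow> set rs \<subseteq> zq_lists q (Suc n) \<Longrightarrow>
      map_pmf hd (run_circuit C' (concat (map (enc_ints q) rs))) = map_pmf HOL.Not (G rs)"
  shows "pmf (lwe_experiment n q \<chi> C) True = 1 / 2 +
    (pmf (pmf_of_set (Zq_vec q n) \<bind> (\<lambda>s. replicate_pmf m (map_pmf sample_row (lwe_dist n q \<chi> s)) \<bind> G)) True -
     pmf (replicate_pmf m (pmf_of_set (zq_lists q (Suc n))) \<bind> G) True) / 2"
proof -
  have run: "run_qcircuit (map_pmf (enc_sample q) D) C =
      map_pmf HOL.Not (replicate_pmf m (map_pmf sample_row D) \<bind> G)"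
    if D: "\<And>z. z \<in> set_pmf D \<Longrightarrow> sample_row z \<in> zq_lists q (Suc n)" for D
  proof -
    let ?R = "replicate_pmf m (map_pmf sample_row D)"
    have "run_qcircuit (map_pmf (enc_sample q) D) C =
        replicate_pmf m (map_pmf (enc_ints q) (map_pmf sample_row D)) \<bind>
          (\<lambda>zs. map_pmf hd (run_circuit C' (concat zs)))"
    proof -
      have "length (enc_sample q z) = Suc n * Qlen q" if "z \<in> set_pmf D" for z
        using D[OF that] by (simp add: enc_sample_row zq_lists_def)
      then have "\<forall>z\<in>set_pmf (map_pmf (enc_sample q) D). length z = Suc n * Qlen q"
        unfolding set_map_pmf by blast
      moreover have "map_pmf (enc_sample q) D = map_pmf (enc_ints q) (map_pmf sample_row D)"
        unfolding map_pmf_comp by (intro map_pmf_cong refl enc_sample_row)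
      ultimately show ?thesis
        using C by metis
    qed
    also have "\<dots> = ?R \<bind> (\<lambda>rs. map_pmf hd (run_circuit C' (concat (map (enc_ints q) rs))))"
      by (simp only: replicate_map_pmf[of m "enc_ints q"] bind_map_pmf)
    also have "\<dots> = ?R \<bind> (\<lambda>rs. map_pmf HOL.Not (G rs))"
    proof (rule bind_pmf_cong[OF refl])
      fix rs assume rs: "rs \<in> set_pmf ?R"
      then have "length rs = m" "set rs \<subseteq> zq_lists q (Suc n)"
        using D by (auto simp: set_replicate_pmf)
      then show "map_pmf hd (run_circuit C' (concat (map (enc_ints q) rs))) = map_pmf HOL.Not (G rs)"
        by (rule C')
    qed
    also have "\<dots> = map_pmf HOL.Not (?R \<bind> G)"
      by (simp add: map_bind_pmf)
    finally show ?thesis .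
  qed
  let ?S = "pmf_of_set (Zq_vec q n)"
  let ?L = "\<lambda>s. replicate_pmf m (map_pmf sample_row (lwe_dist n q \<chi> s))"
  let ?U = "replicate_pmf m (pmf_of_set (zq_lists q (Suc n)))"
  have unif: "sample_row z \<in> zq_lists q (Suc n)" if "z \<in> set_pmf (lwe_unif n q)" for z
  proof -
    have "set_pmf (map_pmf sample_row (lwe_unif n q)) = zq_lists q (Suc n)"
      unfolding map_sample_row_unif[OF q] using zero_zq_lists[OF q] finite_zq_lists
      by (intro set_pmf_of_set) auto
    then show ?thesis
      using that by (simp add: set_eq_iff image_iff) blast
  qed
  have U: "run_qcircuit (map_pmf (enc_sample q) (lwe_unif n q)) C = map_pmf HOL.Not (?U \<bind> G)"
    unfolding map_sample_row_unif[OF q, symmetric] by (rule run) (rule unif)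
  have L: "run_qcircuit (map_pmf (enc_sample q) (lwe_dist n q \<chi> s)) C = map_pmf HOL.Not (?L s \<bind> G)" for s
    by (rule run) (rule set_lwe_dist[OF q])
  have exp: "lwe_experiment n q \<chi> C = coin \<bind> (\<lambda>\<beta>. ?S \<bind> (\<lambda>s. map_pmf (\<lambda>\<beta>'. \<beta>' = \<beta>)
      (run_qcircuit (map_pmf (enc_sample q) (if \<beta> then lwe_unif n q else lwe_dist n q \<chi> s)) C)))"
    by (simp only: lwe_experiment_def map_pmf_def)
  have F: "map_pmf (\<lambda>\<beta>'. \<beta>' = False) (map_pmf HOL.Not p) = p" for p
    by (simp add: map_pmf_comp)
  have T: "map_pmf (\<lambda>\<beta>'. \<beta>' = True) p = p" for p
    by simp
  have "pmf (lwe_experiment n q \<chi> C) True =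
      (pmf (map_pmf HOL.Not (?U \<bind> G)) True + pmf (?S \<bind> (\<lambda>s. ?L s \<bind> G)) True) / 2"
    by (simp only: exp pmf_coin_bind if_True if_False U L F T bind_pmf_const)
  then show ?thesis
    by (simp add: pmf_map_Not field_simps)
qed

section \<open>From the protocol to guessing the bit\<close>

text \<open>The relation is affine, so it passes through a shared sample. This strips off the common
  randomness of protocol and guess, one sample after another.\<close>

lemma pmf_bind_half:
  assumes "\<And>x. x \<in> set_pmf p \<Longrightarrow> pmf (f x) True \<le> (1 + pmf (g x) True) / 2"
  shows "pmf (p \<bind> f) True \<le> (1 + pmf (p \<bind> g) True) / 2"
proof -
  have "pmf (p \<bind> f) True \<le> measure_pmf.expectation p (\<lambda>x. (1 + pmf (g x) True) / 2)"
    unfolding pmf_bind using assms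
    by (intro expectation_mono integrable_pmf_comp) (auto intro!: integrable_pmf_comp)
  also have "\<dots> = (1 + pmf (p \<bind> g) True) / 2"
    by (simp add: pmf_bind integrable_pmf_comp)
  finally show ?thesis .
qed

lemma pmf_bind_union_bound:
  assumes "\<And>x. x \<in> set_pmf p \<Longrightarrow> pmf (f x) True + pmf (g x) True \<le> 1 + pmf (h x) True"
  shows "pmf (p \<bind> f) True + pmf (p \<bind> g) True \<le> 1 + pmf (p \<bind> h) True"
proof -
  have "pmf (p \<bind> f) True + pmf (p \<bind> g) True =
      measure_pmf.expectation p (\<lambda>x. pmf (f x) True + pmf (g x) True)"
    by (simp add: pmf_bind integrable_pmf_comp)
  also have "\<dots> \<le> measure_pmf.expectation p (\<lambda>x. 1 + pmf (h x) True)"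
    using assms by (intro expectation_mono) (auto intro!: integrable_pmf_comp)
  also have "\<dots> = 1 + pmf (p \<bind> h) True"
    by (simp add: pmf_bind integrable_pmf_comp)
  finally show ?thesis .
qed

text \<open>Running the second response on both challenges: if both answers were accepted, their
  exclusive or would be \<open>b\<close>.\<close>

lemma both_challenges:
  "pmf (coin \<bind> (\<lambda>b'. X b' \<bind> (\<lambda>r. return_pmf ((d \<noteq> hd r) = (b \<and> b'))))) True \<le>
     (1 + pmf (X False \<bind> (\<lambda>d0. X True \<bind> (\<lambda>d1. return_pmf ((hd d0 \<noteq> hd d1) = b)))) True) / 2"
proof -
  \<comment> \<open>Both checks, for one and the same \<open>d\<close>, are put into an experiment
    that runs the response on both challenges: on \<open>False\<close> the check is
    \<open>d = hd d0\<close>, on \<open>True\<close> it is \<open>(d \<noteq> hd d1) = b\<close>,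
    and together they force the third event.\<close>
  have "pmf (X False \<bind> (\<lambda>d0. X True \<bind> (\<lambda>d1. return_pmf (d = hd d0)))) True +
      pmf (X False \<bind> (\<lambda>d0. X True \<bind> (\<lambda>d1. return_pmf ((d \<noteq> hd d1) = b)))) True \<le>
      1 + pmf (X False \<bind> (\<lambda>d0. X True \<bind> (\<lambda>d1. return_pmf ((hd d0 \<noteq> hd d1) = b)))) True"
    by (intro pmf_bind_union_bound) (auto simp: indicator_def)
  then show ?thesis
    unfolding pmf_coin_bind by simp
qed

text \<open>The guessing game in the matrix notation of the protocol;
  \<open>accepting_guess_eq\<close> translates it to rows.\<close>

definition accepting_guess ::
  "circuit \<Rightarrow> circuit \<Rightarrow> nat \<Rightarrow> nat \<Rightarrow> nat \<Rightarrow> int mat \<Rightarrow> int vec \<Rightarrow> bool pmf" where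
  "accepting_guess C1 C2 k q m A v = do {
     b \<leftarrow> coin;
     f \<leftarrow> pmf_of_set (binary_vecs m);
     g \<leftarrow> guess_bit C1 C2 k (enc_mat q A @ enc_vec q v @ enc_vec q (modv q (transpose_mat A *\<^sub>v f)) @
            enc_int q ((f \<bullet> v + of_bool b * \<lfloor>real q / 4\<rfloor>) mod int q));
     return_pmf (g = b) }"

text \<open>Protocol and guess share everything up to the challenge, and \<open>d\<close> is
  determined by then, so \<open>both_challenges\<close> applies for fixed values of the shared
  samples.\<close>

lemma protocol_Q_le_guess:
  "pmf (protocol_Q n q \<sigma> Gen Inv C1 C2) True \<le> (1 + pmf (Gen \<bind> (\<lambda>(A, t).
     pmf_of_set (Zq_vec q n) \<bind> (\<lambda>s. iid_vec (mdim n q) (trunc_gaussian \<sigma> (tau n q)) \<bind> (\<lambda>e.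
       accepting_guess C1 C2 (mdim n q * Qlen q + n * Qlen q) q (mdim n q) A (modv q (A *\<^sub>v s + e)))))) True) / 2"
proof -
  let ?k = "mdim n q * Qlen q + n * Qlen q"
  have "pmf (protocol_Q n q \<sigma> Gen Inv C1 C2) True \<le> (1 + pmf (pmf_of_set (Zq_vec q n) \<bind> (\<lambda>s.
      iid_vec (mdim n q) (trunc_gaussian \<sigma> (tau n q)) \<bind> (\<lambda>e. Gen \<bind> (\<lambda>(A, t).
       accepting_guess C1 C2 ?k q (mdim n q) A (modv q (A *\<^sub>v s + e)))))) True) / 2"
    unfolding protocol_Q.simps Let_def accepting_guess_def guess_bit_def case_prod_unfold bind_assoc_pmf
      bind_return_pmf
    by (intro pmf_bind_half both_challenges)
  \<comment> \<open>Sampling the key matrix first prepares the exchange of its distribution.\<close>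
  also have "pmf_of_set (Zq_vec q n) \<bind> (\<lambda>s.
      iid_vec (mdim n q) (trunc_gaussian \<sigma> (tau n q)) \<bind> (\<lambda>e. Gen \<bind> (\<lambda>(A, t).
       accepting_guess C1 C2 ?k q (mdim n q) A (modv q (A *\<^sub>v s + e))))) =
    Gen \<bind> (\<lambda>(A, t). pmf_of_set (Zq_vec q n) \<bind> (\<lambda>s. iid_vec (mdim n q) (trunc_gaussian \<sigma> (tau n q)) \<bind> (\<lambda>e.
       accepting_guess C1 C2 ?k q (mdim n q) A (modv q (A *\<^sub>v s + e)))))"
    unfolding case_prod_unfold bind_commute_pmf[of _ Gen] by (rule refl)
  finally show ?thesis .
qed

section \<open>The ciphertext as a shifted subset sum of key rows\<close>

definition key_rows :: "int mat \<Rightarrow> int vec \<Rightarrow> int list list" where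
  "key_rows A v = map (\<lambda>i. sample_row (row A i, v $ i)) [0..<dim_row A]"

text \<open>What the plaintext bit 1 adds to the subset sum.\<close>

definition quarter_row :: "nat \<Rightarrow> nat \<Rightarrow> int list" where
  "quarter_row q n = replicate n 0 @ [\<lfloor>real q / 4\<rfloor>]"

lemma quarter_row_zq_lists: "0 < q \<Longrightarrow> quarter_row q n \<in> zq_lists q (Suc n)"
proof -
  assume "0 < q"
  then have "0 \<le> \<lfloor>real q / 4\<rfloor>" "\<lfloor>real q / 4\<rfloor> < int q"
    by (auto simp: floor_less_iff)
  then show ?thesis
    using \<open>0 < q\<close> by (simp add: quarter_row_def zq_lists_def Zq_def subset_iff)
qed

lemma pmf_of_binary_vecs:
  "pmf_of_set (binary_vecs m) = map_pmf (\<lambda>fs. vec m (\<lambda>i. of_bool (fs ! i))) (replicate_pmf m coin)"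
proof -
  let ?L = "{fs :: bool list. length fs = m \<and> set fs \<subseteq> UNIV}"
  have "bij_betw (\<lambda>fs. vec m (\<lambda>i. of_bool (fs ! i))) ?L (binary_vecs m)"
  proof (rule bij_betw_byWitness[where f' = "\<lambda>f. map (\<lambda>i. f $ i = 1) [0..<m]"])
    show "\<forall>fs\<in>?L. map (\<lambda>i. vec m (\<lambda>i. of_bool (fs ! i)) $ i = (1 :: int)) [0..<m] = fs"
      by (auto intro!: nth_equalityI)
    show "\<forall>f\<in>binary_vecs m. vec m (\<lambda>i. of_bool (map (\<lambda>i. f $ i = 1) [0..<m] ! i)) = f"
      by (intro ballI eq_vecI) (auto simp: binary_vecs_def)
    show "(\<lambda>fs. vec m (\<lambda>i. of_bool (fs ! i))) ` ?L \<subseteq> binary_vecs m"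
      by (auto simp: binary_vecs_def)
    show "(\<lambda>f. map (\<lambda>i. f $ i = 1) [0..<m]) ` binary_vecs m \<subseteq> ?L"
      by auto
  qed
  moreover have "finite ?L"
    using finite_lists_length_eq[of "UNIV :: bool set" m] by simp
  moreover have "?L \<noteq> {}"
    using length_replicate[of m True] by blast
  ultimately have "map_pmf (\<lambda>fs. vec m (\<lambda>i. of_bool (fs ! i))) (pmf_of_set ?L) = pmf_of_set (binary_vecs m)"
    by (intro map_pmf_of_set_bij_betw)
  then show ?thesis
    unfolding coin_def by (subst replicate_pmf_of_set) auto
qed

text \<open>The fold reduces after each addition, the protocol once per scalar product; entrywise
  this is the same.\<close>

lemma row_sum_nth:
  assumes "0 < q" "length fs = length rs" "a \<in> zq_lists q K" "set rs \<subseteq> zq_lists q K" "j < K"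
  shows "row_sum q K a fs rs ! j = (a ! j + (\<Sum>i<length rs. of_bool (fs ! i) * rs ! i ! j)) mod int q"
  using assms(2,3,4)
proof (induction fs rs arbitrary: a rule: list_induct2)
  case Nil
  then show ?case
    using zq_lists_nth[OF Nil(1) assms(5)] by (simp add: row_sum_def)
next
  case (Cons f fs r rs)
  let ?r = "select_row K (f, r)"
  have r: "?r \<in> zq_lists q K"
    using Cons.prems zero_zq_lists[OF assms(1), of K] by (auto simp: select_row_def)
  have "row_sum q K a (f # fs) (r # rs) ! j = row_sum q K (add_mod q a ?r) fs rs ! j"
    by (simp add: row_sum_def)
  also have "\<dots> = (add_mod q a ?r ! j + (\<Sum>i<length rs. of_bool (fs ! i) * rs ! i ! j)) mod int q"
    using Cons.prems r by (intro Cons.IH add_mod_zq_lists assms(1)) auto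
  also have "add_mod q a ?r ! j = (a ! j + of_bool f * r ! j) mod int q"
    using Cons.prems(1) r assms(5) by (auto simp: add_mod_def zq_lists_def select_row_def)
  finally show ?case
    by (simp add: sum.lessThan_Suc_shift mod_simps add.assoc del: sum.lessThan_Suc)
qed

lemma key_rows_zq_lists:
  assumes "A \<in> Zq_mat q m n" "v \<in> Zq_vec q m"
  shows "set (key_rows A v) \<subseteq> zq_lists q (Suc n)" "length (key_rows A v) = m"
proof -
  have "(row A i, v $ i) \<in> Zq_vec q n \<times> Zq q" if "i < m" for i
    using that assms by (auto simp: Zq_mat_def Zq_vec_def)
  then have "sample_row (row A i, v $ i) \<in> zq_lists q (Suc n)" if "i < m" for i
    using that bij_betwE[OF sample_row_bij] by blast
  then show "set (key_rows A v) \<subseteq> zq_lists q (Suc n)" "length (key_rows A v) = m"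
    using assms(1) by (auto simp: key_rows_def Zq_mat_def)
qed

text \<open>Append \<open>v\<close> to \<open>A\<close> as a last column: entry \<open>j\<close> is
  then the scalar product of \<open>f\<close> with column \<open>j\<close>, and the plaintext enters
  only in the last one.\<close>

lemma ciphertext_row_sum:
  assumes q: "0 < q" and A: "A \<in> Zq_mat q m n" and v: "v \<in> Zq_vec q m" and fs: "length fs = m"
  defines "f \<equiv> vec m (\<lambda>i. of_bool (fs ! i))"
  shows "list_of_vec (modv q (transpose_mat A *\<^sub>v f)) @ [(f \<bullet> v + of_bool b * \<lfloor>real q / 4\<rfloor>) mod int q] =
    row_sum q (Suc n) (select_row (Suc n) (b, quarter_row q n)) fs (key_rows A v)"
proof (rule nth_equalityI)
  note rs = key_rows_zq_lists[OF A v]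
  have dim: "dim_row A = m" "dim_col A = n" "dim_vec v = m"
    using A v by (auto simp: Zq_mat_def Zq_vec_def)
  let ?c = "select_row (Suc n) (b, quarter_row q n)"
  have c: "?c \<in> zq_lists q (Suc n)"
    using quarter_row_zq_lists[OF q, of n] zero_zq_lists[OF q, of "Suc n"]
    by (auto simp: select_row_def simp del: replicate_Suc)
  have "length (row_sum q (Suc n) ?c fs (key_rows A v)) = Suc n"
    using row_sum_zq_lists[OF q c rs(1), of fs] by (simp add: zq_lists_def)
  then show "length (list_of_vec (modv q (transpose_mat A *\<^sub>v f)) @ [(f \<bullet> v + of_bool b * \<lfloor>real q / 4\<rfloor>) mod int q]) =
      length (row_sum q (Suc n) ?c fs (key_rows A v))"
    using dim by (simp add: modv_def)
  fix j assume "j < length (list_of_vec (modv q (transpose_mat A *\<^sub>v f)) @ [(f \<bullet> v + of_bool b * \<lfloor>real q / 4\<rfloor>) mod int q])"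
  then have j: "j < Suc n"
    using dim by (simp add: modv_def)
  have R: "row_sum q (Suc n) ?c fs (key_rows A v) ! j =
      (?c ! j + (\<Sum>i<m. of_bool (fs ! i) * key_rows A v ! i ! j)) mod int q"
    using row_sum_nth[OF q _ c rs(1) j, of fs] fs rs(2) by simp
  show "(list_of_vec (modv q (transpose_mat A *\<^sub>v f)) @ [(f \<bullet> v + of_bool b * \<lfloor>real q / 4\<rfloor>) mod int q]) ! j =
      row_sum q (Suc n) ?c fs (key_rows A v) ! j"
  proof (cases "j < n")
    case True
    have "col A j \<bullet> f = (\<Sum>i<m. of_bool (fs ! i) * A $$ (i, j))"
      using True dim by (auto simp: scalar_prod_def f_def atLeast0LessThan mult.commute intro!: sum.cong)
    moreover have "key_rows A v ! i ! j = A $$ (i, j)" if "i < m" for i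
      using that True dim by (simp add: key_rows_def sample_row_def nth_append)
    moreover have "?c ! j = 0"
      using True by (cases b) (simp_all add: select_row_def quarter_row_def nth_append del: replicate_Suc)
    ultimately show ?thesis
      unfolding R using True dim by (simp add: modv_def nth_append)
  next
    case False
    then have jn: "j = n"
      using j by simp
    have "(\<Sum>i<m. of_bool (fs ! i) * key_rows A v ! i ! n) = (\<Sum>i<m. of_bool (fs ! i) * v $ i)"
      using dim by (intro sum.cong refl) (simp add: key_rows_def sample_row_def nth_append)
    also have "\<dots> = f \<bullet> v"
      using dim unfolding scalar_prod_def f_def atLeast0LessThan by (intro sum.cong) auto
    finally have S: "(\<Sum>i<m. of_bool (fs ! i) * key_rows A v ! i ! n) = f \<bullet> v" .
    have "?c ! n = of_bool b * \<lfloor>real q / 4\<rfloor>"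
      by (cases b) (simp_all add: select_row_def quarter_row_def nth_append del: replicate_Suc)
    then show ?thesis
      unfolding R unfolding jn S using dim by (simp add: modv_def nth_append add.commute)
  qed
qed

lemma accepting_guess_eq:
  assumes q: "0 < q" and A: "A \<in> Zq_mat q m n" and v: "v \<in> Zq_vec q m"
  shows "accepting_guess C1 C2 k q m A v = guess_correct C1 C2 k q n (quarter_row q n) (key_rows A v)"
proof -
  have dim: "dim_row A = m" "dim_col A = n" "dim_vec v = m"
    using A v by (auto simp: Zq_mat_def Zq_vec_def)
  have "enc_mat q A = concat (map (\<lambda>r. enc_ints q (take n r)) (key_rows A v))"
    using dim by (simp add: enc_mat_def rows_def key_rows_def sample_row_def comp_def enc_vec_enc_ints)
  moreover have "enc_vec q v = concat (map (\<lambda>r. enc_int q (r ! n)) (key_rows A v))"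
    using dim by (simp add: enc_vec_def list_of_vec_map key_rows_def sample_row_def comp_def nth_append)
  ultimately have rows: "enc_mat q A @ enc_vec q v = enc_rows q n (key_rows A v)"
    by (simp add: enc_rows_def)
  have enc: "enc_mat q A @ enc_vec q v @ enc_vec q a @ enc_int q w =
      enc_rows q n (key_rows A v) @ enc_ints q (list_of_vec a @ [w])" for a w
    unfolding rows[symmetric] by (simp add: enc_ints_append enc_vec_enc_ints) (simp add: enc_ints_def)
  show ?thesis
    unfolding accepting_guess_def guess_correct_def pmf_of_binary_vecs bind_map_pmf enc
      key_rows_zq_lists(2)[OF A v]
    by (intro bind_pmf_cong refl arg_cong2[of _ _ _ _ bind_pmf]
        arg_cong[of _ _ "\<lambda>x. guess_bit C1 C2 k (enc_rows q n (key_rows A v) @ enc_ints q x)"]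
        ciphertext_row_sum[OF q A v]) (simp add: set_replicate_pmf)
qed

section \<open>From the trapdoor matrix to LWE samples\<close>

text \<open>A test changes its acceptance probability by at most the sum of the pointwise
  differences, and \<open>stat_dist\<close> is half of that sum. The factor 2 is generous but
  disappears when the bound on the guess is halved.\<close>

lemma pmf_bind_stat_dist:
  assumes S: "finite S" "set_pmf p \<subseteq> S" "set_pmf p' \<subseteq> S"
  shows "pmf (p \<bind> f) True \<le> pmf (p' \<bind> f) True + 2 * stat_dist p p'"
proof -
  have pf: "pmf (r \<bind> f) True = (\<Sum>x\<in>S. pmf (f x) True * pmf r x)" if "set_pmf r \<subseteq> S" for r
    unfolding pmf_bind using that S(1) by (intro integral_measure_pmf_real) auto
  have "pmf r x = 0" if "set_pmf r \<subseteq> S" "x \<notin> S" for r :: "'a pmf" and x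
    using that by (auto simp: pmf_eq_0_set_pmf)
  then have "(\<Sum>\<^sub>\<infinity>x. \<bar>pmf p x - pmf p' x\<bar>) = (\<Sum>\<^sub>\<infinity>x\<in>S. \<bar>pmf p x - pmf p' x\<bar>)"
    using S(2,3) by (intro infsum_cong_neutral) auto
  then have sd: "2 * stat_dist p p' = (\<Sum>x\<in>S. \<bar>pmf p x - pmf p' x\<bar>)"
    using S(1) by (simp add: stat_dist_def)
  have "pmf (p \<bind> f) True - pmf (p' \<bind> f) True = (\<Sum>x\<in>S. pmf (f x) True * (pmf p x - pmf p' x))"
    by (simp add: pf[OF S(2)] pf[OF S(3)] sum_subtractf right_diff_distrib)
  also have "\<dots> \<le> (\<Sum>x\<in>S. \<bar>pmf p x - pmf p' x\<bar>)"
  proof (rule sum_mono)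
    fix x
    have "pmf (f x) True * (pmf p x - pmf p' x) \<le> pmf (f x) True * \<bar>pmf p x - pmf p' x\<bar>"
      by (intro mult_left_mono) auto
    also have "\<dots> \<le> 1 * \<bar>pmf p x - pmf p' x\<bar>"
      by (intro mult_right_mono) (auto simp: pmf_le_1)
    finally have "pmf (f x) True * (pmf p x - pmf p' x) \<le> 1 * \<bar>pmf p x - pmf p' x\<bar>" .
    then show "pmf (f x) True * (pmf p x - pmf p' x) \<le> \<bar>pmf p x - pmf p' x\<bar>"
      by simp
  qed
  finally show ?thesis
    using sd by simp
qed

text \<open>Regroups independent draws: the key is drawn as all rows of the matrix and then all
  errors, the oracle draws a row and its error together.\<close>

lemma replicate_pmf_map2:
  "replicate_pmf m p \<bind> (\<lambda>xs. map_pmf (\<lambda>ys. map2 h xs ys) (replicate_pmf m r)) =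
     replicate_pmf m (p \<bind> (\<lambda>x. map_pmf (h x) r))"
proof (induction m)
  case (Suc m)
  let ?P = "replicate_pmf m p" and ?R = "replicate_pmf m r"
  have "replicate_pmf (Suc m) p \<bind> (\<lambda>xs. map_pmf (\<lambda>ys. map2 h xs ys) (replicate_pmf (Suc m) r)) =
      p \<bind> (\<lambda>x. ?P \<bind> (\<lambda>xs. r \<bind> (\<lambda>y. ?R \<bind> (\<lambda>ys. return_pmf (h x y # map2 h xs ys)))))"
    by (simp add: map_bind_pmf bind_assoc_pmf bind_return_pmf)
  also have "\<dots> = p \<bind> (\<lambda>x. r \<bind> (\<lambda>y. ?P \<bind> (\<lambda>xs. ?R \<bind> (\<lambda>ys. return_pmf (h x y # map2 h xs ys)))))"
    by (subst bind_commute_pmf[of ?P]) (rule refl)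
  also have "\<dots> = p \<bind> (\<lambda>x. r \<bind> (\<lambda>y. (?P \<bind> (\<lambda>xs. map_pmf (\<lambda>ys. map2 h xs ys) ?R)) \<bind>
      (\<lambda>zs. return_pmf (h x y # zs))))"
    by (simp only: bind_assoc_pmf bind_map_pmf)
  also have "\<dots> = replicate_pmf (Suc m) (p \<bind> (\<lambda>x. map_pmf (h x) r))"
    unfolding Suc.IH by (simp add: bind_assoc_pmf bind_map_pmf)
  finally show ?case .
qed simp

lemma Zq_mat_bij:
  "bij_betw (mat_of_rows n) {rs. length rs = m \<and> set rs \<subseteq> Zq_vec q n} (Zq_mat q m n)"
proof (rule bij_betw_byWitness[where f' = rows])
  let ?L = "{rs. length rs = m \<and> set rs \<subseteq> Zq_vec q n}"
  have carrier: "set rs \<subseteq> carrier_vec n" if "rs \<in> ?L" for rs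
    using that by (auto simp: Zq_vec_def)
  then show "\<forall>rs\<in>?L. rows (mat_of_rows n rs) = rs"
    using rows_mat_of_rows by blast
  show "\<forall>A\<in>Zq_mat q m n. mat_of_rows n (rows A) = A"
    using mat_of_rows_rows by (auto simp: Zq_mat_def)
  show "mat_of_rows n ` ?L \<subseteq> Zq_mat q m n"
  proof (rule image_subsetI)
    fix rs assume rs: "rs \<in> ?L"
    then have "rs ! i \<in> Zq_vec q n" if "i < m" for i
      using nth_mem[of i rs] that by auto
    then have "rs ! i $ j \<in> Zq q" if "i < m" "j < n" for i j
      using that by (auto simp: Zq_vec_def)
    then show "mat_of_rows n rs \<in> Zq_mat q m n"
      using rs by (auto simp: Zq_mat_def mat_of_rows_index)
  qed
  show "rows ` Zq_mat q m n \<subseteq> ?L"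
    by (auto simp: rows_def Zq_mat_def Zq_vec_def)
qed

lemma finite_Zq_vec_lists: "finite {rs. length rs = m \<and> set rs \<subseteq> Zq_vec q n}"
  using finite_lists_length_eq[OF finite_Zq_vec, of q n m] by (simp add: conj_commute)

lemma finite_Zq_mat: "finite (Zq_mat q m n)"
  using bij_betw_finite[OF Zq_mat_bij] finite_Zq_vec_lists by blast

lemma Zq_vec_lists_nonempty: "0 < q \<Longrightarrow> {rs. length rs = m \<and> set rs \<subseteq> Zq_vec q n} \<noteq> {}"
proof -
  assume "0 < q"
  then have "replicate m (0\<^sub>v n) \<in> {rs. length rs = m \<and> set rs \<subseteq> Zq_vec q n}"
    using zero_Zq_vec[of q n] by auto
  then show ?thesis
    by blast
qed

lemma Zq_mat_nonempty: "0 < q \<Longrightarrow> Zq_mat q m n \<noteq> {}"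
  using Zq_vec_lists_nonempty[of q m n] bij_betw_imp_surj_on[OF Zq_mat_bij, of n m q] by blast

lemma pmf_of_Zq_mat:
  assumes "0 < q"
  shows "pmf_of_set (Zq_mat q m n) = map_pmf (mat_of_rows n) (replicate_pmf m (pmf_of_set (Zq_vec q n)))"
proof -
  have "replicate_pmf m (pmf_of_set (Zq_vec q n)) = pmf_of_set {rs. length rs = m \<and> set rs \<subseteq> Zq_vec q n}"
    using zero_Zq_vec[OF assms, of n] by (intro replicate_pmf_of_set finite_Zq_vec) auto
  then show ?thesis
    using map_pmf_of_set_bij_betw[OF Zq_mat_bij Zq_vec_lists_nonempty[OF assms] finite_Zq_vec_lists, of n m]
    by simp
qed

lemma modv_Zq_vec: "0 < q \<Longrightarrow> v \<in> carrier_vec m \<Longrightarrow> modv q v \<in> Zq_vec q m"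
  by (auto simp: modv_def Zq_vec_def Zq_def)

text \<open>The rows of a uniform matrix are independent and uniform, so each of them, with its
  entry of \<open>v\<close>, is a fresh LWE sample for the common secret \<open>s\<close>.\<close>

lemma uniform_matrix_guess:
  assumes q: "0 < q"
  shows "pmf_of_set (Zq_mat q m n) \<bind> (\<lambda>A. pmf_of_set (Zq_vec q n) \<bind> (\<lambda>s. iid_vec m \<chi> \<bind> (\<lambda>e.
      accepting_guess C1 C2 k q m A (modv q (A *\<^sub>v s + e))))) =
    pmf_of_set (Zq_vec q n) \<bind> (\<lambda>s. replicate_pmf m (map_pmf sample_row (lwe_dist n q \<chi> s)) \<bind>
      guess_correct C1 C2 k q n (quarter_row q n))"
proof -
  let ?V = "pmf_of_set (Zq_vec q n)"
  let ?G = "guess_correct C1 C2 k q n (quarter_row q n)"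
  let ?h = "\<lambda>s a e. sample_row (a, (a \<bullet> s + e) mod int q)"
  have V: "set_pmf ?V = Zq_vec q n"
    using zero_Zq_vec[OF q, of n] by (intro set_pmf_of_set finite_Zq_vec) auto
  have "accepting_guess C1 C2 k q m (mat_of_rows n as) (modv q (mat_of_rows n as *\<^sub>v s + vec_of_list es)) =
      ?G (map2 (?h s) as es)"
    if as: "as \<in> set_pmf (replicate_pmf m ?V)" and es: "es \<in> set_pmf (replicate_pmf m \<chi>)" for as es s
  proof -
    have las: "length as = m" "set as \<subseteq> Zq_vec q n" and les: "length es = m"
      using as es V by (auto simp: set_replicate_pmf)
    let ?A = "mat_of_rows n as"
    let ?v = "modv q (?A *\<^sub>v s + vec_of_list es)"
    have A: "?A \<in> Zq_mat q m n"
      using bij_betwE[OF Zq_mat_bij] las by blast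
    have v: "?v \<in> Zq_vec q m"
      using las les by (intro modv_Zq_vec[OF q] carrier_vecI) simp
    have "key_rows ?A ?v = map2 (?h s) as es"
    proof (rule nth_equalityI)
      show "length (key_rows ?A ?v) = length (map2 (?h s) as es)"
        using las les by (simp add: key_rows_def)
      fix i assume "i < length (key_rows ?A ?v)"
      then have i: "i < m"
        using las by (simp add: key_rows_def)
      then have "as ! i \<in> Zq_vec q n"
        using las nth_mem[of i as] by auto
      then have "as ! i \<in> carrier_vec n"
        by (simp add: Zq_vec_def)
      then show "key_rows ?A ?v ! i = map2 (?h s) as es ! i"
        using i las les by (simp add: key_rows_def modv_def vec_of_list_index)
    qed
    then show ?thesis
      using accepting_guess_eq[OF q A v] by simp
  qed
  then have 1: "replicate_pmf m ?V \<bind> (\<lambda>as. replicate_pmf m \<chi> \<bind> (\<lambda>es.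
      accepting_guess C1 C2 k q m (mat_of_rows n as) (modv q (mat_of_rows n as *\<^sub>v s + vec_of_list es)))) =
    replicate_pmf m ?V \<bind> (\<lambda>as. replicate_pmf m \<chi> \<bind> (\<lambda>es. ?G (map2 (?h s) as es)))" for s
    by (intro bind_pmf_cong refl)
  have 2: "replicate_pmf m ?V \<bind> (\<lambda>as. replicate_pmf m \<chi> \<bind> (\<lambda>es. ?G (map2 (?h s) as es))) =
      replicate_pmf m (?V \<bind> (\<lambda>a. map_pmf (?h s a) \<chi>)) \<bind> ?G" for s
    unfolding replicate_pmf_map2[symmetric] by (simp add: bind_assoc_pmf bind_map_pmf)
  have 3: "?V \<bind> (\<lambda>a. map_pmf (?h s a) \<chi>) = map_pmf sample_row (lwe_dist n q \<chi> s)" for s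
    by (simp add: lwe_dist_def map_pmf_def bind_assoc_pmf bind_return_pmf)
  show ?thesis
    unfolding pmf_of_Zq_mat[OF q] bind_map_pmf iid_vec_def
    unfolding bind_commute_pmf[of "replicate_pmf m ?V" ?V] 1 2 3 by (rule refl)
qed

section \<open>The reduction and its asymptotics\<close>

lemma le_power_Qlen:
  assumes "0 < q"
  shows "q \<le> 2 ^ Qlen q"
proof -
  have "real q = 2 powr log 2 (real q)"
    using assms by simp
  also have "\<dots> \<le> 2 powr real (Qlen q)"
    unfolding Qlen_def by (intro powr_mono) (auto simp: real_nat_ceiling_ge)
  also have "\<dots> = real (2 ^ Qlen q)"
    by (simp add: powr_realpow)
  finally show ?thesis
    by (simp only: of_nat_le_iff)
qed

section \<open>Size and error bounds for a fixed security parameter\<close>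

text \<open>The bound of \<open>distinguisher_circuit\<close>, inserted into that of
  \<open>sampling_circuit_quantum\<close>.\<close>

definition solver_size :: "nat \<Rightarrow> nat \<Rightarrow> nat \<Rightarrow> nat \<Rightarrow> nat \<Rightarrow> nat" where
  "solver_size n m Q c1 c2 = m * (Suc n * Q) + m + 3 * (2 * (1 + m) +
     (Suc n * Q * 10 + m * (Suc n * Q * 10 + Suc n * (Q + Q + 500 * (Q + 2)))) +
     (c1 + 2 * c2 + 36) + 34) + 2"

lemma lwe_solver:
  assumes q: "0 < q"
    and C1: "wf_circuit (m * n * Qlen q + m * Qlen q + n * Qlen q + Qlen q) (k + mem) C1"
    and C2: "wf_circuit (1 + mem) 1 C2"
  shows "\<exists>C. wf_qcircuit (Suc n * Qlen q) C \<and>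
    qcircuit_size C \<le> solver_size n m (Qlen q) (circuit_size C1) (circuit_size C2) \<and>
    (\<forall>\<chi>. pmf (lwe_experiment n q \<chi> C) True = 1 / 2 +
      (pmf (pmf_of_set (Zq_vec q n) \<bind> (\<lambda>s. replicate_pmf m (map_pmf sample_row (lwe_dist n q \<chi> s)) \<bind>
         guess_correct C1 C2 k q n (quarter_row q n))) True -
       pmf (replicate_pmf m (pmf_of_set (zq_lists q (Suc n))) \<bind>
         guess_correct C1 C2 k q n (quarter_row q n)) True) / 2)"
proof -
  have q2: "int q \<le> 2 ^ Qlen q"
    using le_power_Qlen[OF q] by simp
  obtain D where D: "wf_circuit (m * (Suc n * Qlen q)) 1 D"
    "circuit_size D \<le> 2 * (1 + m) + (Suc n * Qlen q * 10 + m * (Suc n * Qlen q * 10 +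
       Suc n * (Qlen q + Qlen q + 500 * (Qlen q + 2)))) + (circuit_size C1 + 2 * circuit_size C2 + 36) + 34"
    and D': "\<And>rs. length rs = m \<Longrightarrow> set rs \<subseteq> zq_lists q (Suc n) \<Longrightarrow>
      map_pmf hd (run_circuit D (concat (map (enc_ints q) rs))) =
      map_pmf HOL.Not (guess_correct C1 C2 k q n (quarter_row q n) rs)"
    using distinguisher_circuit[OF q q2 quarter_row_zq_lists[OF q] C1 C2] by blast
  obtain C where C: "wf_qcircuit (Suc n * Qlen q) C"
    "qcircuit_size C \<le> m * (Suc n * Qlen q) + m + 3 * circuit_size D + 2"
    and C': "\<And>E. \<forall>z \<in> set_pmf E. length z = Suc n * Qlen q \<Longrightarrow>
      run_qcircuit E C = replicate_pmf m E \<bind> (\<lambda>zs. map_pmf hd (run_circuit D (concat zs)))"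
    using sampling_circuit_quantum[OF D(1)] by blast
  have "qcircuit_size C \<le> solver_size n m (Qlen q) (circuit_size C1) (circuit_size C2)"
    unfolding solver_size_def
    by (rule order_trans[OF C(2)], intro add_right_mono add_left_mono mult_left_mono D(2)) simp
  then show ?thesis
    using C(1) lwe_experiment_distinguisher[OF q C' D'] by blast
qed

text \<open>For \<open>n \<ge> 1\<close> the dimension 2 n Q + n is at least (n + 1) Q + n, and q is
  at most 2^Q; so the quotient under the root is at most 2^(-n).\<close>

lemma hash_bound:
  assumes "0 < q" "1 \<le> n"
  shows "sqrt (real (q ^ Suc n) / 2 ^ mdim n q) \<le> 2 powr (- real n / 2)"
proof -
  let ?Q = "Qlen q"
  have "?Q * Suc n + n \<le> mdim n q"
  proof -
    have "?Q \<le> n * ?Q"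
      using assms(2) by simp
    then show ?thesis
      by (simp add: mdim_def algebra_simps)
  qed
  then have "q ^ Suc n * 2 ^ n \<le> 2 ^ mdim n q"
  proof -
    assume le: "?Q * Suc n + n \<le> mdim n q"
    have "q ^ Suc n * 2 ^ n \<le> (2 ^ ?Q) ^ Suc n * 2 ^ n"
      by (intro mult_right_mono power_mono le_power_Qlen assms(1)) auto
    also have "\<dots> = 2 ^ (?Q * Suc n + n)"
      by (simp only: power_mult power_add)
    also have "\<dots> \<le> 2 ^ mdim n q"
      using le by (intro power_increasing) auto
    finally show ?thesis .
  qed
  then have "real (q ^ Suc n * 2 ^ n) \<le> real (2 ^ mdim n q)"
    by (simp only: of_nat_le_iff)
  then have "real (q ^ Suc n) / 2 ^ mdim n q \<le> 1 / 2 ^ n"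
    by (simp add: field_simps)
  also have "\<dots> = (2 powr (- real n / 2))\<^sup>2"
    by (simp add: powr_minus power2_eq_square powr_realpow field_simps flip: powr_add)
  finally have "sqrt (real (q ^ Suc n) / 2 ^ mdim n q) \<le> sqrt ((2 powr (- real n / 2))\<^sup>2)"
    by (rule real_sqrt_le_mono)
  then show ?thesis
    by simp
qed

text \<open>Collects the errors for a single parameter. The hypothesis \<open>lwe\<close> is the
  hardness bound for the circuit of \<open>lwe_solver\<close>, with its success probability written
  out.\<close>

lemma protocol_Q_bound:
  fixes C1 C2 :: circuit
  assumes q: "0 < q" and n: "1 \<le> n"
    and Gen: "\<And>A t. (A, t) \<in> set_pmf Gen \<Longrightarrow> A \<in> Zq_mat q (mdim n q) n"
  defines "k \<equiv> mdim n q * Qlen q + n * Qlen q"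
  defines "G \<equiv> guess_correct C1 C2 k q n (quarter_row q n)"
  assumes lwe: "1 / 2 +
      (pmf (pmf_of_set (Zq_vec q n) \<bind> (\<lambda>s. replicate_pmf (mdim n q) (map_pmf sample_row
         (lwe_dist n q (trunc_gaussian \<sigma> (tau n q)) s)) \<bind> G)) True -
       pmf (replicate_pmf (mdim n q) (pmf_of_set (zq_lists q (Suc n))) \<bind> G) True) / 2 \<le> 1 / 2 + \<epsilon>"
  shows "pmf (protocol_Q n q \<sigma> Gen Inv C1 C2) True \<le>
    3 / 4 + (stat_dist (map_pmf fst Gen) (pmf_of_set (Zq_mat q (mdim n q) n)) + \<epsilon> + 2 powr (- real n / 2))"
proof -
  let ?m = "mdim n q"
  let ?U = "pmf_of_set (Zq_mat q ?m n)"
  define K where "K A = pmf_of_set (Zq_vec q n) \<bind> (\<lambda>s. iid_vec ?m (trunc_gaussian \<sigma> (tau n q)) \<bind>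
    (\<lambda>e. accepting_guess C1 C2 k q ?m A (modv q (A *\<^sub>v s + e))))" for A
  \<comment> \<open>\<open>g\<close>, \<open>u\<close> and \<open>w\<close> are the probabilities of
    a correct guess with the trapdoor matrix, with a uniform matrix and with uniform rows;
    \<open>d\<close> and \<open>x\<close> are the statistical distance and the hash error. Halving
    \<open>g\<close> absorbs the factors 2 that come with \<open>d\<close> and
    \<open>\<epsilon>\<close>.\<close>
  have arith: "P \<le> 3 / 4 + (d + \<epsilon> + h)" if "P \<le> (1 + g) / 2" "g \<le> u + 2 * d" "u = r" "w \<le> 1 / 2 + x"
    "x \<le> h" "1 / 2 + (r - w) / 2 \<le> 1 / 2 + \<epsilon>" "0 \<le> h" for P d h g u r w x :: real
    using that by argo
  have "pmf (protocol_Q n q \<sigma> Gen Inv C1 C2) True \<le> (1 + pmf (map_pmf fst Gen \<bind> K) True) / 2"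
    using protocol_Q_le_guess[of n q \<sigma> Gen Inv C1 C2]
    unfolding K_def k_def bind_map_pmf case_prod_unfold .
  moreover have "pmf (map_pmf fst Gen \<bind> K) True \<le>
      pmf (?U \<bind> K) True + 2 * stat_dist (map_pmf fst Gen) ?U"
  proof (rule pmf_bind_stat_dist)
    show "set_pmf (map_pmf fst Gen) \<subseteq> Zq_mat q ?m n"
      using Gen by auto
    show "set_pmf ?U \<subseteq> Zq_mat q ?m n"
      using Zq_mat_nonempty[OF q, of ?m n] finite_Zq_mat[of q ?m n] by simp
  qed (rule finite_Zq_mat)
  moreover have "pmf (?U \<bind> K) True = pmf (pmf_of_set (Zq_vec q n) \<bind> (\<lambda>s. replicate_pmf ?m
      (map_pmf sample_row (lwe_dist n q (trunc_gaussian \<sigma> (tau n q)) s)) \<bind> G)) True"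
    unfolding K_def G_def uniform_matrix_guess[OF q] by (rule refl)
  moreover have "pmf (replicate_pmf ?m (pmf_of_set (zq_lists q (Suc n))) \<bind> G) True \<le>
      1 / 2 + sqrt (real (q ^ Suc n) / 2 ^ ?m)"
    unfolding G_def by (rule guess_correct_uniform[OF q quarter_row_zq_lists[OF q]])
  moreover note hash_bound[OF q n] lwe powr_ge_zero[of 2 "- real n / 2"]
  ultimately show ?thesis
    by (rule arith)
qed

section \<open>Polynomially bounded and negligible functions\<close>

lemma poly_bounded_const: "poly_bounded (\<lambda>l. c)"
  unfolding poly_bounded_def by (intro exI[of _ 0]) simp

lemma poly_bounded_id: "poly_bounded real"
  unfolding poly_bounded_def by (intro exI[of _ 1]) simp

lemma poly_bounded_mult:
  assumes "poly_bounded f" "poly_bounded g"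
  shows "poly_bounded (\<lambda>l. f l * g l)"
proof -
  obtain j k where "f \<in> O(\<lambda>l. real l ^ j)" "g \<in> O(\<lambda>l. real l ^ k)"
    using assms unfolding poly_bounded_def by blast
  then have "(\<lambda>l. f l * g l) \<in> O(\<lambda>l. real l ^ (j + k))"
    unfolding power_add by (rule landau_o.big.mult)
  then show ?thesis
    unfolding poly_bounded_def by blast
qed

lemma bigo_power_mono:
  assumes "f \<in> O(\<lambda>l::nat. real l ^ j)" "j \<le> k"
  shows "f \<in> O(\<lambda>l. real l ^ k)"
proof -
  have "(\<lambda>l. real l ^ j) \<in> O(\<lambda>l. real l ^ k)"
  proof (rule landau_o.big_mono)
    show "\<forall>\<^sub>F l in sequentially. norm (real l ^ j) \<le> norm (real l ^ k)"
      using eventually_ge_at_top[of 1]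
      by eventually_elim (use assms(2) in \<open>auto intro: power_increasing\<close>)
  qed
  then show ?thesis
    using assms(1) landau_o.big_trans by blast
qed

lemma poly_bounded_add:
  assumes "poly_bounded f" "poly_bounded g"
  shows "poly_bounded (\<lambda>l. f l + g l)"
proof -
  obtain j k where "f \<in> O(\<lambda>l. real l ^ j)" "g \<in> O(\<lambda>l. real l ^ k)"
    using assms unfolding poly_bounded_def by blast
  then have "f \<in> O(\<lambda>l. real l ^ max j k)" "g \<in> O(\<lambda>l. real l ^ max j k)"
    by (auto elim: bigo_power_mono)
  then have "(\<lambda>l. f l + g l) \<in> O(\<lambda>l. real l ^ max j k)"
    by (rule sum_in_bigo)
  then show ?thesis
    unfolding poly_bounded_def by blast
qed

lemma poly_bounded_le:
  assumes "poly_bounded g" "\<And>l. l \<ge> 1 \<Longrightarrow> 0 \<le> f l \<and> f l \<le> g l"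
  shows "poly_bounded f"
proof -
  obtain k where "g \<in> O(\<lambda>l. real l ^ k)"
    using assms(1) unfolding poly_bounded_def by blast
  moreover have "f \<in> O(g)"
  proof (rule landau_o.big_mono)
    show "\<forall>\<^sub>F l in sequentially. norm (f l) \<le> norm (g l)"
      using eventually_ge_at_top[of 1] by eventually_elim (use assms(2) in fastforce)
  qed
  ultimately show ?thesis
    unfolding poly_bounded_def using landau_o.big_trans by blast
qed

lemma poly_bounded_Qlen:
  assumes "poly_bounded (\<lambda>l. log 2 (real (q l)))" "\<And>l. l \<ge> 1 \<Longrightarrow> 0 < q l"
  shows "poly_bounded (\<lambda>l. real (Qlen (q l)))"
proof (rule poly_bounded_le[OF poly_bounded_add[OF assms(1) poly_bounded_const[of 1]]])
  fix l :: nat assume "l \<ge> 1"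
  then have "0 \<le> log 2 (real (q l))"
    using assms(2)[of l] by simp
  then show "0 \<le> real (Qlen (q l)) \<and> real (Qlen (q l)) \<le> log 2 (real (q l)) + 1"
    unfolding Qlen_def by (auto intro: less_imp_le)
qed

lemma negligible_fun_add: "negligible_fun f \<Longrightarrow> negligible_fun g \<Longrightarrow> negligible_fun (\<lambda>l. f l + g l)"
  unfolding negligible_fun_def by (auto intro: sum_in_bigo)

lemma negligible_poly_exp:
  assumes "poly_bounded f" "\<And>l. 0 \<le> f l"
  shows "negligible_fun (\<lambda>l. f l * 2 powr (- real l / 2))"
  unfolding negligible_fun_def
proof (intro conjI allI impI)
  fix C :: real
  obtain k where "f \<in> O(\<lambda>l. real l ^ k)"
    using assms(1) unfolding poly_bounded_def by blast
  then have "(\<lambda>l. f l * 2 powr (- real l / 2)) \<in> O(\<lambda>l. real l ^ k * 2 powr (- real l / 2))"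
    by (intro landau_o.big.mult) auto
  also have "(\<lambda>l. real l ^ k * 2 powr (- real l / 2)) \<in> O(\<lambda>l. real l powr - C)"
    by real_asymp
  finally show "(\<lambda>l. f l * 2 powr (- real l / 2)) \<in> O(\<lambda>l. real l powr - C)" .
qed (use assms(2) in simp)

theorem theorem5p3:
  fixes q :: "nat \<Rightarrow> nat" and \<sigma> :: "nat \<Rightarrow> real"
    and GenTrap :: "nat \<Rightarrow> (int mat \<times> bool list) pmf"
    and Invert :: "nat \<Rightarrow> int mat \<Rightarrow> int vec \<Rightarrow> bool list \<Rightarrow> int vec"
    and FirstResponse SecondResponse :: "nat \<Rightarrow> circuit"
    and mem :: "nat \<Rightarrow> nat"
  defines "Q \<equiv> \<lambda>l. Qlen (q l)" and "m \<equiv> \<lambda>l. mdim l (q l)" and "\<tau> \<equiv> \<lambda>l. tau l (q l)"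
  assumes "poly_bounded (\<lambda>l. log 2 (real (q l)))"
    and "poly_bounded (\<lambda>l. log 2 (\<sigma> l))"
    and "\<And>l. l \<ge> 1 \<Longrightarrow> \<sigma> l \<ge> 1"
    and "\<And>l. l \<ge> 1 \<Longrightarrow> prime (q l) \<and> odd (q l)"
    and "gentrap_poly_time q GenTrap"
    and "invert_poly_time q Invert"
    and "\<And>l A y t. l \<ge> 1 \<Longrightarrow> A \<in> Zq_mat (q l) (m l) l \<Longrightarrow> y \<in> Zq_vec (q l) (m l) \<Longrightarrow>
           Invert l A y t \<in> Zq_vec (q l) l"
    and "\<And>l A t. l \<ge> 1 \<Longrightarrow> (A, t) \<in> set_pmf (GenTrap l) \<Longrightarrow> A \<in> Zq_mat (q l) (m l) l"
    and "\<And>l. l \<ge> 1 \<Longrightarrow>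
           stat_dist (map_pmf fst (GenTrap l)) (pmf_of_set (Zq_mat (q l) (m l) l))
             \<le> real l * real (Q l) * 2 powr (- real l / 2)"
    and "\<And>l A t s e. l \<ge> 1 \<Longrightarrow> (A, t) \<in> set_pmf (GenTrap l) \<Longrightarrow>
           s \<in> Zq_vec (q l) l \<Longrightarrow> e \<in> Zq_vec (q l) (m l) \<Longrightarrow>
           real_of_int (linf_norm (q l) e) \<le> 2 * \<tau> l \<Longrightarrow>
           Invert l A (modv (q l) (A *\<^sub>v s + e)) t = s"
    and "lwe_hard (\<lambda>l. l) q (\<lambda>l. trunc_gaussian (\<sigma> l) (\<tau> l))"
    and "nonuniform_ppt
           (\<lambda>l. m l * l * Q l + m l * Q l + l * Q l + Q l)
           (\<lambda>l. m l * Q l + l * Q l + mem l) FirstResponse"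
    and "nonuniform_ppt (\<lambda>l. 1 + mem l) (\<lambda>l. 1) SecondResponse"
  shows "\<exists>negl. negligible_fun negl \<and>
           (\<forall>l\<ge>1. pmf (protocol_Q l (q l) (\<sigma> l) (GenTrap l) (Invert l)
                        (FirstResponse l) (SecondResponse l)) True
                    \<le> 3/4 + negl l)"
proof -
  note poly_q = assms(4) and prime_q = assms(7) and Gen = assms(11) and Gen_dist = assms(12)
    and hard = assms(14) and first = assms(15) and second = assms(16)
  have q: "0 < q l" if "l \<ge> 1" for l
    using prime_q[OF that] prime_gt_0_nat by blast
  let ?G = "\<lambda>l. guess_correct (FirstResponse l) (SecondResponse l) (m l * Q l + l * Q l) (q l) l
    (quarter_row (q l) l)"
  let ?S = "\<lambda>l. solver_size l (m l) (Q l) (circuit_size (FirstResponse l)) (circuit_size (SecondResponse l))"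
  let ?adv = "\<lambda>l. 1 / 2 +
      (pmf (pmf_of_set (Zq_vec (q l) l) \<bind> (\<lambda>s. replicate_pmf (m l) (map_pmf sample_row
         (lwe_dist l (q l) (trunc_gaussian (\<sigma> l) (\<tau> l)) s)) \<bind> ?G l)) True -
       pmf (replicate_pmf (m l) (pmf_of_set (zq_lists (q l) (Suc l))) \<bind> ?G l) True) / 2"
  \<comment> \<open>The condition \<open>l \<ge> 1\<close> stands inside the quantifier, so that
    choice yields a family on all numbers, with an arbitrary circuit at 0.\<close>
  have "\<exists>C. l \<ge> 1 \<longrightarrow> wf_qcircuit ((l + 1) * Qlen (q l)) C \<and> qcircuit_size C \<le> ?S l \<and>
      pmf (lwe_experiment l (q l) (trunc_gaussian (\<sigma> l) (\<tau> l)) C) True = ?adv l" for l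
  proof (cases "l \<ge> 1")
    case True
    have "wf_circuit (m l * l * Q l + m l * Q l + l * Q l + Q l) (m l * Q l + l * Q l + mem l) (FirstResponse l)"
      "wf_circuit (1 + mem l) 1 (SecondResponse l)"
      using first second True unfolding nonuniform_ppt_def by blast+
    from lwe_solver[OF q[OF True] this[unfolded Q_def]] show ?thesis
      unfolding Q_def by (simp only: Suc_eq_plus1) blast
  qed simp
  then have "\<exists>C. \<forall>l. l \<ge> 1 \<longrightarrow> wf_qcircuit ((l + 1) * Qlen (q l)) (C l) \<and> qcircuit_size (C l) \<le> ?S l \<and>
      pmf (lwe_experiment l (q l) (trunc_gaussian (\<sigma> l) (\<tau> l)) (C l)) True = ?adv l"
    by (intro choice allI)
  then obtain C where C: "\<And>l. l \<ge> 1 \<Longrightarrow> wf_qcircuit ((l + 1) * Qlen (q l)) (C l)"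
    "\<And>l. l \<ge> 1 \<Longrightarrow> qcircuit_size (C l) \<le> ?S l"
    "\<And>l. l \<ge> 1 \<Longrightarrow> pmf (lwe_experiment l (q l) (trunc_gaussian (\<sigma> l) (\<tau> l)) (C l)) True = ?adv l"
    by blast
  have poly_Q: "poly_bounded (\<lambda>l. real (Q l))"
    unfolding Q_def by (rule poly_bounded_Qlen[OF poly_q q])
  have "real (m l) = real l * (2 * real (Q l) + 1)" for l
    by (simp add: m_def mdim_def Q_def algebra_simps)
  then have poly_m: "poly_bounded (\<lambda>l. real (m l))"
    by (simp only:) (intro poly_bounded_mult poly_bounded_add poly_bounded_const poly_bounded_id poly_Q)
  have "poly_bounded (\<lambda>l. real (?S l))"
    using first second unfolding solver_size_def nonuniform_ppt_def of_nat_add of_nat_mult of_nat_Suc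
    by (intro poly_bounded_add poly_bounded_mult poly_bounded_const poly_bounded_id poly_Q poly_m) auto
  then have "poly_bounded (\<lambda>l. real (qcircuit_size (C l)))"
    by (rule poly_bounded_le) (use C(2) in simp)
  then obtain \<epsilon> where \<epsilon>: "negligible_fun \<epsilon>"
    "\<And>l. l \<ge> 1 \<Longrightarrow> pmf (lwe_experiment l (q l) (trunc_gaussian (\<sigma> l) (\<tau> l)) (C l)) True \<le> 1 / 2 + \<epsilon> l"
    using hard C(1) unfolding lwe_hard_def by blast
  \<comment> \<open>Distance of the trapdoor matrix from uniform, advantage of the solver, error of
    the hash lemma. The factor 1 brings the last term into the form of
    \<open>negligible_poly_exp\<close>.\<close>
  let ?negl = "\<lambda>l. (real l * real (Q l) * 2 powr (- real l / 2) + \<epsilon> l) + 1 * 2 powr (- real l / 2)"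
  have "negligible_fun ?negl"
    by (intro negligible_fun_add negligible_poly_exp poly_bounded_mult poly_bounded_id poly_Q
        poly_bounded_const \<epsilon>) auto
  moreover have "pmf (protocol_Q l (q l) (\<sigma> l) (GenTrap l) (Invert l) (FirstResponse l) (SecondResponse l)) True
      \<le> 3 / 4 + ?negl l" if l: "l \<ge> 1" for l
  proof -
    have adv: "?adv l \<le> 1 / 2 + \<epsilon> l"
      using \<epsilon>(2)[OF l] C(3)[OF l] by simp
    have "pmf (protocol_Q l (q l) (\<sigma> l) (GenTrap l) (Invert l) (FirstResponse l) (SecondResponse l)) True
      \<le> 3 / 4 + (stat_dist (map_pmf fst (GenTrap l)) (pmf_of_set (Zq_mat (q l) (m l) l)) + \<epsilon> l +
          2 powr (- real l / 2))"
      using protocol_Q_bound[OF q[OF l] l Gen[OF l, unfolded m_def] adv[unfolded m_def Q_def \<tau>_def]]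
      unfolding m_def .
    then show ?thesis
      using Gen_dist[OF l] by (simp del: protocol_Q.simps)
  qed
  ultimately show ?thesis
    by blast
qed

end
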